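(* Let $\mathscr{P}$ be a $C^*$-planar algebra and let $x\in\mathscr{P}_{2,\pm}$ be $\mathfrak{F}$-positive. Let $r$ be the spectral radius of $x$ (in the finite-dimensional algebra $\mathscr{P}_{2,\pm}$). Then there exists a non-zero $\mathfrak{F}$-positive element $y\in\mathscr{P}_{2,\pm}$ such that $$xy=yx=r\,y .$$ Equivalently, $\widehat{x}*\widehat{y}=\widehat{y}*\widehat{x}=r\,\widehat{y}$.
   Context: $C^*$-planar algebra: a (shaded) planar algebra in the sense of Jones is a family $\mathscr{P}=\{\mathscr{P}_{n,\pm}\}_{n\ge 0}$ of complex vector spaces on which shaded planar tangles act multilinearly, compatibly with isotopy and composition of tangles. Elements of $\mathscr{P}_{n,\pm}$ are boxes with $n$ strings attached on top and $n$ on the bottom; the region at the left (marked) side is unshaded for $+$ and shaded for $-$. It is a $C^*$-planar algebra if each $\mathscr{P}_{n,\pm}$ is a finite-dimensional unital $C^*$-algebra for the vertical stacking product ($xy$ is drawn with $y$ above $x$), the involution $*$ is compatible with reflection of tangles in a horizontal line, and there are positive faithful traces $tr_{n,\pm}$ with $tr_{n,\pm}(x)=tr_{0,\pm}$(closure of $x$), the closure joining each top string to the corresponding bottom string. Fourier transform: $\mathfrak{F}:\mathscr{P}_{2,\pm}\to\mathscr{P}_{2,\mp}$, $\widehat{x}=\mathfrak{F}(x)$, is the $90^\circ$ rotation: the top-left, top-right, bottom-left, bottom-right boundary points of $\widehat{x}$ are connected respectively to the bottom-left, top-left, bottom-right, top-right points of $x$. Convolution of $2$-boxes: for $u,v$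 in the same space $\mathscr{P}_{2,\pm}$, $u*v$ is obtained by placing $u$ to the left of $v$ and joining the top-right point of $u$ to the top-left point of $v$ and the bottom-right point of $u$ to the bottom-left point of $v$; it is the product transported by the Fourier transform, $u*v=\mathfrak{F}^{-1}(\mathfrak{F}(v)\mathfrak{F}(u))$. An element of a $C^*$-algebra is positive if it is of the form $aa^*$. An element $x\in\mathscr{P}_{2,\pm}$ is $\mathfrak{F}$-positive if $\widehat{x}$ is positive in $\mathscr{P}_{2,\mp}$. *)

theory Defs
  imports Complex_Main
begin

section \<open>Shaded planar tangles\<close>

text \<open>
  A shaded planar tangle, taken up to isotopy, is recorded by its incidence structure.

  Discs are numbered: disc 0 is the output (outer) disc, discs 1, 2, ... are the input (inner)
  discs.  A disc of colour (n, s) has 2n boundary points, numbered 0, ..., 2n-1 clockwise from its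
  marked interval; s = True iff the region touching the marked interval is shaded (so False is
  the sign + and True is the sign -).  Drawn as a box with the marked interval on the left, the
  points 0, ..., n-1 are the top ones from left to right and n, ..., 2n-1 are the bottom ones from
  right to left.  The boundary interval i is the one that precedes the point i clockwise, so that
  interval 0 is the marked one; a disc without boundary points has the single interval 0.

  Strings (arcs and closed loops) and regions carry arbitrary names.  Because the shading is a
  checkerboard, each string has exactly one shaded and one unshaded side, so its two sides can be
  addressed by their shade.
\<close>

type_synonym colour = "nat \<times> bool"

record tangle =
  colours :: "colour list"  \<comment> \<open>colour of the output disc, followed by those of the input discs\<close>
  strings :: "nat set"
  regions :: "nat set"
  string_at :: "nat \<times> nat \<Rightarrow> nat"  \<comment> \<open>(disc, point) to the string ending there\<close>
  region_at :: "nat \<times> nat \<Rightarrow> nat"  \<comment> \<open>(disc, interval) to the region touching it\<close>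
  region_beside :: "nat \<Rightarrow> bool \<Rightarrow> nat"
    \<comment> \<open>string and shade to the region on the side of the string having that shade\<close>

definition points :: "colour list \<Rightarrow> (nat \<times> nat) set" where
  "points cs = {(d, i). d < length cs \<and> i < 2 * fst (cs ! d)}"

definition intervals :: "colour list \<Rightarrow> (nat \<times> nat) set" where
  "intervals cs = {(d, i). d < length cs \<and> i < max 1 (2 * fst (cs ! d))}"

definition next_interval :: "colour list \<Rightarrow> nat \<times> nat \<Rightarrow> nat \<times> nat" where
  "next_interval cs p = (fst p, Suc (snd p) mod (2 * fst (cs ! fst p)))"

definition flanks :: "colour list \<Rightarrow> nat \<times> nat \<Rightarrow> (nat \<times> nat) set" where
  "flanks cs p = {p, next_interval cs p}"

definition shade :: "colour list \<Rightarrow> nat \<times> nat \<Rightarrow> bool" where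
  "shade cs a \<longleftrightarrow> snd (cs ! fst a) \<noteq> odd (snd a)"

text \<open>
  Orient every string so that the shaded region is on its left.  Then the string leaves an input
  disc at the point i iff the interval i is shaded, and it leaves the boundary of the output disc
  at the point i iff the interval i is unshaded.
\<close>

definition emits :: "colour list \<Rightarrow> nat \<times> nat \<Rightarrow> bool" where
  "emits cs p \<longleftrightarrow> shade cs p \<noteq> (fst p = 0)"

definition ends_of :: "tangle \<Rightarrow> nat \<Rightarrow> (nat \<times> nat) set" where
  "ends_of T t = {p \<in> points (colours T). string_at T p = t}"

definition loops :: "tangle \<Rightarrow> nat set" where
  "loops T = {t \<in> strings T. ends_of T t = {}}"

definition shaded_incidence :: "tangle \<Rightarrow> bool" where
  "shaded_incidence T \<longleftrightarrow> (let cs = colours T in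
     cs \<noteq> [] \<and> finite (strings T) \<and> finite (regions T) \<and>
     string_at T ` points cs \<subseteq> strings T \<and>
     regions T = region_at T ` intervals cs
                 \<union> {region_beside T t b | t b. t \<in> strings T} \<and>
     (\<forall>t \<in> strings T. ends_of T t = {} \<or>
        (\<exists>p q. ends_of T t = {p, q} \<and> emits cs p \<and> \<not> emits cs q)) \<and>
     (\<forall>p \<in> points cs. \<forall>a \<in> flanks cs p.
        region_at T a = region_beside T (string_at T p) (shade cs a)) \<and>
     (\<exists>sh. (\<forall>a \<in> intervals cs. sh (region_at T a) = shade cs a) \<and>
           (\<forall>t \<in> strings T. \<forall>b. sh (region_beside T t b) = b)))"

text \<open>
  Planarity.  Fill each region in as a sphere with one hole for each of its boundary components.
  Together with the discs (the output disc being the complementary disc of the sphere) this gives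
  a closed oriented surface, and the tangle is planar iff that surface is a sphere, i.e. it is
  connected of Euler characteristic
    (number of discs) - (number of arcs) + (sum over regions of 2 - number of boundary components)
  equal to 2.  A boundary component of a region is either one side of a closed loop or a cyclic
  sequence of disc intervals, consecutive ones being joined along one side of an arc.
\<close>

definition same_boundary :: "tangle \<Rightarrow> ((nat \<times> nat) \<times> (nat \<times> nat)) set" where
  "same_boundary T = (let cs = colours T in
     {(a, b). \<exists>p \<in> points cs. \<exists>q \<in> points cs. a \<in> flanks cs p \<and> b \<in> flanks cs q \<and>
        string_at T p = string_at T q \<and> shade cs a = shade cs b}\<^sup>*)"

definition boundary_components :: "tangle \<Rightarrow> nat" where
  "boundary_components T =
     card (intervals (colours T) // same_boundary T) + 2 * card (loops T)"

definition region_adjacent :: "tangle \<Rightarrow> (nat \<times> nat) set" where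
  "region_adjacent T =
     {(region_beside T t b, region_beside T t c) | t b c. t \<in> strings T} \<union>
     {(region_at T (d, i), region_at T (d, j)) | d i j.
        (d, i) \<in> intervals (colours T) \<and> (d, j) \<in> intervals (colours T)}"

definition planar_tangle :: "tangle \<Rightarrow> bool" where
  "planar_tangle T \<longleftrightarrow> shaded_incidence T \<and>
     (\<forall>r \<in> regions T. \<forall>r' \<in> regions T. (r, r') \<in> (region_adjacent T)\<^sup>*) \<and>
     length (colours T) + 2 * card (regions T)
       = 2 + card (strings T - loops T) + boundary_components T"

text \<open>
  Two planar tangles are isotopic iff they have isomorphic incidence structures.  The permutation
  \<open>\<sigma>\<close> keeps track of a renumbering of the input discs.
\<close>

definition isotopic_via :: "(nat \<Rightarrow> nat) \<Rightarrow> tangle \<Rightarrow> tangle \<Rightarrow> bool" where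
  "isotopic_via \<sigma> T T' \<longleftrightarrow>
     \<sigma> 0 = 0 \<and> bij_betw \<sigma> {..<length (colours T)} {..<length (colours T')} \<and>
     (\<forall>d < length (colours T). colours T' ! \<sigma> d = colours T ! d) \<and>
     (\<exists>f g. bij_betw f (strings T) (strings T') \<and> bij_betw g (regions T) (regions T') \<and>
        (\<forall>(d, i) \<in> points (colours T). string_at T' (\<sigma> d, i) = f (string_at T (d, i))) \<and>
        (\<forall>(d, i) \<in> intervals (colours T). region_at T' (\<sigma> d, i) = g (region_at T (d, i))) \<and>
        (\<forall>t \<in> strings T. \<forall>b. region_beside T' (f t) b = g (region_beside T t b)))"

text \<open>
  Composition: \<open>R\<close> is obtained from \<open>T\<close> by gluing \<open>S\<close> into its input disc \<open>i\<close>.  The strings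
  (regions) of \<open>R\<close> are those of \<open>T\<close> and \<open>S\<close>, with those meeting at a common point (interval) of
  the glued disc merged.  The input discs of \<open>S\<close> take the place of the disc \<open>i\<close> in the numbering.
\<close>

definition identifies :: "('x \<times> 'x) set \<Rightarrow> 'x set \<Rightarrow> 'y set \<Rightarrow> ('x \<Rightarrow> 'y) \<Rightarrow> bool" where
  "identifies E X Y f \<longleftrightarrow>
     f ` X = Y \<and> (\<forall>x \<in> X. \<forall>y \<in> X. f x = f y \<longleftrightarrow> (x, y) \<in> (E \<union> E\<inverse>)\<^sup>*)"

definition composite :: "tangle \<Rightarrow> nat \<Rightarrow> tangle \<Rightarrow> tangle \<Rightarrow> bool" where
  "composite T i S R \<longleftrightarrow>
     (let cT = colours T; cS = colours S;
          posT = (\<lambda>d. if d < i then d else d + length cS - 2);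
          posS = (\<lambda>d. i + d - 1) in
      1 \<le> i \<and> i < length cT \<and> cT ! i = cS ! 0 \<and>
      colours R = take i cT @ tl cS @ drop (Suc i) cT \<and>
      (\<exists>f g.
        identifies {(Inl (string_at T (i, j)), Inr (string_at S (0, j))) | j. (0, j) \<in> points cS}
          (strings T <+> strings S) (strings R) f \<and>
        identifies {(Inl (region_at T (i, j)), Inr (region_at S (0, j))) | j. (0, j) \<in> intervals cS}
          (regions T <+> regions S) (regions R) g \<and>
        (\<forall>(d, j) \<in> points cT. d \<noteq> i \<longrightarrow> string_at R (posT d, j) = f (Inl (string_at T (d, j)))) \<and>
        (\<forall>(d, j) \<in> points cS. d \<noteq> 0 \<longrightarrow> string_at R (posS d, j) = f (Inr (string_at S (d, j)))) \<and>
        (\<forall>(d, j) \<in> intervals cT. d \<noteq> i \<longrightarrow> region_at R (posT d, j) = g (Inl (region_at T (d, j)))) \<and>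
        (\<forall>(d, j) \<in> intervals cS. d \<noteq> 0 \<longrightarrow> region_at R (posS d, j) = g (Inr (region_at S (d, j)))) \<and>
        (\<forall>t \<in> strings T. \<forall>b. region_beside R (f (Inl t)) b = g (Inl (region_beside T t b))) \<and>
        (\<forall>t \<in> strings S. \<forall>b. region_beside R (f (Inr t)) b = g (Inr (region_beside S t b)))))"

text \<open>Reflection in a horizontal line; marked intervals stay on the left.\<close>

definition reflect :: "tangle \<Rightarrow> tangle" where
  "reflect T = (let N = (\<lambda>d. 2 * fst (colours T ! d)) in
     T\<lparr>string_at := (\<lambda>(d, i). string_at T (d, N d - 1 - i)),
       region_at := (\<lambda>(d, i). region_at T (d, (N d - i) mod N d))\<rparr>)"

subsection \<open>The tangles used\<close>

text \<open>In a tangle without closed loops the regions beside the strings can be read off at the discs.\<close>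

definition loopless :: "colour list \<Rightarrow> (nat \<times> nat \<Rightarrow> nat) \<Rightarrow> (nat \<times> nat \<Rightarrow> nat) \<Rightarrow> tangle" where
  "loopless cs str reg =
     \<lparr>colours = cs, strings = str ` points cs, regions = reg ` intervals cs,
      string_at = str, region_at = reg,
      region_beside = (\<lambda>t b. THE r. \<exists>p \<in> points cs. \<exists>a \<in> flanks cs p.
                               str p = t \<and> shade cs a = b \<and> reg a = r)\<rparr>"

text \<open>
  Horizontal position, counted from the left, of the boundary point i and of the boundary interval
  i of a box with n points on top and n at the bottom.
\<close>

definition point_column :: "nat \<Rightarrow> nat \<Rightarrow> nat" where
  "point_column n i = (if i < n then i else 2 * n - 1 - i)"

definition interval_column :: "nat \<Rightarrow> nat \<Rightarrow> nat" where
  "interval_column n i = (if i \<le> n then i else 2 * n - i)"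

definition identity_tangle :: "colour \<Rightarrow> tangle" where
  "identity_tangle c = loopless [c, c] snd snd"

definition unit_tangle :: "colour \<Rightarrow> tangle" where
  "unit_tangle c = loopless [c] (\<lambda>(d, i). point_column (fst c) i)
                                (\<lambda>(d, i). interval_column (fst c) i)"

text \<open>
  Multiplication: the input disc 1 is at the bottom, the input disc 2 on top.  The strings are
  arranged in three layers: 0 above disc 2, 1 between the discs, 2 below disc 1.  The leftmost and
  the rightmost regions extend over all layers.
\<close>

definition mult_tangle :: "colour \<Rightarrow> tangle" where
  "mult_tangle c = (let n = fst c;
       layer = (\<lambda>d top. if d = 0 then (if top then 0 else 2)
                        else if d = 1 then (if top then 1 else 2)
                        else (if top then 0 else 1 :: nat)) in
     loopless [c, c, c]
       (\<lambda>(d, i). layer d (i < n) * n + point_column n i)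
       (\<lambda>(d, i). let k = interval_column n i in
                 if k = 0 \<or> k = n then k else layer d (i \<le> n) * (n + 1) + k))"

definition closure_tangle :: "colour \<Rightarrow> tangle" where
  "closure_tangle c = loopless [(0, snd c), c] (\<lambda>(d, i). point_column (fst c) i)
                                               (\<lambda>(d, i). interval_column (fst c) i)"

text \<open>
  The Fourier transform: the points 0, 1, 2, 3 (top-left, top-right, bottom-right, bottom-left)
  of the output are joined to the points 3, 0, 1, 2 of the input.
\<close>

definition fourier_tangle :: "bool \<Rightarrow> tangle" where
  "fourier_tangle s = (let turn = (\<lambda>(d, i). if d = 0 then (i + 3) mod 4 else i) in
     loopless [(2, \<not> s), (2, s)] turn turn)"

definition conv_tangle :: "bool \<Rightarrow> tangle" where
  "conv_tangle s = loopless [(2, s), (2, s), (2, s)]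
     (\<lambda>(d, i). [[0, 1, 2, 3], [0, 4, 5, 3], [4, 1, 2, 5]] ! d ! i)
     (\<lambda>(d, i). [[0, 1, 2, 3], [0, 1, 4, 3], [4, 1, 2, 3]] ! d ! i)"



section \<open>Planar algebras\<close>

text \<open>
  The spaces \<open>P (n, s)\<close> are represented as subspaces of one ambient complex vector space; this is
  no restriction, since any family of vector spaces embeds into its direct sum.  They are not
  required to be independent or disjoint.
\<close>

definition valid_inputs :: "(colour \<Rightarrow> 'a set) \<Rightarrow> tangle \<Rightarrow> 'a list \<Rightarrow> bool" where
  "valid_inputs P T xs \<longleftrightarrow> list_all2 (\<lambda>c x. x \<in> P c) (tl (colours T)) xs"

locale planar_algebra = vector_space scale
  for scale :: "complex \<Rightarrow> 'a::ab_group_add \<Rightarrow> 'a" +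
  fixes P :: "colour \<Rightarrow> 'a set"
    and Z :: "tangle \<Rightarrow> 'a list \<Rightarrow> 'a"
  assumes subspace_P: "subspace (P c)"
    and Z_closed: "\<lbrakk>planar_tangle T; valid_inputs P T xs\<rbrakk> \<Longrightarrow> Z T xs \<in> P (hd (colours T))"
    and Z_multilinear:
      "\<lbrakk>planar_tangle T; valid_inputs P T (us @ [x] @ vs); valid_inputs P T (us @ [y] @ vs)\<rbrakk> \<Longrightarrow>
       Z T (us @ [scale a x + y] @ vs) = scale a (Z T (us @ [x] @ vs)) + Z T (us @ [y] @ vs)"
    and Z_isotopy:
      "\<lbrakk>planar_tangle T; planar_tangle T'; isotopic_via \<sigma> T T'; valid_inputs P T xs;
        length xs' = length xs; \<And>d. 1 \<le> d \<Longrightarrow> d \<le> length xs \<Longrightarrow> xs' ! (\<sigma> d - 1) = xs ! (d - 1)\<rbrakk>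
       \<Longrightarrow> Z T' xs' = Z T xs"
    and Z_composite:
      "\<lbrakk>planar_tangle T; planar_tangle S; planar_tangle R; composite T (Suc (length us)) S R;
        valid_inputs P S ys; valid_inputs P R (us @ ys @ vs)\<rbrakk>
       \<Longrightarrow> Z R (us @ ys @ vs) = Z T (us @ [Z S ys] @ vs)"
    and Z_identity: "x \<in> P c \<Longrightarrow> Z (identity_tangle c) [x] = x"


section \<open>Finite-dimensional C*-algebras and C*-planar algebras\<close>

text \<open>
  A C*-norm on a finite-dimensional algebra is automatically complete, so completeness need not be
  required.
\<close>

locale fin_dim_cstar_algebra = vector_space scale
  for scale :: "complex \<Rightarrow> 'a::ab_group_add \<Rightarrow> 'a" +
  fixes A :: "'a set" and mul :: "'a \<Rightarrow> 'a \<Rightarrow> 'a" and one :: 'a and star :: "'a \<Rightarrow> 'a"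
  assumes subspace_A: "subspace A"
    and fin_dim: "\<exists>B. finite B \<and> span B = A"
    and mul_closed: "\<lbrakk>x \<in> A; y \<in> A\<rbrakk> \<Longrightarrow> mul x y \<in> A"
    and mul_assoc: "\<lbrakk>x \<in> A; y \<in> A; z \<in> A\<rbrakk> \<Longrightarrow> mul (mul x y) z = mul x (mul y z)"
    and mul_linear_left: "\<lbrakk>x \<in> A; y \<in> A; z \<in> A\<rbrakk> \<Longrightarrow>
          mul (scale a x + y) z = scale a (mul x z) + mul y z"
    and mul_linear_right: "\<lbrakk>x \<in> A; y \<in> A; z \<in> A\<rbrakk> \<Longrightarrow>
          mul z (scale a x + y) = scale a (mul z x) + mul z y"
    and one_closed: "one \<in> A"
    and one_nonzero: "one \<noteq> 0"
    and mul_one: "x \<in> A \<Longrightarrow> mul one x = x" "x \<in> A \<Longrightarrow> mul x one = x"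
    and star_closed: "x \<in> A \<Longrightarrow> star x \<in> A"
    and star_conj_linear: "\<lbrakk>x \<in> A; y \<in> A\<rbrakk> \<Longrightarrow>
          star (scale a x + y) = scale (cnj a) (star x) + star y"
    and star_star: "x \<in> A \<Longrightarrow> star (star x) = x"
    and star_mul: "\<lbrakk>x \<in> A; y \<in> A\<rbrakk> \<Longrightarrow> star (mul x y) = mul (star y) (star x)"
    and cstar_norm: "\<exists>N :: 'a \<Rightarrow> real.
          (\<forall>x \<in> A. 0 \<le> N x \<and> (N x = 0 \<longleftrightarrow> x = 0)) \<and>
          (\<forall>x \<in> A. \<forall>y \<in> A. N (x + y) \<le> N x + N y \<and> N (mul x y) \<le> N x * N y) \<and>
          (\<forall>a. \<forall>x \<in> A. N (scale a x) = cmod a * N x) \<and>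
          (\<forall>x \<in> A. N (mul (star x) x) = (N x)\<^sup>2)"

definition pmult :: "(tangle \<Rightarrow> 'a list \<Rightarrow> 'a) \<Rightarrow> colour \<Rightarrow> 'a \<Rightarrow> 'a \<Rightarrow> 'a" where
  "pmult Z c x y = Z (mult_tangle c) [x, y]"

definition pone :: "(tangle \<Rightarrow> 'a list \<Rightarrow> 'a) \<Rightarrow> colour \<Rightarrow> 'a" where
  "pone Z c = Z (unit_tangle c) []"

locale cstar_planar_algebra = planar_algebra scale P Z
  for scale :: "complex \<Rightarrow> 'a::ab_group_add \<Rightarrow> 'a"
    and P :: "colour \<Rightarrow> 'a set" and Z :: "tangle \<Rightarrow> 'a list \<Rightarrow> 'a" +
  fixes star :: "colour \<Rightarrow> 'a \<Rightarrow> 'a" and tr :: "colour \<Rightarrow> 'a \<Rightarrow> complex"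
  assumes cstar: "fin_dim_cstar_algebra scale (P c) (pmult Z c) (pone Z c) (star c)"
    and star_reflect: "\<lbrakk>planar_tangle T; valid_inputs P T xs\<rbrakk> \<Longrightarrow>
          star (hd (colours T)) (Z T xs) = Z (reflect T) (map2 star (tl (colours T)) xs)"
    and tr_linear: "\<lbrakk>x \<in> P c; y \<in> P c\<rbrakk> \<Longrightarrow> tr c (scale a x + y) = a * tr c x + tr c y"
    and tr_trace: "\<lbrakk>x \<in> P c; y \<in> P c\<rbrakk> \<Longrightarrow> tr c (pmult Z c x y) = tr c (pmult Z c y x)"
    and tr_positive: "x \<in> P c \<Longrightarrow>
          Im (tr c (pmult Z c x (star c x))) = 0 \<and> 0 \<le> Re (tr c (pmult Z c x (star c x)))"
    and tr_faithful: "\<lbrakk>x \<in> P c; tr c (pmult Z c x (star c x)) = 0\<rbrakk> \<Longrightarrow> x = 0"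
    and tr_closure: "x \<in> P c \<Longrightarrow> tr c x = tr (0, snd c) (Z (closure_tangle c) [x])"

definition fourier :: "(tangle \<Rightarrow> 'a list \<Rightarrow> 'a) \<Rightarrow> bool \<Rightarrow> 'a \<Rightarrow> 'a" where
  "fourier Z s x = Z (fourier_tangle s) [x]"

definition convolution :: "(tangle \<Rightarrow> 'a list \<Rightarrow> 'a) \<Rightarrow> bool \<Rightarrow> 'a \<Rightarrow> 'a \<Rightarrow> 'a" where
  "convolution Z s u v = Z (conv_tangle s) [u, v]"

definition positive ::
  "(colour \<Rightarrow> 'a set) \<Rightarrow> (tangle \<Rightarrow> 'a list \<Rightarrow> 'a) \<Rightarrow> (colour \<Rightarrow> 'a \<Rightarrow> 'a) \<Rightarrow> colour \<Rightarrow> 'a \<Rightarrow> bool" where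
  "positive P Z star c x \<longleftrightarrow> (\<exists>a \<in> P c. x = pmult Z c a (star c a))"

definition F_positive ::
  "(colour \<Rightarrow> 'a set) \<Rightarrow> (tangle \<Rightarrow> 'a list \<Rightarrow> 'a) \<Rightarrow> (colour \<Rightarrow> 'a \<Rightarrow> 'a) \<Rightarrow> bool \<Rightarrow> 'a \<Rightarrow> bool" where
  "F_positive P Z star s x \<longleftrightarrow> x \<in> P (2, s) \<and> positive P Z star (2, \<not> s) (fourier Z s x)"

definition alg_spectrum ::
  "(complex \<Rightarrow> 'a \<Rightarrow> 'a::ab_group_add) \<Rightarrow> 'a set \<Rightarrow> ('a \<Rightarrow> 'a \<Rightarrow> 'a) \<Rightarrow> 'a \<Rightarrow> 'a \<Rightarrow> complex set" where
  "alg_spectrum scale A mul one x =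
     {l. \<not> (\<exists>z \<in> A. mul (x - scale l one) z = one \<and> mul z (x - scale l one) = one)}"

definition spectral_radius ::
  "(complex \<Rightarrow> 'a \<Rightarrow> 'a::ab_group_add) \<Rightarrow> 'a set \<Rightarrow> ('a \<Rightarrow> 'a \<Rightarrow> 'a) \<Rightarrow> 'a \<Rightarrow> 'a \<Rightarrow> real" where
  "spectral_radius scale A mul one x = Sup (cmod ` alg_spectrum scale A mul one x)"

end

theory Submission
  imports Defs "HOL-Computational_Algebra.Fundamental_Theorem_Algebra"
begin

text \<open>
  Write \<open>A\<close> and \<open>B\<close> for the algebras of 2-boxes of the two shadings, and \<open>F\<close> for the Fourier transform
  from \<open>A\<close> to \<open>B\<close>.  It is a linear bijection that carries the product of \<open>A\<close> to the convolution of \<open>B\<close>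
  (\<open>fourier_pmult\<close>), which settles the equivalence of the two forms of the eigenvalue equations.  The
  existence of \<open>y\<close> is a Perron-Frobenius theorem for the cone of F-positive elements of \<open>A\<close>.

  This cone is closed under products by the Schur product theorem: the convolution of positive elements of
  \<open>B\<close> is positive (\<open>convolution_positive\<close>).  So for \<open>\<bar>l\<bar> > r\<close> the series \<open>\<Sum> x\<^sup>n / l\<^sup>n\<close> over
  \<open>n \<ge> 1\<close>, which is \<open>x (l - x)\<^sup>-\<^sup>1\<close>, has coefficients in the cone.  As in Pringsheim's theorem it must
  be singular at \<open>r\<close>, since it is singular at some point of absolute value \<open>r\<close> (\<open>radius_is_root\<close>); and
  its leading coefficient at \<open>r\<close>, which is an eigenvector of \<open>x\<close> for the eigenvalue \<open>r\<close> and commutes with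
  \<open>x\<close>, is the limit of the elements \<open>(t - r)\<^sup>k x (t - x)\<^sup>-\<^sup>1\<close> of the cone as \<open>t\<close> decreases to \<open>r\<close>
  (\<open>leading_term_nonneg\<close>).  If \<open>r = 0\<close>, then \<open>x\<close> is nilpotent and its last nonzero power is an eigenvector.

  All limits are taken in the complex numbers.  The positive cone of \<open>B\<close> is self-dual with respect to the
  trace (\<open>positive_cone_self_dual\<close>), so an element \<open>y\<close> of \<open>A\<close> is F-positive iff
  \<open>tr (u u\<^sup>* F(y)) \<ge> 0\<close> for all \<open>u\<close>, and one may study the scalar sequences
  \<open>tr (u u\<^sup>* F(x\<^sup>n))\<close>.  They are nonnegative and solve the linear recurrence given by the minimal
  polynomial of \<open>x\<close>, whose roots are the spectrum of \<open>x\<close>.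

  The Schur product theorem follows from self-duality as well, because
  \<open>tr (c c\<^sup>* (u u\<^sup>* * v v\<^sup>*))\<close> is a closed diagram with six boxes that form a prism.  The plane between
  the triangles \<open>c\<^sup>*, u, v\<close> and \<open>c, u\<^sup>*, v\<^sup>*\<close> cuts it into a 3-box \<open>w\<close> and its adjoint, so it equals
  \<open>tr (w w\<^sup>*) \<ge> 0\<close> (\<open>tr_square_convolution\<close>).  The pictures enter through criteria for planarity,
  composition and isotopy of tangles given by tables (\<open>planar_loopless\<close>, \<open>composite_loopless\<close>,
  \<open>isotopic_loopless\<close>), which are evaluated by rewriting.
\<close>

section \<open>Functionals on polynomials with nonnegative moments\<close>

definition poly_linear :: "(complex poly \<Rightarrow> complex) \<Rightarrow> bool" where
  "poly_linear L \<longleftrightarrow> (\<forall>c p q. L (smult c p + q) = c * L p + L q)"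

lemma poly_linear_simps:
  assumes "poly_linear L"
  shows "L (p + q) = L p + L q" "L (smult c p) = c * L p" "L 0 = 0" "L (p - q) = L p - L q"
proof -
  have lin: "L (smult c p + q) = c * L p + L q" for c p q using assms by (simp add: poly_linear_def)
  show "L (p + q) = L p + L q" for p q using lin[of 1 p q] by simp
  show zero: "L 0 = 0" using lin[of 1 0 0] by simp
  show "L (smult c p) = c * L p" using lin[of c p 0] zero by simp
  show "L (p - q) = L p - L q" using lin[of "-1" q p] by simp
qed

lemma poly_linear_mult: "poly_linear L \<Longrightarrow> poly_linear (\<lambda>q. L (h * q))"
  by (simp add: poly_linear_def algebra_simps)

definition annihilates :: "complex poly \<Rightarrow> (complex poly \<Rightarrow> complex) \<Rightarrow> bool" where
  "annihilates p L \<longleftrightarrow> (\<forall>q. L (p * q) = 0)"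

text \<open>
  The moments \<open>L (X\<^sup>n)\<close> solve the linear recurrence with characteristic polynomial \<open>p\<close>, so they
  grow no faster than the powers of any \<open>\<rho>\<close> beyond the roots.  One linear factor \<open>X - z\<close> of \<open>p\<close> is
  removed at a time: \<open>L\<close> composed with multiplication by \<open>X - z\<close> is annihilated by the other factor.
\<close>

lemma annihilated_growth:
  assumes "poly_linear L" "annihilates p L" "p \<noteq> 0" "\<And>z. poly p z = 0 \<Longrightarrow> cmod z \<le> r" "0 \<le> r" "r < \<rho>"
  shows "\<exists>C \<ge> 0. \<forall>n. cmod (L (monom 1 n)) \<le> C * \<rho> ^ n"
  using assms(1-4)
proof (induction "degree p" arbitrary: p L)
  case 0
  then obtain c where c: "p = [:c:]" "c \<noteq> 0" by (metis degree_eq_zeroE pCons_0_0)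
  have "L q = 0" for q
    using "0.prems"(2) c unfolding annihilates_def by (auto dest: spec[of _ "smult (1 / c) q"])
  then show ?case by (intro exI[of _ 0]) simp
next
  case (Suc d)
  have "\<not> constant (poly p)" using Suc.hyps(2) constant_degree[of p] by simp
  then obtain z where z: "poly p z = 0" using fundamental_theorem_of_algebra by blast
  then obtain p' where p': "p = [:- z, 1:] * p'" by (auto simp: poly_eq_0_iff_dvd)
  let ?L = "\<lambda>q. L ([:- z, 1:] * q)"
  have nz: "p' \<noteq> 0" using Suc.prems(3) p' by auto
  then have "degree p = Suc (degree p')" unfolding p' by (subst degree_mult_eq) auto
  then have "d = degree p'" using Suc.hyps(2) by simp
  moreover have "poly_linear ?L" using Suc.prems(1) by (rule poly_linear_mult)
  moreover have "annihilates p' ?L"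
    using Suc.prems(2) unfolding annihilates_def p' mult.assoc by blast
  moreover have "cmod w \<le> r" if "poly p' w = 0" for w
    using Suc.prems(4)[of w] that p' by simp
  ultimately obtain C where C: "0 \<le> C" "\<And>n. cmod (?L (monom 1 n)) \<le> C * \<rho> ^ n"
    using Suc.hyps(1)[of p' ?L] nz by auto
  \<comment> \<open>The second bound makes the step \<open>r * D + C \<le> D * \<rho>\<close> of the recurrence below go through.\<close>
  define D where "D = max (cmod (L 1)) (C / (\<rho> - r))"
  have D: "cmod (L 1) \<le> D" "C \<le> D * (\<rho> - r)" "0 \<le> D"
  proof -
    have "C / (\<rho> - r) \<le> D" by (simp add: D_def)
    then show "C \<le> D * (\<rho> - r)" using assms(6) by (simp add: divide_le_eq)
  qed (simp_all add: D_def le_max_iff_disj)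
  have "cmod (L (monom 1 n)) \<le> D * \<rho> ^ n" for n
  proof (induction n)
    case 0
    then show ?case using D(1) by (simp add: monom_0 one_pCons)
  next
    case (Suc n)
    have "monom 1 (Suc n) = smult z (monom 1 n) + [:- z, 1:] * monom 1 n"
      by (simp add: monom_Suc)
    then have "L (monom 1 (Suc n)) = z * L (monom 1 n) + ?L (monom 1 n)"
      using poly_linear_simps[OF \<open>poly_linear L\<close>] by metis
    then have "cmod (L (monom 1 (Suc n))) \<le> cmod z * cmod (L (monom 1 n)) + cmod (?L (monom 1 n))"
      by (metis norm_mult norm_triangle_ineq)
    also have "\<dots> \<le> r * (D * \<rho> ^ n) + C * \<rho> ^ n"
      using Suc.IH C(2) \<open>\<And>z. poly p z = 0 \<Longrightarrow> cmod z \<le> r\<close>[OF z] assms(5) by (intro add_mono mult_mono) auto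
    also have "\<dots> = (r * D + C) * \<rho> ^ n" by (simp add: algebra_simps)
    also have "\<dots> \<le> (D * \<rho>) * \<rho> ^ n"
      using D(2) assms(5,6) by (intro mult_right_mono) (auto simp: algebra_simps)
    finally show ?case by (simp add: mult_ac)
  qed
  then show ?case using D(3) by blast
qed

text \<open>
  \<open>synthetic_div p l\<close> is the polynomial \<open>(p(X) - p(l)) / (X - l)\<close>.  If \<open>p\<close> annihilates an algebra
  element \<open>x\<close>, then this polynomial, evaluated at \<open>x\<close>, is \<open>p(l)\<close> times the resolvent \<open>(l - x)\<^sup>-\<^sup>1\<close>;
  unlike the resolvent it stays finite at the roots of \<open>p\<close>, where it becomes an eigenvector.  The
  additional factor \<open>X\<close> removes the constant term of the resolvent series.
\<close>

definition quotient_value :: "(complex poly \<Rightarrow> complex) \<Rightarrow> complex poly \<Rightarrow> complex \<Rightarrow> complex" where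
  "quotient_value L p l = L (pCons 0 (synthetic_div p l))"

text \<open>
  It is a polynomial in \<open>l\<close>, by the recursion of synthetic division along the coefficients of \<open>p\<close>.
\<close>

lemma continuous_quotient_value:
  assumes "poly_linear L"
  shows "isCont (quotient_value L p) l"
  using assms
proof (induction p arbitrary: L)
  case 0
  then show ?case by (simp add: quotient_value_def)
next
  case (pCons a p)
  let ?L = "\<lambda>q. L ([:0, 1:] * q)"
  have "quotient_value L (pCons a p) = (\<lambda>l. poly p l * L [:0, 1:] + quotient_value ?L p l)"
  proof
    fix l
    have "pCons 0 (synthetic_div (pCons a p) l) =
        smult (poly p l) [:0, 1:] + [:0, 1:] * pCons 0 (synthetic_div p l)" by simp
    then show "quotient_value L (pCons a p) l = poly p l * L [:0, 1:] + quotient_value ?L p l"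
      using poly_linear_simps[OF pCons.prems] unfolding quotient_value_def by metis
  qed
  moreover have "isCont (quotient_value ?L p) l"
    using pCons.IH[OF poly_linear_mult[OF pCons.prems]] .
  ultimately show ?case by (auto intro!: continuous_intros poly_isCont)
qed

text \<open>
  The series telescopes: with \<open>h = synthetic_div p l\<close> the relation \<open>X h = l h + p - p(l)\<close> and the
  vanishing of \<open>L\<close> on multiples of \<open>p\<close> give \<open>p(l) L(X\<^sup>n) = l L(X\<^sup>n h) - L(X\<^sup>n\<^sup>+\<^sup>1 h)\<close>.
\<close>

lemma resolvent_series:
  assumes "poly_linear L" "annihilates p L" "p \<noteq> 0" "\<And>z. poly p z = 0 \<Longrightarrow> cmod z \<le> r" "0 \<le> r"
    and "r < cmod l"
  shows "(\<lambda>n. poly p l * (L (monom 1 (Suc n)) / l ^ Suc n)) sums quotient_value L p l"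
proof -
  note lin = poly_linear_simps[OF assms(1)]
  have l: "l \<noteq> 0" using assms(5,6) by auto
  let ?h = "synthetic_div p l"
  define c where "c n = L (monom 1 n * ?h)" for n
  have step: "c (Suc n) = l * c n - poly p l * L (monom 1 n)" for n
  proof -
    have "p + smult l ?h = pCons (poly p l) ?h" by (rule synthetic_div_correct)
    then have "pCons 0 ?h = p + smult l ?h - smult (poly p l) 1"
      by (simp add: one_pCons)
    moreover have "monom 1 (Suc n) * ?h = monom 1 n * pCons 0 ?h" by (simp add: monom_Suc)
    ultimately have "monom 1 (Suc n) * ?h = monom 1 n * (p + smult l ?h - smult (poly p l) 1)"
      by simp
    also have "\<dots> = p * monom 1 n + smult l (monom 1 n * ?h) - smult (poly p l) (monom 1 n)"
      by (simp add: algebra_simps)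
    finally show ?thesis
      using assms(2) lin unfolding c_def annihilates_def by simp
  qed
  obtain \<rho> where \<rho>: "r < \<rho>" "\<rho> < cmod l" using assms(6) dense by blast
  have "annihilates p (\<lambda>q. L (?h * q))"
    using assms(2) by (simp add: annihilates_def) (metis mult.left_commute)
  from annihilated_growth[OF poly_linear_mult[OF assms(1)] this assms(3-5) \<rho>(1)]
  obtain C where C: "0 \<le> C" "\<And>n. cmod (c n) \<le> C * \<rho> ^ n" by (auto simp: c_def mult.commute)
  have "(\<lambda>n. c (Suc n) / l ^ n) \<longlonglongrightarrow> 0"
  proof (rule tendsto_0_le)
    show "(\<lambda>n. (\<rho> / cmod l) ^ n) \<longlonglongrightarrow> 0"
      using \<rho> assms(5) by (intro LIMSEQ_power_zero) (auto simp: divide_less_eq_1)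
    have "norm (c (Suc n) / l ^ n) \<le> norm ((\<rho> / cmod l) ^ n) * (C * \<rho>)" for n
    proof -
      have "norm (c (Suc n) / l ^ n) \<le> C * \<rho> ^ Suc n / cmod l ^ n"
        unfolding norm_divide norm_power by (intro divide_right_mono C(2)) simp_all
      also have "\<dots> = norm ((\<rho> / cmod l) ^ n) * (C * \<rho>)"
        using \<rho> assms(5) by (simp add: power_divide)
      finally show ?thesis .
    qed
    then show "eventually (\<lambda>n. norm (c (Suc n) / l ^ n) \<le> norm ((\<rho> / cmod l) ^ n) * (C * \<rho>)) sequentially"
      by (intro always_eventually allI)
  qed
  from telescope_sums'[OF this]
  have "(\<lambda>n. c (Suc n) / l ^ n - c (Suc (Suc n)) / l ^ Suc n) sums c 1" by simp
  moreover have "c (Suc n) / l ^ n - c (Suc (Suc n)) / l ^ Suc n =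
      poly p l * (L (monom 1 (Suc n)) / l ^ Suc n)" for n
    using l step[of "Suc n"] by (simp add: field_simps)
  moreover have "c 1 = quotient_value L p l"
    by (simp add: c_def quotient_value_def monom_Suc monom_0)
  ultimately show ?thesis by simp
qed

text \<open>
  The scalar shadow of a positive element of spectral radius \<open>r\<close>: \<open>L\<close> is a positive functional
  evaluated at polynomials in the element.  The moments start at \<open>X\<close>: a cone that is closed under products
  and contains the element contains its powers from the first one on.
\<close>

locale positive_moments =
  fixes L :: "complex poly \<Rightarrow> complex" and p :: "complex poly" and r :: real
  assumes linear: "poly_linear L" and ann: "annihilates p L" and nonzero: "p \<noteq> 0"
    and roots: "\<And>z. poly p z = 0 \<Longrightarrow> cmod z \<le> r" and r_pos: "0 < r"
    and moments: "\<And>n. Im (L (monom 1 (Suc n))) = 0 \<and> 0 \<le> Re (L (monom 1 (Suc n)))"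
begin

lemma moment_norm: "cmod (L (monom 1 (Suc n))) = Re (L (monom 1 (Suc n)))"
  using moments[of n] by (simp add: cmod_def)

lemma off_spectrum: "r < cmod l \<Longrightarrow> poly p l \<noteq> 0"
  using roots[of l] by fastforce

lemma series:
  assumes "r < cmod l"
  shows "(\<lambda>n. L (monom 1 (Suc n)) / l ^ Suc n) sums (quotient_value L p l / poly p l)"
  using sums_divide[OF resolvent_series[OF linear ann nonzero roots less_imp_le[OF r_pos] assms], of "poly p l"]
    off_spectrum[OF assms] by simp

lemma real_series:
  assumes "r < t"
  shows "(\<lambda>n. Re (L (monom 1 (Suc n))) / t ^ Suc n) sums Re (quotient_value L p t / poly p t)"
    and "Im (quotient_value L p t / poly p t) = 0"
    and "0 \<le> Re (quotient_value L p t / poly p t)"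
proof -
  have t: "r < cmod (complex_of_real t)" "0 < t" using assms r_pos by simp_all
  have eq: "L (monom 1 (Suc n)) / complex_of_real t ^ Suc n =
      complex_of_real (Re (L (monom 1 (Suc n))) / t ^ Suc n)" for n
  proof -
    have "L (monom 1 (Suc n)) = complex_of_real (Re (L (monom 1 (Suc n))))"
      using moments[of n] by (simp add: complex_eq_iff)
    then show ?thesis by (metis of_real_divide of_real_power)
  qed
  show re: "(\<lambda>n. Re (L (monom 1 (Suc n))) / t ^ Suc n) sums Re (quotient_value L p t / poly p t)"
    using sums_Re[OF series[OF t(1)]] unfolding eq by simp
  have "(\<lambda>n. 0) sums Im (quotient_value L p t / poly p t)"
    using sums_Im[OF series[OF t(1)]] unfolding eq by simp
  then show "Im (quotient_value L p t / poly p t) = 0" using sums_0 sums_unique2 by blast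
  show "0 \<le> Re (quotient_value L p t / poly p t)"
    by (rule sums_le[OF _ sums_zero re]) (use moments t(2) in simp)
qed

text \<open>
  The triangle inequality for the resolvent series at \<open>t z\<close>, whose terms have the absolute values of
  those at \<open>t r\<close>.  The denominators are cleared so that \<open>t\<close> can tend to \<open>1\<close>.
\<close>

lemma quotient_value_bound:
  assumes "cmod z = r" "1 < t"
  shows "cmod (quotient_value L p (t * z)) * cmod (poly p (t * r)) \<le>
         cmod (poly p (t * z)) * cmod (quotient_value L p (t * r))"
proof -
  have z: "cmod (t * z) = t * r" "r < t * r" using assms r_pos by (simp_all add: norm_mult)
  let ?R = "Re (quotient_value L p (t * r) / poly p (t * r))"
  have sums: "(\<lambda>n. Re (L (monom 1 (Suc n))) / (t * r) ^ Suc n) sums ?R"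
    using real_series(1)[OF z(2)] by simp
  have sums': "(\<lambda>n. L (monom 1 (Suc n)) / (t * z) ^ Suc n) sums (quotient_value L p (t * z) / poly p (t * z))"
    using series[of "t * z"] z by simp
  have norm: "cmod (L (monom 1 (Suc n)) / (t * z) ^ Suc n) = Re (L (monom 1 (Suc n))) / (t * r) ^ Suc n" for n
    by (simp only: norm_divide norm_power z(1) moment_norm)
  have "cmod (quotient_value L p (t * z) / poly p (t * z)) \<le> ?R"
    unfolding sums_unique[OF sums'] sums_unique[OF sums] norm[symmetric]
    by (rule summable_norm) (use sums in \<open>simp add: norm sums_iff del: power_Suc\<close>)
  also have "\<dots> \<le> cmod (quotient_value L p (t * r) / poly p (t * r))" by (rule complex_Re_le_cmod)
  finally show ?thesis
    using off_spectrum[of "t * z"] off_spectrum[of "t * r"] z assms(2) r_pos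
    by (simp add: norm_divide field_simps norm_mult)
qed

text \<open>
  Pringsheim's theorem: a power series with nonnegative coefficients is singular at the positive point
  of its circle of convergence if it is singular anywhere on that circle.  Here the right hand side of
  the preceding bound tends to \<open>0\<close>, as \<open>p\<close> vanishes at \<open>z\<close>, while the left hand side tends to a
  nonzero multiple of \<open>\<bar>p(r)\<bar>\<close>.
\<close>

lemma radius_is_root:
  assumes "cmod z = r" "poly p z = 0" "quotient_value L p z \<noteq> 0"
  shows "poly p r = 0"
proof -
  have cont: "((\<lambda>t. quotient_value L p (complex_of_real t * w)) \<longlongrightarrow> quotient_value L p w) (at_right 1)"
    "((\<lambda>t. poly p (complex_of_real t * w)) \<longlongrightarrow> poly p w) (at_right 1)" for w
  proof -
    have lim: "((\<lambda>t. complex_of_real t * w) \<longlongrightarrow> w) (at_right 1)" by (auto intro!: tendsto_eq_intros)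
    show "((\<lambda>t. quotient_value L p (complex_of_real t * w)) \<longlongrightarrow> quotient_value L p w) (at_right 1)"
      by (rule isCont_tendsto_compose[OF continuous_quotient_value[OF linear] lim])
    show "((\<lambda>t. poly p (complex_of_real t * w)) \<longlongrightarrow> poly p w) (at_right 1)"
      by (rule isCont_tendsto_compose[OF poly_isCont lim])
  qed
  have "cmod (quotient_value L p z) * cmod (poly p r) \<le> cmod (poly p z) * cmod (quotient_value L p r)"
  proof (rule tendsto_le)
    show "eventually (\<lambda>t. cmod (quotient_value L p (complex_of_real t * z)) * cmod (poly p (complex_of_real t * r))
        \<le> cmod (poly p (complex_of_real t * z)) * cmod (quotient_value L p (complex_of_real t * r))) (at_right 1)"
      unfolding eventually_at_right_field
      using quotient_value_bound[OF assms(1)] by (intro exI[of _ 2]) auto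
  qed (intro tendsto_intros cont trivial_limit_at_right_real)+
  then show ?thesis using assms(2,3) by (simp add: mult_le_0_iff)
qed

text \<open>
  For real \<open>t > r\<close> the sum \<open>S(t)\<close> of the resolvent series is nonnegative, and the value at \<open>t\<close> is
  \<open>(t - r)\<^sup>k q(t) S(t)\<close>; multiplied by \<open>cnj (q(t))\<close> it is nonnegative too, and so is its limit as
  \<open>t\<close> decreases to \<open>r\<close>.  If \<open>q(r) \<noteq> 0\<close>, this is the leading coefficient of the series at its pole
  \<open>r\<close>, up to the positive factor \<open>\<bar>q(r)\<bar>\<^sup>2\<close>.
\<close>

lemma leading_term_nonneg:
  assumes "p = [:- complex_of_real r, 1:] ^ k * q"
  shows "Im (cnj (poly q r) * quotient_value L p r) = 0" "0 \<le> Re (cnj (poly q r) * quotient_value L p r)"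
proof -
  let ?g = "\<lambda>t::real. cnj (poly q t) * quotient_value L p t"
  have lim: "(?g \<longlongrightarrow> ?g r) (at_right r)"
  proof -
    have "(complex_of_real \<longlongrightarrow> complex_of_real r) (at_right r)" by (auto intro!: tendsto_eq_intros)
    then show ?thesis
      by (intro tendsto_intros isCont_tendsto_compose[OF continuous_quotient_value[OF linear]]
          isCont_tendsto_compose[OF poly_isCont])
  qed
  have pos: "Im (?g t) = 0" "0 \<le> Re (?g t)" if t: "r < t" for t
  proof -
    let ?T = "quotient_value L p t / poly p t"
    have "?T = complex_of_real (Re ?T)"
      using real_series(2)[OF t] by (simp add: complex_eq_iff)
    moreover have "quotient_value L p t = poly p t * ?T"
      using off_spectrum[of t] t r_pos by simp
    moreover have "poly p t = complex_of_real ((t - r) ^ k) * poly q t"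
      by (simp add: assms poly_power)
    ultimately have "?g t = cnj (poly q t) * (complex_of_real ((t - r) ^ k) * poly q t * complex_of_real (Re ?T))"
      by metis
    also have "\<dots> = complex_of_real ((cmod (poly q t))\<^sup>2 * (t - r) ^ k * Re ?T)"
      by (simp only: of_real_mult complex_norm_square) (simp add: mult_ac)
    finally have g: "?g t = complex_of_real ((cmod (poly q t))\<^sup>2 * (t - r) ^ k * Re ?T)" .
    show "Im (?g t) = 0" unfolding g by simp
    show "0 \<le> Re (?g t)" unfolding g using real_series(3)[OF t] t by simp
  qed
  have "eventually (\<lambda>t. r < t) (at_right r)" by (simp add: eventually_at_right_less)
  then have ev: "eventually (\<lambda>t. Im (?g t) = 0) (at_right r)" "eventually (\<lambda>t. 0 \<le> Re (?g t)) (at_right r)"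
    using pos by (auto elim!: eventually_mono)
  show "Im (?g r) = 0"
    using tendsto_unique[OF trivial_limit_at_right_real tendsto_Im[OF lim]] tendsto_eventually[OF ev(1)] by blast
  show "0 \<le> Re (?g r)"
    by (rule tendsto_lowerbound[OF tendsto_Re[OF lim] ev(2) trivial_limit_at_right_real])
qed

end

section \<open>Polynomials in an element of a finite-dimensional algebra\<close>

context fin_dim_cstar_algebra
begin

lemma zero_closed: "0 \<in> A" and add_closed: "u \<in> A \<Longrightarrow> v \<in> A \<Longrightarrow> u + v \<in> A"
  and scale_closed: "u \<in> A \<Longrightarrow> scale c u \<in> A" and diff_closed: "u \<in> A \<Longrightarrow> v \<in> A \<Longrightarrow> u - v \<in> A"
  using subspace_A by (auto intro: subspace_0 subspace_add subspace_scale subspace_diff)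

lemmas closed = zero_closed add_closed scale_closed diff_closed mul_closed one_closed star_closed

lemma mul_add_left: "u \<in> A \<Longrightarrow> v \<in> A \<Longrightarrow> z \<in> A \<Longrightarrow> mul (u + v) z = mul u z + mul v z"
  using mul_linear_left[of u v z 1] by simp

lemma mul_add_right: "u \<in> A \<Longrightarrow> v \<in> A \<Longrightarrow> z \<in> A \<Longrightarrow> mul z (u + v) = mul z u + mul z v"
  using mul_linear_right[of u v z 1] by simp

lemma mul_zero_left: "z \<in> A \<Longrightarrow> mul 0 z = 0"
  using mul_add_left[of 0 0 z] zero_closed by simp

lemma mul_zero_right: "z \<in> A \<Longrightarrow> mul z 0 = 0"
  using mul_add_right[of 0 0 z] zero_closed by simp

lemma mul_scale_left: "u \<in> A \<Longrightarrow> z \<in> A \<Longrightarrow> mul (scale c u) z = scale c (mul u z)"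
  using mul_linear_left[of u 0 z c] zero_closed mul_zero_left by simp

lemma mul_scale_right: "u \<in> A \<Longrightarrow> z \<in> A \<Longrightarrow> mul z (scale c u) = scale c (mul z u)"
  using mul_linear_right[of u 0 z c] zero_closed mul_zero_right by simp

lemma mul_diff_left: "u \<in> A \<Longrightarrow> v \<in> A \<Longrightarrow> z \<in> A \<Longrightarrow> mul (u - v) z = mul u z - mul v z"
  using mul_add_left[of "u - v" v z] diff_closed by (simp add: algebra_simps)

lemma mul_diff_right: "u \<in> A \<Longrightarrow> v \<in> A \<Longrightarrow> z \<in> A \<Longrightarrow> mul z (u - v) = mul z u - mul z v"
  using mul_add_right[of "u - v" v z] diff_closed by (simp add: algebra_simps)

lemma star_add: "u \<in> A \<Longrightarrow> v \<in> A \<Longrightarrow> star (u + v) = star u + star v"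
  using star_conj_linear[of u v 1] by simp

lemma star_zero: "star 0 = 0"
  using star_add[of 0 0] zero_closed by simp

lemma star_scale: "u \<in> A \<Longrightarrow> star (scale c u) = scale (cnj c) (star u)"
  using star_conj_linear[of u 0 c] zero_closed star_zero by simp

lemma star_diff: "u \<in> A \<Longrightarrow> v \<in> A \<Longrightarrow> star (u - v) = star u - star v"
  using star_add[of "u - v" v] diff_closed by (simp add: algebra_simps)

lemma star_one: "star one = one"
  using star_mul[of "star one" one] star_star[OF one_closed] mul_one star_closed[OF one_closed] one_closed
  by metis

definition peval :: "'a \<Rightarrow> complex poly \<Rightarrow> 'a" where
  "peval a p = fold_coeffs (\<lambda>c z. scale c one + mul a z) p 0"

lemma peval_0: "peval a 0 = 0"
  by (simp add: peval_def)

lemma peval_pCons: "a \<in> A \<Longrightarrow> peval a (pCons c p) = scale c one + mul a (peval a p)"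
  by (cases "p = 0 \<and> c = 0") (auto simp: peval_def mul_zero_right)

lemma peval_closed: "a \<in> A \<Longrightarrow> peval a p \<in> A"
  by (induction p) (simp_all add: peval_0 peval_pCons closed)

lemma peval_const: "a \<in> A \<Longrightarrow> peval a [:c:] = scale c one"
  by (simp add: peval_0 peval_pCons mul_zero_right)

lemma peval_1: "a \<in> A \<Longrightarrow> peval a 1 = one"
  by (simp add: one_pCons peval_const)

lemma peval_X: "a \<in> A \<Longrightarrow> peval a [:0, 1:] = a"
  by (simp add: peval_pCons peval_0 mul_zero_right mul_one)

lemma peval_add: "a \<in> A \<Longrightarrow> peval a (p + q) = peval a p + peval a q"
proof (induction p q rule: poly_induct2)
  case (pCons c p d q)
  then show ?case
    by (simp add: peval_pCons peval_closed mul_add_right closed scale_left_distrib algebra_simps)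
qed (simp add: peval_0)

lemma peval_smult: "a \<in> A \<Longrightarrow> peval a (smult c p) = scale c (peval a p)"
  by (induction p) (simp_all add: peval_0 peval_pCons peval_closed mul_scale_right closed scale_right_distrib)

lemma peval_diff: "a \<in> A \<Longrightarrow> peval a (p - q) = peval a p - peval a q"
  using peval_add[of a "p - q" q] by (simp add: algebra_simps)

lemma peval_mult: "a \<in> A \<Longrightarrow> peval a (p * q) = mul (peval a p) (peval a q)"
proof (induction p)
  case 0
  then show ?case by (simp add: peval_0 mul_zero_left peval_closed)
next
  case (pCons c p)
  then have "peval a (pCons c p * q) = scale c (peval a q) + mul a (mul (peval a p) (peval a q))"
    by (simp add: peval_add peval_smult peval_pCons)
  also have "\<dots> = mul (peval a (pCons c p)) (peval a q)"
    using pCons.prems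
    by (simp add: peval_pCons peval_closed mul_add_left closed mul_scale_left mul_one mul_assoc)
  finally show ?case .
qed

lemma peval_commute: "a \<in> A \<Longrightarrow> mul (peval a p) a = mul a (peval a p)"
  using peval_mult[of a p "[:0, 1:]"] peval_mult[of a "[:0, 1:]" p] peval_X[of a]
  by (metis mult.commute)

lemma peval_monom_Suc: "a \<in> A \<Longrightarrow> peval a (monom 1 (Suc n)) = mul a (peval a (monom 1 n))"
  by (simp add: monom_Suc peval_pCons closed peval_closed)

lemma peval_power_add: "a \<in> A \<Longrightarrow> peval a (p ^ (m + n)) = mul (peval a (p ^ m)) (peval a (p ^ n))"
  by (simp add: power_add peval_mult)

lemma star_peval: "a \<in> A \<Longrightarrow> star (peval a p) = peval (star a) (map_poly cnj p)"
proof (induction p)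
  case 0
  then show ?case by (simp add: peval_0 star_zero)
next
  case (pCons c p)
  then show ?case
    by (simp add: map_poly_pCons peval_pCons star_add star_mul star_scale star_one closed peval_closed peval_commute)
qed

lemma peval_sum: "a \<in> A \<Longrightarrow> peval a (\<Sum>i \<in> I. f i) = (\<Sum>i \<in> I. peval a (f i))"
  by (induction I rule: infinite_finite_induct) (simp_all add: peval_0 peval_add)

text \<open>
  Otherwise the powers of \<open>a\<close> would be linearly independent, whatever their number.
\<close>

lemma ex_annihilating_poly:
  assumes "a \<in> A"
  shows "\<exists>p. p \<noteq> 0 \<and> peval a p = 0"
proof (rule ccontr)
  assume "\<not> ?thesis"
  then have nz: "\<And>p. p \<noteq> 0 \<Longrightarrow> peval a p \<noteq> 0" by blast
  obtain B where B: "finite B" "span B = A" using fin_dim by blast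
  define m where "m n = peval a (monom 1 n)" for n
  let ?N = "{..card B}"
  have inj: "inj_on m ?N"
  proof (rule inj_onI)
    fix i j assume "m i = m j"
    then have "peval a (monom 1 i - monom 1 j) = 0" by (simp add: m_def peval_diff assms)
    then have "monom (1::complex) i = monom 1 j" using nz[of "monom 1 i - monom 1 j"] by auto
    then show "i = j" by (simp add: monom_eq_iff')
  qed
  have "independent (m ` ?N)"
  proof
    assume "dependent (m ` ?N)"
    then obtain u where u: "\<exists>v \<in> m ` ?N. u v \<noteq> 0" "(\<Sum>v \<in> m ` ?N. scale (u v) v) = 0"
      by (subst (asm) dependent_finite) auto
    let ?p = "\<Sum>n \<in> ?N. monom (u (m n)) n"
    have "peval a ?p = (\<Sum>n \<in> ?N. scale (u (m n)) (m n))"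
    proof (subst peval_sum[OF assms], rule sum.cong[OF refl])
      fix n
      have "monom (u (m n)) n = smult (u (m n)) (monom 1 n)" by (simp add: smult_monom)
      then show "peval a (monom (u (m n)) n) = scale (u (m n)) (m n)"
        unfolding m_def by (metis peval_smult[OF assms])
    qed
    also have "\<dots> = 0" using u(2) by (subst (asm) sum.reindex[OF inj]) (simp add: comp_def)
    finally have "?p = 0" using nz by blast
    then have coeff: "coeff ?p k = 0" for k by simp
    have "u (m k) = 0" if "k \<le> card B" for k
      using that coeff[of k] by (simp add: coeff_sum)
    then show False using u(1) by auto
  qed
  moreover have "m ` ?N \<subseteq> span B" using B(2) peval_closed[OF assms] by (auto simp: m_def)
  ultimately have "card (m ` ?N) \<le> card B" using independent_span_bound[OF B(1)] by blast
  then show False by (simp add: card_image[OF inj])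
qed

definition minimal_poly :: "'a \<Rightarrow> complex poly \<Rightarrow> bool" where
  "minimal_poly a p \<longleftrightarrow> p \<noteq> 0 \<and> peval a p = 0 \<and> (\<forall>q. q \<noteq> 0 \<longrightarrow> peval a q = 0 \<longrightarrow> degree p \<le> degree q)"

lemma ex_minimal_poly: "a \<in> A \<Longrightarrow> \<exists>p. minimal_poly a p"
  using ex_has_least_nat[of "\<lambda>p. p \<noteq> 0 \<and> peval a p = 0" _ degree] ex_annihilating_poly[of a]
  unfolding minimal_poly_def by metis

lemma minimal_poly_degree: "a \<in> A \<Longrightarrow> minimal_poly a p \<Longrightarrow> 0 < degree p"
proof (rule ccontr)
  assume a: "a \<in> A" "minimal_poly a p" "\<not> 0 < degree p"
  then obtain c where "p = [:c:]" "c \<noteq> 0" unfolding minimal_poly_def by (metis degree_eq_zeroE gr0I pCons_0_0)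
  then show False using a(1,2) one_nonzero by (simp add: minimal_poly_def peval_const)
qed

lemma mul_peval_synthetic_div:
  assumes "a \<in> A"
  shows "mul a (peval a (synthetic_div p l)) =
    scale l (peval a (synthetic_div p l)) - scale (poly p l) one + peval a p"
proof -
  have "p + smult l (synthetic_div p l) = pCons (poly p l) (synthetic_div p l)"
    by (rule synthetic_div_correct)
  then have "peval a p + scale l (peval a (synthetic_div p l)) =
      scale (poly p l) one + mul a (peval a (synthetic_div p l))"
    using assms by (metis peval_add peval_smult peval_pCons)
  then show ?thesis by (simp add: algebra_simps)
qed

text \<open>
  The quotient of the minimal polynomial by \<open>X - l\<close> does not annihilate \<open>a\<close>, its degree being too
  small, but its product with \<open>X - l\<close> does.
\<close>

lemma eigenvector:
  assumes "a \<in> A" "minimal_poly a p" "poly p l = 0"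
  shows "peval a (synthetic_div p l) \<noteq> 0"
    and "mul a (peval a (synthetic_div p l)) = scale l (peval a (synthetic_div p l))"
proof -
  have d: "0 < degree p" using minimal_poly_degree assms by blast
  then have "synthetic_div p l \<noteq> 0" "degree (synthetic_div p l) < degree p"
    by (simp_all add: synthetic_div_eq_0_iff degree_synthetic_div)
  then show "peval a (synthetic_div p l) \<noteq> 0"
    using assms(2) unfolding minimal_poly_def by (meson leD)
  show "mul a (peval a (synthetic_div p l)) = scale l (peval a (synthetic_div p l))"
    using mul_peval_synthetic_div[OF assms(1)] assms(2,3) by (simp add: minimal_poly_def)
qed

text \<open>
  Off the roots, \<open>p(l) = p(l) - p(a)\<close> is an invertible scalar divisible by \<open>a - l\<close>; at a root the
  eigenvector above is killed by \<open>a - l\<close>.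
\<close>

lemma alg_spectrum_eq_roots:
  assumes "a \<in> A" "minimal_poly a p"
  shows "alg_spectrum scale A mul one a = {l. poly p l = 0}"
proof -
  have "(\<exists>z \<in> A. mul (a - scale l one) z = one \<and> mul z (a - scale l one) = one) \<longleftrightarrow> poly p l \<noteq> 0" for l
  proof
    let ?h = "peval a (synthetic_div p l)"
    have h: "?h \<in> A" by (rule peval_closed[OF assms(1)])
    have sub: "a - scale l one \<in> A" using assms(1) by (simp add: closed)
    have left: "mul (a - scale l one) ?h = scale (- poly p l) one"
      using mul_peval_synthetic_div[OF assms(1), of p l] assms h
      by (simp add: mul_diff_left closed mul_scale_left mul_one minimal_poly_def)
    have right: "mul ?h (a - scale l one) = mul (a - scale l one) ?h"
      using assms(1) h by (simp add: mul_diff_left mul_diff_right closed mul_scale_left mul_scale_right mul_one peval_commute)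
    show "poly p l \<noteq> 0" if inv: "\<exists>z \<in> A. mul (a - scale l one) z = one \<and> mul z (a - scale l one) = one"
    proof
      assume l: "poly p l = 0"
      obtain z where z: "z \<in> A" "mul z (a - scale l one) = one" using inv by blast
      have "?h = mul (mul z (a - scale l one)) ?h" using z(2) mul_one(1)[OF h] by simp
      also have "\<dots> = mul z (mul (a - scale l one) ?h)" by (rule mul_assoc[OF z(1) sub h])
      also have "\<dots> = 0" using left l z(1) by (simp add: mul_zero_right)
      finally show False using eigenvector(1)[OF assms l] by simp
    qed
    define k where "k = - poly p l"
    assume "poly p l \<noteq> 0"
    then have "k \<noteq> 0" by (simp add: k_def)
    moreover have "mul (a - scale l one) ?h = scale k one" "mul ?h (a - scale l one) = scale k one"
      using left right by (simp_all add: k_def)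
    ultimately have "mul (a - scale l one) (scale (inverse k) ?h) = one"
      "mul (scale (inverse k) ?h) (a - scale l one) = one"
      using h sub by (simp_all add: mul_scale_left mul_scale_right)
    then show "\<exists>z \<in> A. mul (a - scale l one) z = one \<and> mul z (a - scale l one) = one"
      using h by (auto intro: scale_closed)
  qed
  then show ?thesis unfolding alg_spectrum_def by blast
qed

lemma spectral_radius_root:
  assumes "a \<in> A" "minimal_poly a p"
  defines "r \<equiv> spectral_radius scale A mul one a"
  shows "\<And>z. poly p z = 0 \<Longrightarrow> cmod z \<le> r" "\<exists>z. poly p z = 0 \<and> cmod z = r"
proof -
  let ?S = "cmod ` {l. poly p l = 0}"
  have r: "r = Sup ?S" unfolding r_def spectral_radius_def alg_spectrum_eq_roots[OF assms(1,2)] ..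
  have fin: "finite ?S"
    using poly_roots_finite[of p] assms(2) by (simp add: minimal_poly_def)
  have "\<not> constant (poly p)"
    using minimal_poly_degree[OF assms(1,2)] constant_degree[of p] by simp
  then have "?S \<noteq> {}" using fundamental_theorem_of_algebra by blast
  then have "r \<in> ?S" unfolding r using fin by (simp add: cSup_eq_Max del: image_is_empty)
  then show "\<exists>z. poly p z = 0 \<and> cmod z = r" by auto
  show "cmod z \<le> r" if "poly p z = 0" for z
    unfolding r using that fin by (intro cSup_upper bdd_above_finite) auto
qed

text \<open>
  The Nullstellensatz in one variable: \<open>p\<close> divides a power of \<open>g\<close>.
\<close>

lemma peval_nilpotent:
  assumes "a \<in> A" "minimal_poly a p" "\<And>z. poly p z = 0 \<Longrightarrow> poly g z = 0"
  shows "\<exists>n. peval a (g ^ n) = 0"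
proof -
  have "p dvd g ^ degree p"
    using nullstellensatz_univariate[of p g] assms(2,3) by (auto simp: minimal_poly_def)
  then obtain h where "g ^ degree p = p * h" ..
  then have "peval a (g ^ degree p) = 0"
    using assms by (simp add: peval_mult minimal_poly_def mul_zero_left peval_closed)
  then show ?thesis ..
qed

text \<open>
  A form of the Perron-Frobenius theorem for the cone of all \<open>y\<close> on which the functionals in
  \<open>\<Phi>\<close> are nonnegative.  Describing the cone by functionals makes it closed without a topology on the
  algebra: the limits of the scalar section are taken separately for each \<open>\<phi>\<close>, and the eigenvector
  \<open>cnj (q(r)) x h(r)\<close>, where \<open>p = (X - r)\<^sup>k q\<close> is the minimal polynomial of \<open>x\<close> and \<open>h(r)\<close> is
  \<open>p / (X - r)\<close> at \<open>x\<close>, is the same for all of them.  If the spectral radius is zero, then \<open>x\<close> is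
  nilpotent and its last nonzero power is in the cone.
\<close>

theorem perron_frobenius:
  fixes \<Phi> :: "('a \<Rightarrow> complex) set"
  assumes x: "x \<in> A" "x \<noteq> 0"
    and lin: "\<And>\<phi> u v c. \<phi> \<in> \<Phi> \<Longrightarrow> u \<in> A \<Longrightarrow> v \<in> A \<Longrightarrow> \<phi> (scale c u + v) = c * \<phi> u + \<phi> v"
    and sep: "\<And>u. u \<in> A \<Longrightarrow> (\<And>\<phi>. \<phi> \<in> \<Phi> \<Longrightarrow> \<phi> u = 0) \<Longrightarrow> u = 0"
    and pos: "\<And>\<phi> n. \<phi> \<in> \<Phi> \<Longrightarrow>
      Im (\<phi> (peval x (monom 1 (Suc n)))) = 0 \<and> 0 \<le> Re (\<phi> (peval x (monom 1 (Suc n))))"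
  defines "r \<equiv> spectral_radius scale A mul one x"
  shows "\<exists>y \<in> A. y \<noteq> 0 \<and> mul x y = scale (of_real r) y \<and> mul y x = scale (of_real r) y \<and>
    (\<forall>\<phi> \<in> \<Phi>. Im (\<phi> y) = 0 \<and> 0 \<le> Re (\<phi> y))"
proof -
  obtain p where p: "minimal_poly x p" using ex_minimal_poly[OF x(1)] by blast
  note roots = spectral_radius_root[OF x(1) p, folded r_def]
  obtain z where z: "poly p z = 0" "cmod z = r" using roots(2) by blast
  show ?thesis
  proof (cases "r = 0")
    case True
    have "\<exists>n. peval x ([:0, 1:] ^ n) = 0"
      using roots(1) True by (intro peval_nilpotent[OF x(1) p]) simp
    then have ex: "\<exists>n. peval x (monom 1 n) = 0" by (simp add: monom_altdef)
    define n where "n = (LEAST n. peval x (monom 1 n) = 0)"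
    have n: "peval x (monom 1 n) = 0" "\<And>m. m < n \<Longrightarrow> peval x (monom 1 m) \<noteq> 0"
      unfolding n_def using LeastI_ex[OF ex] not_less_Least by blast+
    have "peval x (monom 1 0) = one" "peval x (monom 1 (Suc 0)) = x"
      using peval_1[OF x(1)] peval_X[OF x(1)] by (simp_all add: monom_0 monom_Suc one_pCons)
    then have "n \<noteq> 0" "n \<noteq> Suc 0" using n(1) one_nonzero x(2) by metis+
    then obtain m where m: "n = Suc (Suc m)" by (metis not0_implies_Suc)
    let ?y = "peval x (monom 1 (Suc m))"
    have "mul x ?y = 0" using n(1) unfolding m peval_monom_Suc[OF x(1), of "Suc m"] .
    then show ?thesis
      using n(2)[of "Suc m"] m pos True peval_closed[OF x(1)] peval_commute[OF x(1)]
      by (intro bexI[of _ ?y]) auto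
  next
    case False
    then have r: "0 < r" using z(2) by (metis norm_ge_zero order_le_less)
    define L where "L \<phi> q = \<phi> (peval x q)" for \<phi> :: "'a \<Rightarrow> complex" and q
    have zero: "\<phi> 0 = 0" if "\<phi> \<in> \<Phi>" for \<phi> using lin[OF that zero_closed zero_closed, of 1] by simp
    have moments: "positive_moments (L \<phi>) p r" if \<phi>: "\<phi> \<in> \<Phi>" for \<phi>
    proof
      show "poly_linear (L \<phi>)"
        using lin[OF \<phi>] x(1) by (simp add: poly_linear_def L_def peval_add peval_smult peval_closed)
      show "annihilates p (L \<phi>)"
        using p x(1) zero[OF \<phi>]
        by (simp add: annihilates_def L_def peval_mult minimal_poly_def mul_zero_left peval_closed)
      show "p \<noteq> 0" using p by (simp add: minimal_poly_def)
      show "cmod w \<le> r" if "poly p w = 0" for w using roots(1)[OF that] .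
      show "Im (L \<phi> (monom 1 (Suc n))) = 0 \<and> 0 \<le> Re (L \<phi> (monom 1 (Suc n)))" for n
        using pos[OF \<phi>] by (simp add: L_def)
    qed (rule r)
    define h where "h l = peval x (synthetic_div p l)" for l
    have h: "h l \<in> A" for l unfolding h_def by (rule peval_closed[OF x(1)])
    have eig: "h l \<noteq> 0" "mul x (h l) = scale l (h l)" if "poly p l = 0" for l
      using eigenvector[OF x(1) p that] by (simp_all add: h_def)
    have qv: "quotient_value (L \<phi>) p l = \<phi> (mul x (h l))" for \<phi> l
      using h by (simp add: quotient_value_def L_def h_def peval_pCons[OF x(1)])
    have "scale z (h z) \<noteq> 0" using eig(1)[OF z(1)] z(2) r by auto
    then obtain \<phi> where \<phi>: "\<phi> \<in> \<Phi>" "\<phi> (scale z (h z)) \<noteq> 0"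
      using sep[of "scale z (h z)"] h scale_closed by blast
    then have root: "poly p r = 0"
      using positive_moments.radius_is_root[OF moments[OF \<phi>(1)] z(2,1)] eig(2)[OF z(1)] by (simp add: qv)
    obtain q where q: "p = [:- complex_of_real r, 1:] ^ order (complex_of_real r) p * q"
      "\<not> [:- complex_of_real r, 1:] dvd q"
      using order_decomp[of p "complex_of_real r"] p unfolding minimal_poly_def by blast
    then have qr: "poly q r \<noteq> 0" by (simp add: poly_eq_0_iff_dvd)
    let ?y = "scale (cnj (poly q r)) (mul x (h r))"
    have y: "?y = scale (cnj (poly q r) * r) (h r)" using eig(2)[OF root] by simp
    have "h r \<noteq> 0" by (rule eig(1)[OF root])
    then have "?y \<noteq> 0" unfolding y using qr r by simp
    moreover have "mul x ?y = scale (of_real r) ?y"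
      unfolding y using eig(2)[OF root] by (simp add: mul_scale_right[OF h x(1)] mult.commute)
    moreover have "mul ?y x = mul x ?y"
      unfolding y mul_scale_right[OF h x(1)] mul_scale_left[OF h x(1)]
      by (simp only: h_def peval_commute[OF x(1)])
    moreover have "Im (\<phi> ?y) = 0 \<and> 0 \<le> Re (\<phi> ?y)" if \<phi>: "\<phi> \<in> \<Phi>" for \<phi>
    proof -
      have "\<phi> ?y = cnj (poly q r) * quotient_value (L \<phi>) p r"
        using lin[OF \<phi> mul_closed[OF x(1) h] zero_closed] zero[OF \<phi>] by (simp add: qv)
      then show ?thesis using positive_moments.leading_term_nonneg[OF moments[OF \<phi>] q(1)] by simp
    qed
    ultimately show ?thesis using h x(1) by (intro bexI[of _ ?y]) (simp_all add: closed)
  qed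
qed

end

section \<open>Self-duality of the positive cone\<close>

lemma ex_interpolating_poly:
  fixes g :: "'b::field \<Rightarrow> 'b"
  assumes "finite S"
  shows "\<exists>f. \<forall>z \<in> S. poly f z = g z"
  using assms
proof (induction S)
  case (insert w S)
  then obtain f where f: "\<forall>z \<in> S. poly f z = g z" by blast
  let ?v = "\<Prod>s \<in> S. [:- s, 1:]"
  let ?f = "f + smult ((g w - poly f w) / poly ?v w) ?v"
  have "poly ?v w \<noteq> 0" using insert.hyps by (auto simp: poly_prod)
  moreover have "poly ?v z = 0" if "z \<in> S" for z using that insert.hyps(1) by (auto simp: poly_prod)
  ultimately have "\<forall>z \<in> insert w S. poly ?f z = g z" using f by simp
  then show ?case by blast
qed simp

text \<open>
  A faithful positive trace replaces representations by operators: with the inner product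
  \<open>tr (u v\<^sup>*)\<close>, selfadjoint elements act by left multiplication as selfadjoint operators.
\<close>

locale tracial_star_algebra = fin_dim_cstar_algebra scale A mul one star
  for scale :: "complex \<Rightarrow> 'a::ab_group_add \<Rightarrow> 'a" and A mul one star +
  fixes tr :: "'a \<Rightarrow> complex"
  assumes tr_linear: "\<lbrakk>u \<in> A; v \<in> A\<rbrakk> \<Longrightarrow> tr (scale c u + v) = c * tr u + tr v"
    and tr_trace: "\<lbrakk>u \<in> A; v \<in> A\<rbrakk> \<Longrightarrow> tr (mul u v) = tr (mul v u)"
    and tr_positive: "u \<in> A \<Longrightarrow> Im (tr (mul u (star u))) = 0 \<and> 0 \<le> Re (tr (mul u (star u)))"
    and tr_faithful: "\<lbrakk>u \<in> A; tr (mul u (star u)) = 0\<rbrakk> \<Longrightarrow> u = 0"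
begin

lemma tr_add: "u \<in> A \<Longrightarrow> v \<in> A \<Longrightarrow> tr (u + v) = tr u + tr v"
  using tr_linear[of u v 1] by simp

lemma tr_zero: "tr 0 = 0"
  using tr_add[of 0 0] zero_closed by simp

lemma tr_scale: "u \<in> A \<Longrightarrow> tr (scale c u) = c * tr u"
  using tr_linear[of u 0 c] zero_closed tr_zero by simp

lemma tr_diff: "u \<in> A \<Longrightarrow> v \<in> A \<Longrightarrow> tr (u - v) = tr u - tr v"
  using tr_add[of "u - v" v] diff_closed by simp

lemma shifted_square:
  assumes "u \<in> A"
  shows "mul (u + scale c one) (star (u + scale c one)) =
    mul u (star u) + (scale (cnj c) u + (scale c (star u) + scale (c * cnj c) one))"
  using assms
  by (simp add: star_add star_scale star_one closed mul_add_left mul_add_right mul_scale_left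
      mul_scale_right mul_one algebra_simps)

lemma tr_star:
  assumes "a \<in> A"
  shows "tr (star a) = cnj (tr a)"
proof -
  have real: "Im (tr one) = 0" using tr_positive[OF one_closed] by (simp add: star_one mul_one one_closed)
  have "Im (cnj c * tr a + c * tr (star a)) = 0" for c
    using tr_positive[of "a + scale c one"] tr_positive[OF assms] real assms
    unfolding shifted_square[OF assms] by (simp add: closed tr_add tr_scale)
  from this[of 1] this[of \<i>] show ?thesis by (simp add: complex_eq_iff)
qed

text \<open>
  Polarization: replacing \<open>u\<close> by \<open>u + 1\<close> and \<open>u + \<i>\<close> isolates \<open>tr (u d)\<close>, which for
  \<open>u = d\<^sup>*\<close> is the square of the norm of \<open>d\<close>.
\<close>

lemma trace_form_nondegenerate:
  assumes d: "d \<in> A" and zero: "\<And>u. u \<in> A \<Longrightarrow> tr (mul (mul u (star u)) d) = 0"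
  shows "d = 0"
proof -
  have eq: "cnj c * tr (mul w d) + c * tr (mul (star w) d) = 0" if w: "w \<in> A" for c w
    using zero[of "w + scale c one"] zero[OF w] zero[OF one_closed] w d
    unfolding shifted_square[OF w]
    by (simp add: closed tr_add tr_scale mul_add_left mul_scale_left mul_one star_one)
  have "tr (mul w d) = 0" if "w \<in> A" for w
    using eq[OF that, of 1] eq[OF that, of \<i>] by (simp add: complex_eq_iff)
  then have "tr (mul d (star d)) = 0" using tr_trace[of d "star d"] d by (simp add: star_closed)
  then show ?thesis by (rule tr_faithful[OF d])
qed

text \<open>
  If \<open>k\<close> is selfadjoint and \<open>k\<^sup>2\<^sup>m = 0\<close>, then \<open>k\<^sup>m (k\<^sup>m)\<^sup>* = 0\<close>, hence \<open>k\<^sup>m = 0\<close> because the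
  trace is faithful; so the exponent can be halved.
\<close>

lemma selfadjoint_nilpotent_eq_0:
  assumes a: "a \<in> A" and self: "star (peval a g) = peval a g" and nil: "peval a (g ^ n) = 0"
  shows "peval a g = 0"
proof -
  have power: "star (peval a (g ^ m)) = peval a (g ^ m)" for m
  proof (induction m)
    case 0
    then show ?case using a by (simp add: peval_1 star_one)
  next
    case (Suc m)
    have "star (peval a (g ^ Suc m)) = mul (star (peval a (g ^ m))) (star (peval a g))"
      using a by (simp add: peval_mult star_mul peval_closed)
    also have "\<dots> = peval a (g ^ m * g)" using a by (simp add: Suc self peval_mult)
    finally show ?case by (simp add: mult.commute)
  qed
  show ?thesis using nil
  proof (induction n rule: less_induct)
    case (less n)
    consider "n = 0" | "n = 1" | "2 \<le> n" by linarith
    then show ?case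
    proof cases
      case 1
      then show ?thesis using less.prems a one_nonzero by (simp add: peval_1)
    next
      case 2
      then show ?thesis using less.prems by simp
    next
      case 3
      \<comment> \<open>Rounding up keeps \<open>2 * ?m \<ge> n\<close>, and \<open>?m < n\<close> because \<open>n \<ge> 2\<close>.\<close>
      let ?m = "(n + 1) div 2"
      have m: "?m < n" "n \<le> ?m + ?m" using 3 by presburger+
      then have "g ^ (?m + ?m) = g ^ n * g ^ (?m + ?m - n)" by (simp flip: power_add)
      then have "peval a (g ^ (?m + ?m)) = 0"
        using less.prems a by (simp add: peval_mult mul_zero_left peval_closed)
      then have "mul (peval a (g ^ ?m)) (star (peval a (g ^ ?m))) = 0"
        unfolding power using a by (simp add: peval_power_add)
      then have "peval a (g ^ ?m) = 0"
        using tr_faithful[OF peval_closed[OF a]] tr_zero by metis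
      then show ?thesis using less.IH[OF m(1)] by blast
    qed
  qed
qed

text \<open>
  The positive cone is its own dual with respect to the trace.  Pairing \<open>a\<close> with squares shows that
  \<open>a\<close> is selfadjoint, and pairing it with the square of an eigenvector shows that the roots of its
  minimal polynomial are nonnegative.  A polynomial \<open>f\<close> that takes the values \<open>\<surd>z\<close> at these roots
  then gives a square root \<open>v = f(a)\<close>: the element \<open>v v\<^sup>* - a\<close> is selfadjoint, and it is nilpotent
  because \<open>f cnj(f) - X\<close> vanishes at the roots.
\<close>

theorem positive_cone_self_dual:
  assumes a: "a \<in> A"
    and pos: "\<And>u. u \<in> A \<Longrightarrow> Im (tr (mul (mul u (star u)) a)) = 0 \<and> 0 \<le> Re (tr (mul (mul u (star u)) a))"
  shows "\<exists>v \<in> A. a = mul v (star v)"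
proof -
  have "a - star a = 0"
  proof (rule trace_form_nondegenerate)
    fix u assume u: "u \<in> A"
    let ?b = "mul u (star u)"
    have b: "?b \<in> A" "star ?b = ?b" using u by (simp_all add: closed star_mul star_star)
    have "tr (mul ?b (star a)) = cnj (tr (mul a ?b))"
      using tr_star[of "mul a ?b"] a b by (simp add: star_mul mul_closed)
    also have "\<dots> = tr (mul ?b a)"
      using pos[OF u] tr_trace[OF a b(1)] by (simp add: complex_eq_iff)
    finally show "tr (mul ?b (a - star a)) = 0" using a b by (simp add: mul_diff_right tr_diff closed)
  qed (use a in \<open>simp add: closed\<close>)
  then have self: "star a = a" by simp
  obtain p where p: "minimal_poly a p" using ex_minimal_poly[OF a] by blast
  have root: "z = complex_of_real (Re z)" "0 \<le> Re z" if z: "poly p z = 0" for z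
  proof -
    let ?h = "peval a (synthetic_div p z)"
    note h = peval_closed[OF a, of "synthetic_div p z"] and eig = eigenvector[OF a p z]
    let ?t = "tr (mul ?h (star ?h))"
    have "tr (mul (mul ?h (star ?h)) a) = tr (mul (mul a ?h) (star ?h))"
      using tr_trace[OF _ a, of "mul ?h (star ?h)"] mul_assoc[OF a h star_closed[OF h]] h by (simp add: closed)
    also have "\<dots> = z * ?t" using h by (simp add: eig(2) mul_scale_left tr_scale closed)
    finally have prod: "Im (z * ?t) = 0" "0 \<le> Re (z * ?t)" using pos[OF h] by simp_all
    have "?t \<noteq> 0" using tr_faithful[OF h] eig(1) by blast
    then have "Im ?t = 0" "0 < Re ?t" using tr_positive[OF h] by (auto simp: complex_eq_iff)
    then show "z = complex_of_real (Re z)" "0 \<le> Re z"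
      using prod by (auto simp: complex_eq_iff zero_le_mult_iff)
  qed
  have "finite {z. poly p z = 0}" using poly_roots_finite[of p] p by (simp add: minimal_poly_def)
  from ex_interpolating_poly[OF this, of "\<lambda>z. complex_of_real (sqrt (Re z))"]
  obtain f where f: "\<And>z. poly p z = 0 \<Longrightarrow> poly f z = complex_of_real (sqrt (Re z))" by auto
  let ?g = "f * map_poly cnj f - [:0, 1:]"
  let ?v = "peval a f"
  have v: "?v \<in> A" by (rule peval_closed[OF a])
  have g: "peval a ?g = mul ?v (star ?v) - a"
    using a by (simp add: peval_diff peval_mult star_peval self peval_X)
  have "poly ?g z = 0" if z: "poly p z = 0" for z
  proof -
    have "cnj z = z" using root(1)[OF z] by (metis complex_cnj_complex_of_real)
    then have "poly (map_poly cnj f) z = complex_of_real (sqrt (Re z))" using f[OF z] by simp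
    then have "poly ?g z = complex_of_real (sqrt (Re z)) * complex_of_real (sqrt (Re z)) - z"
      unfolding poly_diff poly_mult f[OF z] by simp
    also have "\<dots> = complex_of_real (Re z) - z"
      unfolding of_real_mult[symmetric] using root(2)[OF z] by simp
    finally show ?thesis using root(1)[OF z] by simp
  qed
  then obtain n where "peval a (?g ^ n) = 0" using peval_nilpotent[OF a p] by blast
  moreover have "star (peval a ?g) = peval a ?g"
    unfolding g using v a self by (simp add: star_diff star_mul star_star closed)
  ultimately have "peval a ?g = 0" using selfadjoint_nilpotent_eq_0[OF a] by blast
  then have "a = mul ?v (star ?v)" unfolding g by simp
  then show ?thesis using v by blast
qed

lemma tr_square_square:
  assumes "u \<in> A" "v \<in> A"
  shows "Im (tr (mul (mul u (star u)) (mul v (star v)))) = 0 \<and>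
    0 \<le> Re (tr (mul (mul u (star u)) (mul v (star v))))"
proof -
  let ?w = "mul (star v) u"
  have w: "?w \<in> A" "star ?w = mul (star u) v" using assms by (simp_all add: closed star_mul star_star)
  have "tr (mul ?w (star ?w)) = tr (mul (star v) (mul u (mul (star u) v)))"
    unfolding w(2) using assms by (simp add: mul_assoc closed)
  also have "\<dots> = tr (mul (mul u (mul (star u) v)) (star v))"
    using assms by (intro tr_trace) (simp_all add: closed)
  also have "\<dots> = tr (mul (mul u (star u)) (mul v (star v)))"
    using assms by (simp add: mul_assoc closed)
  finally show ?thesis using tr_positive[OF w(1)] by simp
qed

end

section \<open>Computing the classes of an equivalence relation\<close>

text \<open>
  A partition of a list of elements is represented by an association list from elements to labels.
  Starting from the discrete partition, the classes of two elements are merged by overwriting the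
  label of the second one with that of the first.
\<close>

definition lab :: "('a \<times> 'a) list \<Rightarrow> 'a \<Rightarrow> 'a" where
  "lab l x = the (map_of l x)"

definition labelled :: "('a \<times> 'a) list \<Rightarrow> 'a set" where
  "labelled l = fst ` set l"

definition replace_label :: "'a \<Rightarrow> 'a \<Rightarrow> ('a \<times> 'a) list \<Rightarrow> ('a \<times> 'a) list" where
  "replace_label p q l = map (\<lambda>(x, c). (x, if c = p then q else c)) l"

definition merge :: "'a \<times> 'a \<Rightarrow> ('a \<times> 'a) list \<Rightarrow> ('a \<times> 'a) list" where
  "merge e l = replace_label (lab l (snd e)) (lab l (fst e)) l"

definition classes :: "'a list \<Rightarrow> ('a \<times> 'a) list \<Rightarrow> ('a \<times> 'a) list" where
  "classes xs es = fold merge es (map (\<lambda>x. (x, x)) xs)"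

lemma keys_replace_label: "labelled (replace_label p q l) = labelled l"
  by (force simp: replace_label_def labelled_def)

lemma labelled_Cons: "labelled (z # l) = insert (fst z) (labelled l)"
  by (simp add: labelled_def)

lemma lab_replace_label:
  "x \<in> labelled l \<Longrightarrow> lab (replace_label p q l) x = (if lab l x = p then q else lab l x)"
proof (induction l)
  case (Cons z l)
  then show ?case by (cases z) (auto simp: lab_def replace_label_def labelled_Cons)
qed (simp add: labelled_def)

lemma keys_merge: "labelled (merge e l) = labelled l"
  by (simp add: merge_def keys_replace_label)

lemma lab_merge:
  "x \<in> labelled l \<Longrightarrow>
   lab (merge e l) x = (if lab l x = lab l (snd e) then lab l (fst e) else lab l x)"
  by (simp add: merge_def lab_replace_label)

lemma fold_merge_coarser:
  assumes "x \<in> labelled l" "y \<in> labelled l" "lab l x = lab l y"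
  shows "lab (fold merge es l) x = lab (fold merge es l) y"
  using assms by (induction es arbitrary: l) (simp_all add: keys_merge lab_merge)

lemma fold_merge_merges:
  assumes "set es \<subseteq> labelled l \<times> labelled l" "(a, b) \<in> set es"
  shows "lab (fold merge es l) a = lab (fold merge es l) b"
  using assms
proof (induction es arbitrary: l)
  case (Cons e es)
  show ?case
  proof (cases "e = (a, b)")
    case True
    have "lab (merge e l) a = lab (merge e l) b"
      using True Cons.prems(1) by (auto simp: lab_merge)
    then show ?thesis
      using True Cons.prems(1) by (auto simp: keys_merge intro!: fold_merge_coarser)
  next
    case False
    then show ?thesis using Cons by (auto simp: keys_merge)
  qed
qed simp

lemma fold_merge_sound:
  assumes "set es \<subseteq> E" "E \<subseteq> labelled l \<times> labelled l"
    and "\<forall>x \<in> labelled l. (x, lab l x) \<in> (E \<union> E\<inverse>)\<^sup>*" "x \<in> labelled l"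
  shows "(x, lab (fold merge es l) x) \<in> (E \<union> E\<inverse>)\<^sup>*"
  using assms
proof (induction es arbitrary: l)
  case (Cons e es)
  obtain a b where e: "e = (a, b)" by (cases e)
  have ab: "(a, b) \<in> E" "a \<in> labelled l" "b \<in> labelled l"
    using Cons.prems(1,2) e by auto
  have "sym ((E \<union> E\<inverse>)\<^sup>*)" by (intro sym_rtrancl) (auto simp: sym_def)
  then have sym: "(v, u) \<in> (E \<union> E\<inverse>)\<^sup>*" if "(u, v) \<in> (E \<union> E\<inverse>)\<^sup>*" for u v
    using that by (meson symD)
  have "(y, lab (merge e l) y) \<in> (E \<union> E\<inverse>)\<^sup>*" if "y \<in> labelled l" for y
  proof (cases "lab l y = lab l b")
    case True
    have "(y, lab l b) \<in> (E \<union> E\<inverse>)\<^sup>*" using Cons.prems(3) that True by metis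
    moreover have "(lab l b, b) \<in> (E \<union> E\<inverse>)\<^sup>*" using Cons.prems(3) ab(3) sym by blast
    moreover have "(b, a) \<in> (E \<union> E\<inverse>)\<^sup>*" using ab(1) by blast
    moreover have "(a, lab l a) \<in> (E \<union> E\<inverse>)\<^sup>*" using Cons.prems(3) ab(2) by blast
    ultimately show ?thesis using True e that by (simp add: lab_merge)
  next
    case False
    then show ?thesis using Cons.prems(3) e that by (simp add: lab_merge)
  qed
  then show ?case
    using Cons.IH[of "merge e l"] Cons.prems by (auto simp: keys_merge)
qed simp

lemma lab_map_id: "x \<in> set xs \<Longrightarrow> lab (map (\<lambda>x. (x, x)) xs) x = x"
  unfolding lab_def by (induction xs) auto

theorem lab_classes_eq_iff:
  assumes "set es \<subseteq> set xs \<times> set xs" "x \<in> set xs" "y \<in> set xs"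
  shows "lab (classes xs es) x = lab (classes xs es) y \<longleftrightarrow> (x, y) \<in> (set es \<union> (set es)\<inverse>)\<^sup>*"
proof
  let ?E = "set es \<union> (set es)\<inverse>"
  have keys: "labelled (map (\<lambda>x. (x, x)) xs) = set xs" by (force simp: labelled_def)
  have "sym (?E\<^sup>*)" by (intro sym_rtrancl) (auto simp: sym_def)
  moreover have sound: "(z, lab (classes xs es) z) \<in> ?E\<^sup>*" if "z \<in> set xs" for z
    unfolding classes_def using that assms(1)
    by (intro fold_merge_sound) (simp_all only: keys order_refl, auto simp: lab_map_id)
  ultimately show "(x, y) \<in> ?E\<^sup>*" if "lab (classes xs es) x = lab (classes xs es) y"
    using that assms(2,3) sound[of x] sound[of y] by (metis rtrancl_trans symD)
  assume "(x, y) \<in> ?E\<^sup>*"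
  then show "lab (classes xs es) x = lab (classes xs es) y"
  proof (induction rule: rtrancl_induct)
    case (step y z)
    then have "lab (classes xs es) y = lab (classes xs es) z"
      using step.hyps(2) fold_merge_merges[of es "map (\<lambda>x. (x, x)) xs"] assms(1)
      unfolding classes_def keys by auto
    then show ?case using step.IH by simp
  qed simp
qed

section \<open>Planarity of tangles without closed loops\<close>

definition point_list :: "colour list \<Rightarrow> (nat \<times> nat) list" where
  "point_list cs = [(d, i). d \<leftarrow> [0..<length cs], i \<leftarrow> [0..<2 * fst (cs ! d)]]"

definition interval_list :: "colour list \<Rightarrow> (nat \<times> nat) list" where
  "interval_list cs = [(d, i). d \<leftarrow> [0..<length cs], i \<leftarrow> [0..<max 1 (2 * fst (cs ! d))]]"

lemma set_point_list: "set (point_list cs) = points cs"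
  by (force simp: point_list_def points_def)

lemma set_interval_list: "set (interval_list cs) = intervals cs"
  by (force simp: interval_list_def intervals_def)

text \<open>
  A boundary point separates two intervals of opposite shades, so a shade selects one of them.
\<close>

definition flank :: "colour list \<Rightarrow> nat \<times> nat \<Rightarrow> bool \<Rightarrow> nat \<times> nat" where
  "flank cs p b = (if shade cs p = b then p else next_interval cs p)"

lemma shade_next_interval: "p \<in> points cs \<Longrightarrow> shade cs (next_interval cs p) \<longleftrightarrow> \<not> shade cs p"
  by (auto simp: points_def shade_def next_interval_def even_mod_2_iff dvd_mod_iff)

lemma flank_iff:
  "p \<in> points cs \<Longrightarrow> a \<in> flanks cs p \<and> shade cs a = b \<longleftrightarrow> a = flank cs p b"
  by (auto simp: flanks_def flank_def shade_next_interval)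

lemma shade_flank: "p \<in> points cs \<Longrightarrow> shade cs (flank cs p b) = b"
  using flank_iff by blast

lemma flank_in_intervals: "p \<in> points cs \<Longrightarrow> flank cs p b \<in> intervals cs"
  by (auto simp: flank_def points_def intervals_def next_interval_def)

text \<open>
  What makes the regions beside a string well defined: both its ends see the same region on each side.
\<close>

definition side_match :: "colour list \<Rightarrow> (nat \<times> nat \<Rightarrow> nat) \<Rightarrow> (nat \<times> nat \<Rightarrow> nat) \<Rightarrow> bool" where
  "side_match cs str reg \<longleftrightarrow> (\<forall>p \<in> points cs. \<forall>q \<in> points cs. \<forall>b.
     str p = str q \<longrightarrow> reg (flank cs p b) = reg (flank cs q b))"

lemma side_matchD:
  "side_match cs str reg \<Longrightarrow> p \<in> points cs \<Longrightarrow> q \<in> points cs \<Longrightarrow> str p = str q \<Longrightarrow>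
   reg (flank cs p b) = reg (flank cs q b)"
  unfolding side_match_def by blast

text \<open>
  The boundary points are grouped by strings, so that each string is examined only once.
\<close>

definition strand_ends :: "colour list \<Rightarrow> (nat \<times> nat \<Rightarrow> nat) \<Rightarrow> (nat \<times> nat) list list" where
  "strand_ends cs str = (let zs = map (\<lambda>p. (str p, p)) (point_list cs) in
     map (\<lambda>t. map snd (filter (\<lambda>z. fst z = t) zs)) (remdups (map fst zs)))"

lemma strand_ends_eq:
  "strand_ends cs str =
   map (\<lambda>t. filter (\<lambda>p. str p = t) (point_list cs)) (remdups (map str (point_list cs)))"
  by (simp add: strand_ends_def filter_map comp_def)

definition clean_arc :: "colour list \<Rightarrow> (nat \<times> nat \<Rightarrow> nat) \<Rightarrow> (nat \<times> nat) list \<Rightarrow> bool" where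
  "clean_arc cs reg e \<longleftrightarrow> (case e of
     [p, q] \<Rightarrow> emits cs p \<noteq> emits cs q \<and> reg (flank cs p True) = reg (flank cs q True) \<and>
               reg (flank cs p False) = reg (flank cs q False)
   | _ \<Rightarrow> False)"

definition boundary_steps ::
  "colour list \<Rightarrow> (nat \<times> nat \<Rightarrow> nat) \<Rightarrow> ((nat \<times> nat) \<times> (nat \<times> nat)) list" where
  "boundary_steps cs str = concat (map (\<lambda>e. case e of
     [p, q] \<Rightarrow> [(flank cs p True, flank cs q True), (flank cs p False, flank cs q False)]
   | _ \<Rightarrow> []) (strand_ends cs str))"

text \<open>
  Planarity as a computation.  The pairs of a region with its shade form a list with distinct first
  components iff the shading is well defined.  Connectedness is tested by merging the regions that touch
  a common disc; this suffices because every string ends at a disc, whose two intervals beside that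
  end already touch the two sides of the string.  The boundary components are the classes of disc
  intervals generated by following the sides of the strings.
\<close>

definition planar_check ::
  "colour list \<Rightarrow> (nat \<times> nat \<Rightarrow> nat) \<Rightarrow> (nat \<times> nat \<Rightarrow> nat) \<Rightarrow> bool" where
  "planar_check cs str reg \<longleftrightarrow>
     cs \<noteq> [] \<and>
     (\<forall>e \<in> set (strand_ends cs str). clean_arc cs reg e) \<and>
     distinct (map fst (remdups (map (\<lambda>a. (reg a, shade cs a)) (interval_list cs)))) \<and>
     length (remdups (map snd (classes (remdups (map reg (interval_list cs)))
        (map (\<lambda>a. (reg a, reg (fst a, 0))) (interval_list cs))))) = 1 \<and>
     length cs + 2 * length (remdups (map reg (interval_list cs))) =
       2 + length (strand_ends cs str) +
       length (remdups (map snd (classes (interval_list cs) (boundary_steps cs str))))"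

lemma fold_merge_map_fst: "map fst (fold merge es l) = map fst l"
proof (induction es arbitrary: l)
  case (Cons e es)
  have "map fst (merge e l) = map fst l"
    by (simp add: merge_def replace_label_def comp_def case_prod_unfold)
  then show ?case using Cons by simp
qed simp

lemma classes_keys: "map fst (classes xs es) = xs"
  by (simp add: classes_def fold_merge_map_fst comp_def)

lemma set_class_labels:
  assumes "distinct xs"
  shows "set (map snd (classes xs es)) = lab (classes xs es) ` set xs"
proof -
  have keys: "map fst (classes xs es) = xs" by (rule classes_keys)
  have "snd z = lab (classes xs es) (fst z)" if "z \<in> set (classes xs es)" for z
    using that assms keys unfolding lab_def by (metis map_of_eq_Some_iff option.sel prod.collapse)
  then have "snd ` set (classes xs es) = lab (classes xs es) ` (fst ` set (classes xs es))"
    by (force simp: image_image)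
  then show ?thesis using arg_cong[OF keys, of set] by simp
qed

lemma card_quotient_kernel:
  assumes "\<And>x y. x \<in> X \<Longrightarrow> (x, y) \<in> R \<longleftrightarrow> y \<in> X \<and> l x = l y"
  shows "card (X // R) = card (l ` X)"
proof -
  have "bij_betw (\<lambda>c. {y \<in> X. l y = c}) (l ` X) (X // R)"
  proof (rule bij_betw_imageI)
    show "inj_on (\<lambda>c. {y \<in> X. l y = c}) (l ` X)"
    proof (rule inj_onI)
      fix c d assume c: "c \<in> l ` X" and eq: "{y \<in> X. l y = c} = {y \<in> X. l y = d}"
      from c obtain x where x: "x \<in> X" "l x = c" by blast
      then have "x \<in> {y \<in> X. l y = d}" unfolding eq[symmetric] by simp
      with x show "c = d" by simp
    qed
    have "R `` {x} = {y \<in> X. l y = l x}" if "x \<in> X" for x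
    proof (rule set_eqI)
      fix y show "y \<in> R `` {x} \<longleftrightarrow> y \<in> {y \<in> X. l y = l x}"
        unfolding Image_singleton_iff mem_Collect_eq assms[OF that] eq_commute[of "l y"] ..
    qed
    then show "(\<lambda>c. {y \<in> X. l y = c}) ` l ` X = X // R"
      unfolding quotient_def by blast
  qed
  then show ?thesis using bij_betw_same_card by metis
qed

lemma distinct_interval_list: "distinct (interval_list cs)"
proof -
  have "distinct (concat (map (\<lambda>d. map (Pair d) [0..<f d]) ds))" if "distinct ds" for ds and f :: "nat \<Rightarrow> nat"
    using that by (induction ds) (auto simp: distinct_map inj_on_def)
  then show ?thesis by (simp add: interval_list_def)
qed

lemma loopless_select [simp]:
  "colours (loopless cs str reg) = cs"
  "strings (loopless cs str reg) = str ` points cs"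
  "regions (loopless cs str reg) = reg ` intervals cs"
  "string_at (loopless cs str reg) = str"
  "region_at (loopless cs str reg) = reg"
  by (simp_all add: loopless_def)

text \<open>
  The definite description in the definition of \<open>loopless\<close> resolves as soon as the sides match.
\<close>

lemma region_beside_loopless:
  assumes "side_match cs str reg" "p \<in> points cs"
  shows "region_beside (loopless cs str reg) (str p) b = reg (flank cs p b)"
proof -
  have "(\<exists>q \<in> points cs. \<exists>a \<in> flanks cs q. str q = str p \<and> shade cs a = b \<and> reg a = r)
    \<longleftrightarrow> r = reg (flank cs p b)" for r
  proof
    assume "\<exists>q \<in> points cs. \<exists>a \<in> flanks cs q. str q = str p \<and> shade cs a = b \<and> reg a = r"
    then obtain q a where q: "q \<in> points cs" "a \<in> flanks cs q" "str q = str p" "shade cs a = b" "reg a = r"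
      by blast
    then have "a = flank cs q b" using flank_iff by blast
    then show "r = reg (flank cs p b)" using side_matchD[OF assms(1) q(1) assms(2) q(3)] q(5) by simp
  next
    assume "r = reg (flank cs p b)"
    then show "\<exists>q \<in> points cs. \<exists>a \<in> flanks cs q. str q = str p \<and> shade cs a = b \<and> reg a = r"
      using flank_iff[OF assms(2), of "flank cs p b" b] assms(2) by blast
  qed
  then show ?thesis by (simp add: loopless_def)
qed

lemma ends_of_loopless: "ends_of (loopless cs str reg) t = {p \<in> points cs. str p = t}"
  by (simp add: ends_of_def)

text \<open>
  Each conjunct of the check is one clause of planarity, and Euler's formula is compared literally.  The
  one difference is that the boundary relation of a planar tangle relates the flanks of every pair of ends
  of a string, in both orders and including equal ends, while the computation uses each string once; the
  reflexive, symmetric and transitive closures agree.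
\<close>

theorem planar_loopless:
  assumes "planar_check cs str reg"
  shows "planar_tangle (loopless cs str reg)"
proof -
  let ?T = "loopless cs str reg"
  let ?ps = "point_list cs" let ?is = "interval_list cs"
  note [simp] = set_point_list set_interval_list
  have fin: "finite (points cs)" "finite (intervals cs)"
    by (metis set_point_list List.finite_set) (metis set_interval_list List.finite_set)
  have ne: "cs \<noteq> []" and arcs: "\<And>e. e \<in> set (strand_ends cs str) \<Longrightarrow> clean_arc cs reg e"
    and sh0: "distinct (map fst (remdups (map (\<lambda>a. (reg a, shade cs a)) ?is)))"
    and conn: "length (remdups (map snd (classes (remdups (map reg ?is))
        (map (\<lambda>a. (reg a, reg (fst a, 0))) ?is)))) = 1"
    and euler: "length cs + 2 * length (remdups (map reg ?is)) = 2 + length (strand_ends cs str) +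
       length (remdups (map snd (classes ?is (boundary_steps cs str))))"
    using assms unfolding planar_check_def by blast+
  have arc: "\<exists>p q. filter (\<lambda>r. str r = t) ?ps = [p, q] \<and> {r \<in> points cs. str r = t} = {p, q} \<and>
      emits cs p \<noteq> emits cs q \<and> (\<forall>b. reg (flank cs p b) = reg (flank cs q b))"
    if "t \<in> str ` points cs" for t
  proof -
    have "filter (\<lambda>r. str r = t) ?ps \<in> set (strand_ends cs str)"
      using that by (simp add: strand_ends_eq)
    from arcs[OF this] obtain p q where pq: "filter (\<lambda>r. str r = t) ?ps = [p, q]"
      "emits cs p \<noteq> emits cs q" "reg (flank cs p True) = reg (flank cs q True)"
      "reg (flank cs p False) = reg (flank cs q False)"
      by (auto simp: clean_arc_def split: list.splits)
    then have "reg (flank cs p b) = reg (flank cs q b)" for b by (cases b) simp_all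
    moreover have "{r \<in> points cs. str r = t} = set (filter (\<lambda>r. str r = t) ?ps)" by simp
    ultimately show ?thesis using pq(1,2) by auto
  qed
  have sm: "side_match cs str reg"
    unfolding side_match_def
  proof (intro ballI allI impI)
    fix p q b assume "p \<in> points cs" "q \<in> points cs" "str p = str q"
    then have "p \<in> {r \<in> points cs. str r = str q}" "q \<in> {r \<in> points cs. str r = str q}" by simp_all
    moreover obtain p' q' where "{r \<in> points cs. str r = str q} = {p', q'}"
      "reg (flank cs p' b) = reg (flank cs q' b)"
      using arc[of "str q"] \<open>q \<in> points cs\<close> by blast
    ultimately show "reg (flank cs p b) = reg (flank cs q b)" by auto
  qed
  have sh: "shade cs a = shade cs b" if "a \<in> intervals cs" "b \<in> intervals cs" "reg a = reg b" for a b
  proof -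
    have "inj_on fst ((\<lambda>a. (reg a, shade cs a)) ` intervals cs)"
      using sh0 by (simp add: distinct_map)
    moreover have "(reg a, shade cs a) \<in> (\<lambda>a. (reg a, shade cs a)) ` intervals cs"
      "(reg b, shade cs b) \<in> (\<lambda>a. (reg a, shade cs a)) ` intervals cs"
      using that(1,2) by - (rule imageI, assumption)+
    ultimately have "(reg a, shade cs a) = (reg b, shade cs b)"
      unfolding inj_on_def using that(3) by (metis fst_conv)
    then show ?thesis by simp
  qed
  have beside: "region_beside ?T (str p) b = reg (flank cs p b)" if "p \<in> points cs" for p b
    using region_beside_loopless[OF sm that] .
  have ends: "\<exists>p q. ends_of ?T t = {p, q} \<and> emits cs p \<and> \<not> emits cs q" if t: "t \<in> strings ?T" for t
  proof -
    have "t \<in> str ` points cs" using t by simp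
    from arc[OF this] obtain p q where "ends_of ?T t = {p, q}" "emits cs p \<noteq> emits cs q"
      unfolding ends_of_loopless by blast
    then show ?thesis by (metis insert_commute)
  qed
  have loops: "loops ?T = {}" by (auto simp: loops_def ends_of_loopless)
  have incidence: "shaded_incidence ?T"
  proof -
    have "\<exists>sh. (\<forall>a \<in> intervals cs. sh (reg a) = shade cs a) \<and>
           (\<forall>t \<in> strings ?T. \<forall>b. sh (region_beside ?T t b) = b)"
    proof (intro exI conjI ballI allI)
      let ?sh = "\<lambda>r. shade cs (SOME a. a \<in> intervals cs \<and> reg a = r)"
      show *: "?sh (reg a) = shade cs a" if "a \<in> intervals cs" for a
        by (rule sh[OF _ that]) (use someI_ex[of "\<lambda>b. b \<in> intervals cs \<and> reg b = reg a"] that in blast)+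
      show "?sh (region_beside ?T t b) = b" if t: "t \<in> strings ?T" for t b
      proof -
        obtain p where p: "p \<in> points cs" "t = str p" using t unfolding loopless_select by blast
        show ?thesis unfolding p(2) beside[OF p(1)] *[OF flank_in_intervals[OF p(1)]]
          by (rule shade_flank[OF p(1)])
      qed
    qed
    moreover have "reg a = region_beside ?T (str p) (shade cs a)"
      if "p \<in> points cs" "a \<in> flanks cs p" for p a
      using beside[OF that(1)] flank_iff[OF that(1)] that(2) by metis
    moreover have "{region_beside ?T t b | t b. t \<in> strings ?T} \<subseteq> reg ` intervals cs"
      using beside flank_in_intervals by auto
    ultimately show ?thesis
      using ne fin ends unfolding shaded_incidence_def Let_def loopless_select by blast
  qed
  have connected: "(r, r') \<in> (region_adjacent ?T)\<^sup>*" if "r \<in> regions ?T" "r' \<in> regions ?T" for r r'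
  proof -
    let ?es = "map (\<lambda>a. (reg a, reg (fst a, 0))) ?is" and ?xs = "remdups (map reg ?is)"
    have zero: "(fst a, 0) \<in> intervals cs" if "a \<in> intervals cs" for a
      using that by (auto simp: intervals_def)
    obtain c where c: "remdups (map snd (classes ?xs ?es)) = [c]"
      using conn by (auto simp: length_Suc_conv)
    then have single: "lab (classes ?xs ?es) ` set ?xs = {c}"
      using set_class_labels[of ?xs ?es] by (metis distinct_remdups empty_set list.simps(15) set_remdups)
    have "r \<in> set ?xs" "r' \<in> set ?xs" using that by simp_all
    then have "lab (classes ?xs ?es) r \<in> {c}" "lab (classes ?xs ?es) r' \<in> {c}"
      unfolding single[symmetric] by - (rule imageI, assumption)+
    then have "lab (classes ?xs ?es) r = lab (classes ?xs ?es) r'" by simp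
    then have "(r, r') \<in> (set ?es \<union> (set ?es)\<inverse>)\<^sup>*"
      using that zero by (subst (asm) lab_classes_eq_iff) auto
    moreover have "set ?es \<union> (set ?es)\<inverse> \<subseteq> region_adjacent ?T"
      unfolding region_adjacent_def using zero by fastforce
    ultimately show ?thesis using rtrancl_mono by blast
  qed
  have components: "boundary_components ?T = length (remdups (map snd (classes ?is (boundary_steps cs str))))"
  proof -
    let ?E = "{(a, b). \<exists>p \<in> points cs. \<exists>q \<in> points cs. a \<in> flanks cs p \<and> b \<in> flanks cs q \<and>
        str p = str q \<and> shade cs a = shade cs b}"
    let ?S = "set (boundary_steps cs str)"
    have steps: "(a, b) \<in> ?S \<longleftrightarrow> (\<exists>t \<in> str ` points cs. \<exists>p q c. filter (\<lambda>r. str r = t) ?ps = [p, q] \<and>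
        a = flank cs p c \<and> b = flank cs q c)" for a b
    proof -
      have "(a, b) \<in> set (case e of [p, q] \<Rightarrow>
            [(flank cs p True, flank cs q True), (flank cs p False, flank cs q False)] | _ \<Rightarrow> []) \<longleftrightarrow>
          (\<exists>p q c. e = [p, q] \<and> a = flank cs p c \<and> b = flank cs q c)" for e
        by (auto split: list.splits simp: ex_bool_eq)
      then show ?thesis by (simp add: boundary_steps_def strand_ends_eq)
    qed
    have E: "(a, b) \<in> ?E \<longleftrightarrow> (\<exists>p \<in> points cs. \<exists>q \<in> points cs. \<exists>c. str p = str q \<and>
          a = flank cs p c \<and> b = flank cs q c)" for a b
    proof
      assume "(a, b) \<in> ?E"
      then obtain p q where *: "p \<in> points cs" "q \<in> points cs" "a \<in> flanks cs p" "b \<in> flanks cs q"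
        "str p = str q" "shade cs a = shade cs b" by blast
      then have "a = flank cs p (shade cs a)" "b = flank cs q (shade cs a)"
        using flank_iff by metis+
      with * show "\<exists>p \<in> points cs. \<exists>q \<in> points cs. \<exists>c. str p = str q \<and>
        a = flank cs p c \<and> b = flank cs q c" by blast
    next
      assume "\<exists>p \<in> points cs. \<exists>q \<in> points cs. \<exists>c. str p = str q \<and>
        a = flank cs p c \<and> b = flank cs q c"
      then obtain p q c where *: "p \<in> points cs" "q \<in> points cs" "str p = str q"
        "a = flank cs p c" "b = flank cs q c" by blast
      then have "a \<in> flanks cs p \<and> shade cs a = c" "b \<in> flanks cs q \<and> shade cs b = c"
        using flank_iff by blast+
      with * show "(a, b) \<in> ?E" by blast
    qed
    have S_E: "?S \<union> ?S\<inverse> \<subseteq> ?E"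
    proof -
      have "(a, b) \<in> ?E \<and> (b, a) \<in> ?E" if "(a, b) \<in> ?S" for a b
      proof -
        obtain t p q c where *: "filter (\<lambda>r. str r = t) ?ps = [p, q]" "a = flank cs p c" "b = flank cs q c"
          using \<open>(a, b) \<in> ?S\<close> unfolding steps by blast
        have "set (filter (\<lambda>r. str r = t) ?ps) = {p, q}" unfolding *(1) by simp
        then have "p \<in> points cs \<and> str p = t" "q \<in> points cs \<and> str q = t" by auto
        then show ?thesis unfolding E using *(2,3) by metis
      qed
      then show ?thesis by auto
    qed
    have E_S: "?E \<subseteq> (?S \<union> ?S\<inverse>)\<^sup>="
    proof (rule subrelI)
      fix a b assume "(a, b) \<in> ?E"
      then obtain p q c where *: "p \<in> points cs" "q \<in> points cs" "str p = str q"
        "a = flank cs p c" "b = flank cs q c" unfolding E by blast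
      obtain p' q' where pq: "filter (\<lambda>r. str r = str q) ?ps = [p', q']"
        "{r \<in> points cs. str r = str q} = {p', q'}"
        using arc[of "str q"] *(2) by blast
      then have "(flank cs p' c, flank cs q' c) \<in> ?S" unfolding steps using *(2) by blast
      moreover have "p \<in> {r \<in> points cs. str r = str q}" "q \<in> {r \<in> points cs. str r = str q}"
        using * by simp_all
      then have "p \<in> {p', q'}" "q \<in> {p', q'}" unfolding pq(2) .
      ultimately show "(a, b) \<in> (?S \<union> ?S\<inverse>)\<^sup>=" using *(4,5) by auto
    qed
    have closure: "?E\<^sup>* = (?S \<union> ?S\<inverse>)\<^sup>*"
      by (rule rtrancl_subset[OF S_E subset_trans[OF E_S]]) auto
    have sub: "?S \<subseteq> intervals cs \<times> intervals cs"
    proof (rule subrelI)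
      fix a b assume "(a, b) \<in> ?S"
      then have "(a, b) \<in> ?E" using S_E by blast
      then show "(a, b) \<in> intervals cs \<times> intervals cs" unfolding E using flank_in_intervals by auto
    qed
    have same: "same_boundary ?T = ?E\<^sup>*" by (simp add: same_boundary_def)
    have iff: "(x, y) \<in> ?E\<^sup>* \<longleftrightarrow> y \<in> intervals cs \<and>
        lab (classes ?is (boundary_steps cs str)) x = lab (classes ?is (boundary_steps cs str)) y"
      if x: "x \<in> intervals cs" for x y
    proof -
      have "y \<in> intervals cs" if "(x, y) \<in> (?S \<union> ?S\<inverse>)\<^sup>*"
        using that x sub by (induction rule: rtrancl_induct) auto
      then show ?thesis
        using lab_classes_eq_iff[of "boundary_steps cs str" ?is x y] sub x unfolding closure by auto
    qed
    have "card (intervals cs // ?E\<^sup>*) = card (lab (classes ?is (boundary_steps cs str)) ` intervals cs)"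
      by (rule card_quotient_kernel[OF iff])
    also have "\<dots> = card (set (map snd (classes ?is (boundary_steps cs str))))"
      by (simp only: set_class_labels[OF distinct_interval_list] set_interval_list)
    finally show ?thesis
      unfolding boundary_components_def loops same by (simp add: length_remdups_card_conv)
  qed
  show ?thesis
    unfolding planar_tangle_def loops
    using incidence connected components euler by (simp add: length_remdups_card_conv strand_ends_eq)
qed

lemma planar_side_match:
  assumes "planar_tangle (loopless cs str reg)"
  shows "side_match cs str reg"
proof -
  have "\<forall>p \<in> points cs. \<forall>a \<in> flanks cs p.
      reg a = region_beside (loopless cs str reg) (str p) (shade cs a)"
    using assms by (simp add: planar_tangle_def shaded_incidence_def Let_def)
  then have *: "reg (flank cs p b) = region_beside (loopless cs str reg) (str p) b" if "p \<in> points cs" for p b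
    using flank_iff[OF that, of "flank cs p b" b] that by fastforce
  show ?thesis
    unfolding side_match_def by (simp add: *)
qed

section \<open>Composition of tangles without closed loops\<close>

text \<open>
  The composite of two tangles names the classes of glued strings (or regions).  If every class is
  visible at some place \<open>q\<close>, where it is reached through the element \<open>e q\<close> and has the name \<open>n q\<close>,
  then the names determine the required map, provided that equality of names is equivalence.
\<close>

lemma ex_gluing_map:
  assumes "\<And>q. q \<in> Q \<Longrightarrow> e q \<in> X"
    and cover: "\<And>x. x \<in> X \<Longrightarrow> \<exists>q \<in> Q. (e q, x) \<in> (E \<union> E\<inverse>)\<^sup>*"
    and names: "\<And>q q'. q \<in> Q \<Longrightarrow> q' \<in> Q \<Longrightarrow> n q = n q' \<longleftrightarrow> (e q, e q') \<in> (E \<union> E\<inverse>)\<^sup>*"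
  shows "\<exists>f. identifies E X (n ` Q) f \<and> (\<forall>q \<in> Q. f (e q) = n q)"
proof -
  let ?R = "(E \<union> E\<inverse>)\<^sup>*"
  have "sym ?R" by (intro sym_rtrancl) (auto simp: sym_def)
  then have sym: "(v, u) \<in> ?R" if "(u, v) \<in> ?R" for u v
    using that by (meson symD)
  define k where "k x = (SOME q. q \<in> Q \<and> (e q, x) \<in> ?R)" for x
  have k: "k x \<in> Q" "(e (k x), x) \<in> ?R" if "x \<in> X" for x
    using someI_ex[of "\<lambda>q. q \<in> Q \<and> (e q, x) \<in> ?R"] cover[OF that] unfolding k_def by blast+
  have fe: "n (k (e q)) = n q" if "q \<in> Q" for q
    using names[OF k(1)[OF assms(1)[OF that]] that] k(2)[OF assms(1)[OF that]] by blast
  have eq: "n (k x) = n (k y) \<longleftrightarrow> (x, y) \<in> ?R" if "x \<in> X" "y \<in> X" for x y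
  proof -
    have "(e (k x), e (k y)) \<in> ?R \<longleftrightarrow> (x, y) \<in> ?R"
      using k(2)[OF that(1)] k(2)[OF that(2)] sym by (meson rtrancl_trans)
    then show ?thesis using names[OF k(1)[OF that(1)] k(1)[OF that(2)]] by simp
  qed
  have "(\<lambda>x. n (k x)) ` X = n ` Q"
  proof (intro subset_antisym subsetI)
    fix y assume "y \<in> n ` Q"
    then obtain q where "q \<in> Q" "y = n q" by blast
    then have "y = n (k (e q))" "e q \<in> X" using fe assms(1) by simp_all
    then show "y \<in> (\<lambda>x. n (k x)) ` X" by blast
  qed (use k(1) in blast)
  then show ?thesis
    unfolding identifies_def using fe eq by (intro exI[of _ "\<lambda>x. n (k x)"]) blast
qed

lemma identifiesD:
  "identifies E X Y f \<Longrightarrow> x \<in> X \<Longrightarrow> y \<in> X \<Longrightarrow> f x = f y \<longleftrightarrow> (x, y) \<in> (E \<union> E\<inverse>)\<^sup>*"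
  unfolding identifies_def by blast

text \<open>
  Where a disc of the composite comes from if a tangle with \<open>m\<close> discs, the outer one included, is
  glued into disc \<open>i\<close>: the \<open>m - 1\<close> inner discs of the glued tangle occupy the numbers from \<open>i\<close> to
  \<open>i + m - 2\<close>, and the later discs are shifted by \<open>m - 2\<close>.
\<close>

definition origin :: "nat \<Rightarrow> nat \<Rightarrow> nat \<times> nat \<Rightarrow> nat \<times> nat + nat \<times> nat" where
  "origin i m q = (if fst q < i then Inl q
     else if Suc (fst q) < i + m then Inr (Suc (fst q) - i, snd q)
     else Inl (fst q + 2 - m, snd q))"

text \<open>
  Whether \<open>u\<close> and \<open>v\<close> identify the same elements of the list, tested without forming all pairs.
\<close>

definition matching :: "('q \<Rightarrow> 'x) \<Rightarrow> ('q \<Rightarrow> 'n) \<Rightarrow> 'q list \<Rightarrow> bool" where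
  "matching u v qs \<longleftrightarrow> (let ls = remdups (map (\<lambda>q. (u q, v q)) qs) in
     distinct (map fst ls) \<and> distinct (map snd ls))"

lemma matchingD:
  assumes "matching u v qs" "q \<in> set qs" "q' \<in> set qs"
  shows "u q = u q' \<longleftrightarrow> v q = v q'"
proof -
  have inj: "inj_on fst ((\<lambda>q. (u q, v q)) ` set qs)" "inj_on snd ((\<lambda>q. (u q, v q)) ` set qs)"
    using assms(1) by (simp_all add: matching_def Let_def distinct_map)
  have mem: "(u q, v q) \<in> (\<lambda>q. (u q, v q)) ` set qs" "(u q', v q') \<in> (\<lambda>q. (u q, v q)) ` set qs"
    using assms(2,3) by simp_all
  show ?thesis
    using inj_onD[OF inj(1) _ mem] inj_onD[OF inj(2) _ mem] by (metis fst_conv snd_conv)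
qed

definition glue_check ::
  "('q \<Rightarrow> 'x) \<Rightarrow> ('q \<Rightarrow> 'n) \<Rightarrow> 'q list \<Rightarrow> 'x list \<Rightarrow> ('x \<times> 'x) list \<Rightarrow> bool" where
  "glue_check e n qs xs es \<longleftrightarrow>
     (\<forall>q \<in> set qs. e q \<in> set xs) \<and>
     (let l = classes xs es in
      matching (\<lambda>q. lab l (e q)) n qs \<and> set (map snd l) \<subseteq> set (remdups (map (\<lambda>q. lab l (e q)) qs)))"

lemma glue_checkD:
  assumes "glue_check e n qs xs es" "distinct xs" and es: "set es \<subseteq> set xs \<times> set xs"
  shows "\<exists>f. identifies (set es) (set xs) (n ` set qs) f \<and> (\<forall>q \<in> set qs. f (e q) = n q)"
proof (rule ex_gluing_map)
  let ?l = "classes xs es" and ?R = "(set es \<union> (set es)\<inverse>)\<^sup>*"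
  have e: "\<And>q. q \<in> set qs \<Longrightarrow> e q \<in> set xs"
    and match: "matching (\<lambda>q. lab ?l (e q)) n qs"
    and sub: "set (map snd ?l) \<subseteq> set (remdups (map (\<lambda>q. lab ?l (e q)) qs))"
    using assms(1) unfolding glue_check_def Let_def by blast+
  show "e q \<in> set xs" if "q \<in> set qs" for q by (rule e[OF that])
  show "\<exists>q \<in> set qs. (e q, x) \<in> ?R" if x: "x \<in> set xs" for x
  proof -
    have "lab ?l x \<in> set (map snd ?l)" unfolding set_class_labels[OF assms(2)] by (rule imageI[OF x])
    then obtain q where q: "q \<in> set qs" "lab ?l x = lab ?l (e q)"
      using sub unfolding set_remdups set_map by blast
    then show ?thesis using lab_classes_eq_iff[OF es e[OF q(1)] x] by metis
  qed
  show "n q = n q' \<longleftrightarrow> (e q, e q') \<in> ?R" if "q \<in> set qs" "q' \<in> set qs" for q q'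
    using matchingD[OF match that] lab_classes_eq_iff[OF es e[OF that(1)] e[OF that(2)]] by metis
qed

definition composite_check ::
  "colour list \<Rightarrow> (nat \<times> nat \<Rightarrow> nat) \<Rightarrow> (nat \<times> nat \<Rightarrow> nat) \<Rightarrow> nat \<Rightarrow>
   colour list \<Rightarrow> (nat \<times> nat \<Rightarrow> nat) \<Rightarrow> (nat \<times> nat \<Rightarrow> nat) \<Rightarrow>
   colour list \<Rightarrow> (nat \<times> nat \<Rightarrow> nat) \<Rightarrow> (nat \<times> nat \<Rightarrow> nat) \<Rightarrow> bool" where
  "composite_check cT sT rT i cS sS rS cR sR rR \<longleftrightarrow>
     1 \<le> i \<and> i < length cT \<and> cS \<noteq> [] \<and> cT ! i = cS ! 0 \<and>
     cR = take i cT @ tl cS @ drop (Suc i) cT \<and>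
     glue_check (\<lambda>q. map_sum sT sS (origin i (length cS) q)) sR (point_list cR)
       (map Inl (remdups (map sT (point_list cT))) @ map Inr (remdups (map sS (point_list cS))))
       (map (\<lambda>j. (Inl (sT (i, j)), Inr (sS (0, j)))) [0..<2 * fst (cS ! 0)]) \<and>
     glue_check (\<lambda>q. map_sum rT rS (origin i (length cS) q)) rR (interval_list cR)
       (map Inl (remdups (map rT (interval_list cT))) @ map Inr (remdups (map rS (interval_list cS))))
       (map (\<lambda>j. (Inl (rT (i, j)), Inr (rS (0, j)))) [0..<max 1 (2 * fst (cS ! 0))])"

lemma origin_outer:
  assumes "d < i \<or> i < d" "m \<ge> 1" "1 \<le> i"
  shows "origin i m (if d < i then d else d + m - 2, j) = Inl (d, j)"
  using assms by (auto simp: origin_def)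

lemma origin_inner:
  assumes "1 \<le> d" "d < m" "1 \<le> i"
  shows "origin i m (i + d - 1, j) = Inr (d, j)"
  using assms by (auto simp: origin_def)

lemma nth_insert_outer:
  assumes "d < i \<or> i < d" "d < length cT" "i < length cT" "cS \<noteq> []" "1 \<le> i"
  defines "d' \<equiv> if d < i then d else d + length cS - 2"
  shows "(take i cT @ tl cS @ drop (Suc i) cT) ! d' = cT ! d"
    "d' < length (take i cT @ tl cS @ drop (Suc i) cT)"
  using assms by (cases cS; auto simp: nth_append Suc_diff_Suc)+

lemma nth_insert_inner:
  assumes "1 \<le> d" "d < length cS" "i < length cT" "1 \<le> i"
  shows "(take i cT @ tl cS @ drop (Suc i) cT) ! (i + d - 1) = cS ! d"
    "i + d - 1 < length (take i cT @ tl cS @ drop (Suc i) cT)"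
  using assms by (auto simp: nth_append nth_tl)

lemma flank_shift:
  assumes "cs ! d = cs' ! d'"
  shows "flank cs (d, j) b = (d, k) \<longleftrightarrow> flank cs' (d', j) b = (d', k)"
  using assms by (auto simp: flank_def shade_def next_interval_def)

lemma fst_flank: "fst (flank cs p b) = fst p"
  by (simp add: flank_def next_interval_def)

text \<open>
  Strings and regions are compared at the discs of the composite only.  The condition on the regions
  beside the strings follows: it is invariant under gluing, because two strings that meet at a point of
  the glued disc have there the same flanking intervals, whose regions are identified; and each glued
  string ends at a disc of the composite, where the sides can be read off.
\<close>

theorem composite_loopless:
  assumes "planar_tangle (loopless cT sT rT)" "planar_tangle (loopless cS sS rS)"
    "planar_tangle (loopless cR sR rR)" "composite_check cT sT rT i cS sS rS cR sR rR"
  shows "composite (loopless cT sT rT) i (loopless cS sS rS) (loopless cR sR rR)"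
proof -
  let ?T = "loopless cT sT rT" and ?S = "loopless cS sS rS" and ?R = "loopless cR sR rR"
  define posT where "posT d = (if d < i then d else d + length cS - 2)" for d
  define posS where "posS d = i + d - 1" for d
  let ?o = "origin i (length cS)"
  define Es :: "((nat + nat) \<times> (nat + nat)) set" where "Es = {(Inl (sT (i, j)), Inr (sS (0, j))) | j. (0, j) \<in> points cS}"
  define Er :: "((nat + nat) \<times> (nat + nat)) set" where "Er = {(Inl (rT (i, j)), Inr (rS (0, j))) | j. (0, j) \<in> intervals cS}"
  let ?Xs = "sT ` points cT <+> sS ` points cS" and ?Xr = "rT ` intervals cT <+> rS ` intervals cS"
  have i: "1 \<le> i" "i < length cT" and ne: "cS \<noteq> []" and ci: "cT ! i = cS ! 0"
    and cR: "cR = take i cT @ tl cS @ drop (Suc i) cT"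
    using assms(4) unfolding composite_check_def by blast+
  note smT = planar_side_match[OF assms(1)] and smS = planar_side_match[OF assms(2)]
    and smR = planar_side_match[OF assms(3)]
  have pR: "(posT d, j) \<in> points cR" "?o (posT d, j) = Inl (d, j)" "cR ! posT d = cT ! d"
    if "(d, j) \<in> points cT" "d \<noteq> i" for d j
    using that nth_insert_outer[of d i cT cS] i ne origin_outer[of d i "length cS" j]
    unfolding cR posT_def by (auto simp: points_def Suc_le_eq)
  have iR: "(posT d, j) \<in> intervals cR" "?o (posT d, j) = Inl (d, j)"
    if "(d, j) \<in> intervals cT" "d \<noteq> i" for d j
    using that nth_insert_outer[of d i cT cS] i ne origin_outer[of d i "length cS" j]
    unfolding cR posT_def by (auto simp: intervals_def Suc_le_eq)
  have pR': "(posS d, j) \<in> points cR" "?o (posS d, j) = Inr (d, j)" "cR ! posS d = cS ! d"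
    if "(d, j) \<in> points cS" "d \<noteq> 0" for d j
    using that nth_insert_inner[of d cS i cT] i origin_inner[of d "length cS" i j]
    unfolding cR posS_def by (auto simp: points_def Suc_le_eq)
  have iR': "(posS d, j) \<in> intervals cR" "?o (posS d, j) = Inr (d, j)"
    if "(d, j) \<in> intervals cS" "d \<noteq> 0" for d j
    using that nth_insert_inner[of d cS i cT] i origin_inner[of d "length cS" i j]
    unfolding cR posS_def by (auto simp: intervals_def Suc_le_eq)
  have origin_cases: "(\<exists>d j. (d, j) \<in> points cT \<and> d \<noteq> i \<and> q = (posT d, j)) \<or>
      (\<exists>d j. (d, j) \<in> points cS \<and> d \<noteq> 0 \<and> q = (posS d, j))" if q: "q \<in> points cR" for q
  proof -
    obtain k j where kj: "q = (k, j)" by (cases q)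
    have k: "k < length cR" "j < 2 * fst (cR ! k)" using q kj by (auto simp: points_def)
    have len: "length cR = length cT + length cS - 2" using i ne by (simp add: cR) (cases cS; simp)
    consider "k < i" | "i \<le> k" "Suc k < i + length cS" | "i + length cS \<le> Suc k" by linarith
    then show ?thesis
    proof cases
      case 1
      then have "(k, j) \<in> points cT" "k \<noteq> i" "posT k = k"
        using k i by (auto simp: points_def posT_def cR nth_append)
      then show ?thesis using kj by metis
    next
      case 2
      let ?d = "Suc k - i"
      have d: "1 \<le> ?d" "?d < length cS" "posS ?d = k" using 2 i by (auto simp: posS_def)
      then have "cR ! k = cS ! ?d" using nth_insert_inner(1)[OF d(1,2) i(2,1)] by (simp add: cR posS_def)
      then have "(?d, j) \<in> points cS" using d k by (simp add: points_def)
      then show ?thesis using d kj by (metis not_one_le_zero)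
    next
      case 3
      let ?d = "k + 2 - length cS"
      have l: "length cS \<ge> 1" using ne by (simp add: Suc_le_eq)
      have d: "i < ?d" "?d < length cT" "posT ?d = k" using 3 k len l i by (auto simp: posT_def)
      then have "cR ! k = cT ! ?d"
        using nth_insert_outer(1)[of ?d i cT cS] i ne by (simp add: cR posT_def)
      then have "(?d, j) \<in> points cT" using d k by (simp add: points_def)
      then show ?thesis using d kj by (metis less_irrefl)
    qed
  qed
  have S0: "(i, j) \<in> points cT" if "(0, j) \<in> points cS" for j
    using that i ci by (auto simp: points_def)
  have S0': "(i, j) \<in> intervals cT" if "(0, j) \<in> intervals cS" for j
    using that i ci by (auto simp: intervals_def)
  obtain f where f: "identifies Es ?Xs (sR ` points cR) f"
    and fq: "\<And>q. q \<in> points cR \<Longrightarrow> f (map_sum sT sS (?o q)) = sR q"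
  proof -
    let ?es = "map (\<lambda>j. (Inl (sT (i, j)), Inr (sS (0, j)))) [0..<2 * fst (cS ! 0)]"
    let ?xs = "map Inl (remdups (map sT (point_list cT))) @ map Inr (remdups (map sS (point_list cS)))"
    have es: "set ?es = Es" using ne by (force simp: points_def Es_def)
    have xs: "set ?xs = ?Xs" by (auto simp: set_point_list)
    have "set ?es \<subseteq> set ?xs \<times> set ?xs" unfolding es xs Es_def using S0 by auto
    moreover have "glue_check (\<lambda>q. map_sum sT sS (?o q)) sR (point_list cR) ?xs ?es"
      using assms(4) unfolding composite_check_def by blast
    moreover have "distinct ?xs" by (auto simp: distinct_map)
    ultimately show thesis
      using glue_checkD[of "\<lambda>q. map_sum sT sS (?o q)" sR "point_list cR" ?xs ?es] that
      unfolding es xs set_point_list by blast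
  qed
  obtain g where g: "identifies Er ?Xr (rR ` intervals cR) g"
    and gq: "\<And>q. q \<in> intervals cR \<Longrightarrow> g (map_sum rT rS (?o q)) = rR q"
  proof -
    let ?es = "map (\<lambda>j. (Inl (rT (i, j)), Inr (rS (0, j)))) [0..<max 1 (2 * fst (cS ! 0))]"
    let ?xs = "map Inl (remdups (map rT (interval_list cT))) @ map Inr (remdups (map rS (interval_list cS)))"
    have es: "set ?es = Er" using ne by (force simp: intervals_def Er_def)
    have xs: "set ?xs = ?Xr" by (auto simp: set_interval_list)
    have "set ?es \<subseteq> set ?xs \<times> set ?xs" unfolding es xs Er_def using S0' by auto
    moreover have "glue_check (\<lambda>q. map_sum rT rS (?o q)) rR (interval_list cR) ?xs ?es"
      using assms(4) unfolding composite_check_def by blast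
    moreover have "distinct ?xs" by (auto simp: distinct_map)
    ultimately show thesis
      using glue_checkD[of "\<lambda>q. map_sum rT rS (?o q)" rR "interval_list cR" ?xs ?es] that
      unfolding es xs set_interval_list by blast
  qed
  define side where "side x b = map_sum (\<lambda>t. region_beside ?T t b) (\<lambda>t. region_beside ?S t b) x" for x b
  have side_Inl: "side (Inl (sT p)) b = Inl (rT (flank cT p b))" if "p \<in> points cT" for p b
    by (simp add: side_def region_beside_loopless[OF smT that])
  have side_Inr: "side (Inr (sS p)) b = Inr (rS (flank cS p b))" if "p \<in> points cS" for p b
    by (simp add: side_def region_beside_loopless[OF smS that])
  have side_eq: "g (side x b) = g (side y b)" if xy: "(x, y) \<in> Es" for x y b
  proof -
    obtain j where j: "(0, j) \<in> points cS" "x = Inl (sT (i, j))" "y = Inr (sS (0, j))"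
      using xy unfolding Es_def by blast
    obtain k where k: "flank cS (0, j) b = (0, k)" by (metis fst_conv fst_flank surj_pair)
    then have k': "flank cT (i, j) b = (i, k)" using flank_shift[of cT i cS 0 j b k] ci by simp
    have k0: "(0, k) \<in> intervals cS" using flank_in_intervals[OF j(1), of b] k by simp
    then have "(Inl (rT (i, k)), Inr (rS (0, k))) \<in> Er"
      unfolding Er_def by (intro CollectI exI[of _ k]) simp
    then have "(Inl (rT (i, k)), Inr (rS (0, k))) \<in> (Er \<union> Er\<inverse>)\<^sup>*"
      by (intro r_into_rtrancl UnI1)
    moreover have "Inl (rT (i, k)) \<in> ?Xr" "Inr (rS (0, k)) \<in> ?Xr"
      using S0'[OF k0] k0 by - (intro InlI InrI imageI, assumption)+
    ultimately have "g (Inl (rT (i, k))) = g (Inr (rS (0, k)))"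
      using identifiesD[OF g] by simp
    then show ?thesis
      unfolding j(2,3) side_Inl[OF S0[OF j(1)]] side_Inr[OF j(1)] k k' .
  qed
  have chain: "g (side x b) = g (side y b)" if "(x, y) \<in> (Es \<union> Es\<inverse>)\<^sup>*" for x y b
    using that
  proof (induction rule: rtrancl_induct)
    case (step y z)
    then have "g (side y b) = g (side z b)"
      using side_eq[of y z b] side_eq[of z y b] by auto
    then show ?case using step.IH by simp
  qed simp
  have at_point: "g (side (map_sum sT sS (?o q)) b) = rR (flank cR q b)" if q: "q \<in> points cR" for q b
    using origin_cases[OF q]
  proof (elim disjE exE conjE)
    fix d j assume d: "(d, j) \<in> points cT" "d \<noteq> i" "q = (posT d, j)"
    obtain k where k: "flank cT (d, j) b = (d, k)" by (metis fst_conv fst_flank surj_pair)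
    then have k': "flank cR q b = (posT d, k)"
      using flank_shift[of cR "posT d" cT d j b k] pR(3)[OF d(1,2)] d(3) by simp
    have "(d, k) \<in> intervals cT" using flank_in_intervals[OF d(1), of b] k by simp
    then show ?thesis
      using gq[of "(posT d, k)"] iR[of d k] d(2) k k' pR(2)[OF d(1,2)] d(3) side_Inl[OF d(1)] by simp
  next
    fix d j assume d: "(d, j) \<in> points cS" "d \<noteq> 0" "q = (posS d, j)"
    obtain k where k: "flank cS (d, j) b = (d, k)" by (metis fst_conv fst_flank surj_pair)
    then have k': "flank cR q b = (posS d, k)"
      using flank_shift[of cR "posS d" cS d j b k] pR'(3)[OF d(1,2)] d(3) by simp
    have "(d, k) \<in> intervals cS" using flank_in_intervals[OF d(1), of b] k by simp
    then show ?thesis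
      using gq[of "(posS d, k)"] iR'[of d k] d(2) k k' pR'(2)[OF d(1,2)] d(3) side_Inr[OF d(1)] by simp
  qed
  have beside: "region_beside ?R (f x) b = g (side x b)" if x: "x \<in> ?Xs" for x b
  proof -
    have "f x \<in> sR ` points cR" using f x unfolding identifies_def by blast
    then obtain q where q: "q \<in> points cR" "f x = sR q" by blast
    have o: "map_sum sT sS (?o q) \<in> ?Xs"
      using origin_cases[OF q(1)] pR(2) pR'(2) by fastforce
    have "f (map_sum sT sS (?o q)) = f x" using fq[OF q(1)] q(2) by simp
    then have "(map_sum sT sS (?o q), x) \<in> (Es \<union> Es\<inverse>)\<^sup>*"
      using identifiesD[OF f o x] by simp
    then have "g (side x b) = rR (flank cR q b)"
      using chain at_point[OF q(1)] by metis
    then show ?thesis using region_beside_loopless[OF smR q(1)] q(2) by simp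
  qed
  have s1: "sR (posT d, j) = f (Inl (sT (d, j)))" if "(d, j) \<in> points cT" "d \<noteq> i" for d j
    using fq[OF pR(1)[OF that]] pR(2)[OF that] by simp
  have s2: "sR (posS d, j) = f (Inr (sS (d, j)))" if "(d, j) \<in> points cS" "d \<noteq> 0" for d j
    using fq[OF pR'(1)[OF that]] pR'(2)[OF that] by simp
  have r1: "rR (posT d, j) = g (Inl (rT (d, j)))" if "(d, j) \<in> intervals cT" "d \<noteq> i" for d j
    using gq[OF iR(1)[OF that]] iR(2)[OF that] by simp
  have r2: "rR (posS d, j) = g (Inr (rS (d, j)))" if "(d, j) \<in> intervals cS" "d \<noteq> 0" for d j
    using gq[OF iR'(1)[OF that]] iR'(2)[OF that] by simp
  have b1: "region_beside ?R (f (Inl t)) b = g (Inl (region_beside ?T t b))" if "t \<in> sT ` points cT" for t b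
    using beside[OF InlI[OF that], of b] by (simp add: side_def)
  have b2: "region_beside ?R (f (Inr t)) b = g (Inr (region_beside ?S t b))" if "t \<in> sS ` points cS" for t b
    using beside[OF InrI[OF that], of b] by (simp add: side_def)
  have "\<forall>(d, j) \<in> points cT. d \<noteq> i \<longrightarrow> sR (posT d, j) = f (Inl (sT (d, j)))" using s1 by auto
  moreover have "\<forall>(d, j) \<in> points cS. d \<noteq> 0 \<longrightarrow> sR (posS d, j) = f (Inr (sS (d, j)))" using s2 by auto
  moreover have "\<forall>(d, j) \<in> intervals cT. d \<noteq> i \<longrightarrow> rR (posT d, j) = g (Inl (rT (d, j)))" using r1 by auto
  moreover have "\<forall>(d, j) \<in> intervals cS. d \<noteq> 0 \<longrightarrow> rR (posS d, j) = g (Inr (rS (d, j)))" using r2 by auto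
  ultimately show ?thesis
    unfolding composite_def Let_def loopless_select posT_def[symmetric] posS_def[symmetric]
      Es_def[symmetric] Er_def[symmetric]
    using i ci cR f g b1 b2 by blast
qed

section \<open>Isotopy and reflection of tangles without closed loops\<close>

lemma ex_renaming:
  assumes "\<And>q q'. q \<in> Q \<Longrightarrow> q' \<in> Q \<Longrightarrow> u q = u q' \<longleftrightarrow> v q = v q'"
  shows "\<exists>f. bij_betw f (u ` Q) (v ` Q) \<and> (\<forall>q \<in> Q. f (u q) = v q)"
proof -
  define f where "f t = v (SOME q. q \<in> Q \<and> u q = t)" for t
  have f: "f (u q) = v q" if "q \<in> Q" for q
  proof -
    have "(SOME q'. q' \<in> Q \<and> u q' = u q) \<in> Q \<and> u (SOME q'. q' \<in> Q \<and> u q' = u q) = u q"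
      by (rule someI[of "\<lambda>q'. q' \<in> Q \<and> u q' = u q" q]) (simp add: that)
    then show ?thesis unfolding f_def using assms that by blast
  qed
  have "bij_betw f (u ` Q) (v ` Q)"
  proof (rule bij_betw_imageI)
    show "inj_on f (u ` Q)"
    proof (rule inj_onI, elim imageE)
      fix x y q q' assume "f x = f y" "x = u q" "q \<in> Q" "y = u q'" "q' \<in> Q"
      then show "x = y" using f assms by simp
    qed
    show "f ` u ` Q = v ` Q" unfolding image_image by (rule image_cong[OF refl f])
  qed
  with f show ?thesis by blast
qed

definition isotopy_check ::
  "(nat \<Rightarrow> nat) \<Rightarrow> colour list \<Rightarrow> (nat \<times> nat \<Rightarrow> nat) \<Rightarrow> (nat \<times> nat \<Rightarrow> nat) \<Rightarrow>
   colour list \<Rightarrow> (nat \<times> nat \<Rightarrow> nat) \<Rightarrow> (nat \<times> nat \<Rightarrow> nat) \<Rightarrow> bool" where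
  "isotopy_check \<sigma> cs str reg cs' str' reg' \<longleftrightarrow>
     \<sigma> 0 = 0 \<and> length cs' = length cs \<and>
     (\<forall>d \<in> set [0..<length cs]. d \<in> set (map \<sigma> [0..<length cs]) \<and>
        \<sigma> d \<in> set [0..<length cs] \<and> cs' ! \<sigma> d = cs ! d) \<and>
     matching str (\<lambda>p. str' (map_prod \<sigma> id p)) (point_list cs) \<and>
     matching reg (\<lambda>a. reg' (map_prod \<sigma> id a)) (interval_list cs)"

lemma map_prod_indices:
  assumes "\<sigma> ` {..<length cs} = {..<length cs'}" "\<And>d. d < length cs \<Longrightarrow> cs' ! \<sigma> d = cs ! d"
  shows "map_prod \<sigma> id ` points cs = points cs'" "map_prod \<sigma> id ` intervals cs = intervals cs'"
proof -
  have "map_prod \<sigma> id ` {(d, i). d < length cs \<and> i < k (cs ! d)} =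
      {(d, i). d < length cs' \<and> i < k (cs' ! d)}" (is "?l = ?r") for k :: "colour \<Rightarrow> nat"
  proof (intro subset_antisym subsetI)
    fix z assume "z \<in> ?l"
    then obtain d i where "d < length cs" "i < k (cs ! d)" "z = (\<sigma> d, i)" by auto
    moreover from this have "\<sigma> d < length cs'" using assms(1) by blast
    ultimately show "z \<in> ?r" using assms(2) by simp
  next
    fix z assume "z \<in> ?r"
    then obtain e i where z: "z = (e, i)" "e < length cs'" "i < k (cs' ! e)" by auto
    moreover obtain d where d: "d < length cs" "e = \<sigma> d" using z(2) assms(1) by blast
    ultimately have "z = map_prod \<sigma> id (d, i)" "(d, i) \<in> {(d, i). d < length cs \<and> i < k (cs ! d)}"
      using assms(2) by simp_all
    then show "z \<in> ?l" by blast
  qed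
  from this[of "\<lambda>c. 2 * fst c"] this[of "\<lambda>c. max 1 (2 * fst c)"]
  show "map_prod \<sigma> id ` points cs = points cs'" "map_prod \<sigma> id ` intervals cs = intervals cs'"
    by (simp_all add: points_def intervals_def)
qed

theorem isotopic_loopless:
  assumes "planar_tangle (loopless cs str reg)" "planar_tangle (loopless cs' str' reg')"
    "isotopy_check \<sigma> cs str reg cs' str' reg'"
  shows "isotopic_via \<sigma> (loopless cs str reg) (loopless cs' str' reg')"
proof -
  let ?T = "loopless cs str reg" and ?T' = "loopless cs' str' reg'" and ?m = "map_prod \<sigma> id"
  note sm = planar_side_match[OF assms(1)] and sm' = planar_side_match[OF assms(2)]
  have zero: "\<sigma> 0 = 0" and len: "length cs' = length cs"
    and perm: "\<And>d. d \<in> set [0..<length cs] \<Longrightarrow> d \<in> set (map \<sigma> [0..<length cs]) \<and>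
        \<sigma> d \<in> set [0..<length cs] \<and> cs' ! \<sigma> d = cs ! d"
    and match: "matching str (\<lambda>p. str' (?m p)) (point_list cs)"
      "matching reg (\<lambda>a. reg' (?m a)) (interval_list cs)"
    using assms(3) unfolding isotopy_check_def by blast+
  note s = matchingD[OF match(1), unfolded set_point_list]
    and r = matchingD[OF match(2), unfolded set_interval_list]
  have col: "cs' ! \<sigma> d = cs ! d" if "d < length cs" for d using perm[of d] that by simp
  have surj: "\<sigma> ` {..<length cs} = {..<length cs'}"
  proof (intro subset_antisym subsetI)
    fix d assume "d \<in> \<sigma> ` {..<length cs}"
    then show "d \<in> {..<length cs'}" using perm len by auto
  next
    fix d assume "d \<in> {..<length cs'}"
    then show "d \<in> \<sigma> ` {..<length cs}" using perm[of d] len by (auto simp: atLeast0LessThan)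
  qed
  have "inj_on \<sigma> {..<length cs}" using surj len by (intro eq_card_imp_inj_on) simp_all
  then have bij: "bij_betw \<sigma> {..<length cs} {..<length cs'}" using surj by (simp add: bij_betw_def)
  have img: "?m ` points cs = points cs'" "?m ` intervals cs = intervals cs'"
    by (rule map_prod_indices[OF surj]; erule col)+
  obtain f where f: "bij_betw f (str ` points cs) (str' ` points cs')"
    and f_str: "\<And>p. p \<in> points cs \<Longrightarrow> f (str p) = str' (?m p)"
    using ex_renaming[of "points cs" str "\<lambda>p. str' (?m p)", OF s] unfolding img[symmetric] image_image by blast
  obtain g where g: "bij_betw g (reg ` intervals cs) (reg' ` intervals cs')"
    and g_reg: "\<And>p. p \<in> intervals cs \<Longrightarrow> g (reg p) = reg' (?m p)"
    using ex_renaming[of "intervals cs" reg "\<lambda>p. reg' (?m p)", OF r] unfolding img[symmetric] image_image by blast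
  have beside: "region_beside ?T' (f t) b = g (region_beside ?T t b)" if t: "t \<in> str ` points cs" for t b
  proof -
    obtain d i where p: "(d, i) \<in> points cs" "t = str (d, i)" using t by auto
    have p': "(\<sigma> d, i) \<in> points cs'" using p(1) unfolding img(1)[symmetric] by force
    obtain k where k: "flank cs (d, i) b = (d, k)" by (metis fst_conv fst_flank surj_pair)
    have "cs' ! \<sigma> d = cs ! d" using col p(1) by (simp add: points_def)
    then have "flank cs' (\<sigma> d, i) b = (\<sigma> d, k)" using flank_shift[of cs' "\<sigma> d" cs d i b k] k by simp
    moreover have "(d, k) \<in> intervals cs" using flank_in_intervals[OF p(1), of b] k by simp
    ultimately show ?thesis
      using f_str[OF p(1)] g_reg[of "(d, k)"] region_beside_loopless[OF sm p(1), of b]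
        region_beside_loopless[OF sm' p', of b] p(2) k by simp
  qed
  have "\<forall>(d, i) \<in> points cs. str' (\<sigma> d, i) = f (str (d, i))"
    "\<forall>(d, i) \<in> intervals cs. reg' (\<sigma> d, i) = g (reg (d, i))"
    using f_str g_reg by fastforce+
  then show ?thesis
    unfolding isotopic_via_def loopless_select using zero bij col f g beside by blast
qed

definition mirror_point :: "colour list \<Rightarrow> nat \<times> nat \<Rightarrow> nat \<times> nat" where
  "mirror_point cs p = (fst p, 2 * fst (cs ! fst p) - 1 - snd p)"

definition mirror_interval :: "colour list \<Rightarrow> nat \<times> nat \<Rightarrow> nat \<times> nat" where
  "mirror_interval cs a = (fst a, (2 * fst (cs ! fst a) - snd a) mod (2 * fst (cs ! fst a)))"

lemma mirror_point_involution:
  assumes "p \<in> points cs"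
  shows "mirror_point cs p \<in> points cs" "mirror_point cs (mirror_point cs p) = p"
  using assms by (auto simp: points_def mirror_point_def)

lemma mirror_interval_involution:
  assumes "a \<in> intervals cs"
  shows "mirror_interval cs a \<in> intervals cs" "mirror_interval cs (mirror_interval cs a) = a"
    "shade cs (mirror_interval cs a) = shade cs a"
proof -
  obtain d i where a: "a = (d, i)" "d < length cs" "i < max 1 (2 * fst (cs ! d))"
    using assms by (auto simp: intervals_def)
  then show "mirror_interval cs a \<in> intervals cs" "mirror_interval cs (mirror_interval cs a) = a"
    "shade cs (mirror_interval cs a) = shade cs a"
    by (cases "fst (cs ! d) = 0"; cases "i = 0"; auto simp: intervals_def mirror_interval_def shade_def)+
qed

lemma mirror_flank:
  assumes "p \<in> points cs"
  shows "flank cs (mirror_point cs p) b = mirror_interval cs (flank cs p b)"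
proof -
  obtain d i where p: "p = (d, i)" "d < length cs" "i < 2 * fst (cs ! d)"
    using assms by (auto simp: points_def)
  then have odd: "odd (2 * fst (cs ! d) - Suc i) \<longleftrightarrow> even i" by simp
  have last: "(2 * fst (cs ! d) - i) mod (2 * fst (cs ! d)) = Suc 0" if "Suc i = 2 * fst (cs ! d)"
  proof -
    have "2 * fst (cs ! d) - i = 1" "1 < 2 * fst (cs ! d)" using that by presburger+
    then show ?thesis by simp
  qed
  show ?thesis
    using p odd last by (cases "Suc i = 2 * fst (cs ! d)")
      (auto simp: flank_def shade_def next_interval_def mirror_point_def mirror_interval_def Suc_diff_Suc)
qed

text \<open>
  Reflection permutes the places at which strings and regions are read off and preserves the shades, so
  the regions beside a string are described by the same set of incidences as before.
\<close>

lemma reflect_loopless: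
  "reflect (loopless cs str reg) =
   loopless cs (\<lambda>p. str (mirror_point cs p)) (\<lambda>a. reg (mirror_interval cs a))"
proof -
  let ?str = "\<lambda>p. str (mirror_point cs p)" and ?reg = "\<lambda>a. reg (mirror_interval cs a)"
  have "mirror_point cs ` points cs = points cs"
    using mirror_point_involution[of _ cs] by force
  then have strings: "?str ` points cs = str ` points cs" by (metis image_image)
  have "mirror_interval cs ` intervals cs = intervals cs"
    using mirror_interval_involution[of _ cs] by force
  then have regions: "?reg ` intervals cs = reg ` intervals cs" by (metis image_image)
  have beside: "(\<exists>p \<in> points cs. \<exists>a \<in> flanks cs p. s p = t \<and> shade cs a = b \<and> r a = x) \<longleftrightarrow>
      (\<exists>p \<in> points cs. s p = t \<and> r (flank cs p b) = x)" for s r t b and x :: nat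
  proof (rule bex_cong[OF refl])
    fix p assume "p \<in> points cs"
    from flank_iff[OF this, of _ b]
    show "(\<exists>a \<in> flanks cs p. s p = t \<and> shade cs a = b \<and> r a = x) \<longleftrightarrow> s p = t \<and> r (flank cs p b) = x"
      by metis
  qed
  have "(\<exists>p \<in> points cs. str p = t \<and> reg (flank cs p b) = x) \<longleftrightarrow>
      (\<exists>p \<in> points cs. ?str p = t \<and> ?reg (flank cs p b) = x)" for t b x
    using mirror_point_involution[of _ cs] mirror_flank[of _ cs b] by metis
  then have besides: "(\<exists>p \<in> points cs. \<exists>a \<in> flanks cs p. str p = t \<and> shade cs a = b \<and> reg a = x) \<longleftrightarrow>
      (\<exists>p \<in> points cs. \<exists>a \<in> flanks cs p. ?str p = t \<and> shade cs a = b \<and> ?reg a = x)" for t b x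
    unfolding beside .
  show ?thesis
    unfolding reflect_def loopless_def Let_def besides strings regions
    by (simp add: mirror_point_def mirror_interval_def case_prod_unfold)
qed

section \<open>The tangles of the proof\<close>

definition tabular :: "colour list \<Rightarrow> nat list list \<Rightarrow> nat list list \<Rightarrow> tangle" where
  "tabular cs S R = loopless cs (\<lambda>(d, i). S ! d ! i) (\<lambda>(d, i). R ! d ! i)"

text \<open>
  The rotation by a quarter turn in the opposite direction.
\<close>

definition fourier_inv_tangle :: "bool \<Rightarrow> tangle" where
  "fourier_inv_tangle s = (let turn = (\<lambda>(d, i). if d = 0 then (i + 1) mod 4 else i) in
     loopless [(2, \<not> s), (2, s)] turn turn)"

text \<open>
  The Fourier transform of a product, drawn as a single tangle.
\<close>

definition fourier_mult :: "bool \<Rightarrow> tangle" where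
  "fourier_mult s = tabular [(2, \<not> s), (2, s), (2, s)]
     [[0, 1, 2, 3], [4, 5, 3, 0], [1, 2, 5, 4]]
     [[0, 1, 2, 3], [1, 4, 3, 0], [1, 2, 3, 4]]"

text \<open>
  The convolution of a rotated box with a second box: the stage between the two ways of drawing the
  Fourier transform of a product.
\<close>

definition conv_fourier :: "bool \<Rightarrow> tangle" where
  "conv_fourier s = tabular [(2, \<not> s), (2, s), (2, \<not> s)]
     [[0, 1, 2, 3], [4, 5, 3, 0], [4, 1, 2, 5]]
     [[0, 1, 2, 3], [1, 4, 3, 0], [4, 1, 2, 3]]"

text \<open>
  A triangle of 2-boxes: disc 1 is at the bottom, discs 2 and 3 are on top of it, left and right, and any
  two of them are joined by one string.  Of the six free ends two leave at the bottom and four at the top;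
  the rightmost of these four is bent down, so that the result is a 3-box.
\<close>

definition half_prism :: "bool \<Rightarrow> tangle" where
  "half_prism s = tabular [(3, s), (2, s), (2, s), (2, s)]
     [[0, 1, 2, 3, 4, 5], [6, 7, 4, 5], [0, 1, 8, 6], [2, 3, 7, 8]]
     [[0, 1, 2, 3, 4, 5], [0, 6, 4, 5], [0, 1, 2, 6], [2, 3, 4, 6]]"

text \<open>
  The closure of a product of two 2-boxes; from here on the tangle is unfolded by replacing the second
  box by a convolution and then each box by a product, until six boxes are visible.
\<close>

definition pairing2 :: "bool \<Rightarrow> tangle" where
  "pairing2 s = tabular [(0, s), (2, s), (2, s)]
     [[], [0, 1, 2, 3], [3, 2, 1, 0]]
     [[0], [0, 1, 2, 3], [0, 3, 2, 1]]"

definition triple_pairing :: "bool \<Rightarrow> tangle" where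
  "triple_pairing s = tabular [(0, s), (2, s), (2, s), (2, s)]
     [[], [0, 1, 2, 3], [3, 4, 5, 0], [4, 2, 1, 5]]
     [[0], [0, 1, 2, 3], [0, 3, 4, 1], [4, 3, 2, 1]]"

definition quadruple_pairing :: "bool \<Rightarrow> tangle" where
  "quadruple_pairing s = tabular [(0, s), (2, s), (2, s), (2, s), (2, s)]
     [[], [0, 1, 2, 3], [4, 5, 1, 0], [3, 6, 7, 4], [6, 2, 5, 7]]
     [[0], [0, 1, 2, 3], [0, 4, 2, 1], [0, 3, 5, 4], [5, 3, 2, 4]]"

definition quintuple_pairing :: "bool \<Rightarrow> tangle" where
  "quintuple_pairing s = tabular [(0, s), (2, s), (2, s), (2, s), (2, s), (2, s)]
     [[], [0, 1, 2, 3], [4, 5, 1, 0], [6, 7, 8, 4], [3, 9, 7, 6], [9, 2, 5, 8]]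
     [[0], [0, 1, 2, 3], [0, 4, 2, 1], [0, 5, 6, 4], [0, 3, 6, 5], [6, 3, 2, 4]]"

text \<open>
  The trace of \<open>(c c') ((u u') * (v v'))\<close> for the boxes \<open>c, c', u, u', v, v'\<close> in this order.  The
  triangles \<open>c', u, v\<close> and \<open>c, u', v'\<close> are joined to each other by six strings, two for each of the
  pairs \<open>c', c\<close> and \<open>u, u'\<close> and \<open>v, v'\<close>.
\<close>

definition prism :: "bool \<Rightarrow> tangle" where
  "prism s = tabular [(0, s), (2, s), (2, s), (2, s), (2, s), (2, s), (2, s)]
     [[], [0, 1, 2, 3], [4, 5, 1, 0], [6, 7, 8, 4], [3, 9, 7, 6], [10, 11, 5, 8], [9, 2, 11, 10]]
     [[0], [0, 1, 2, 3], [0, 4, 2, 1], [0, 5, 6, 4], [0, 3, 6, 5], [6, 7, 2, 4], [6, 3, 2, 7]]"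

text \<open>
  The closure of a product of two 3-boxes; below, a triangle is glued into the first box and its mirror
  image into the second one.
\<close>

definition pairing3 :: "bool \<Rightarrow> tangle" where
  "pairing3 s = tabular [(0, s), (3, s), (3, s)]
     [[], [0, 1, 2, 3, 4, 5], [5, 4, 3, 2, 1, 0]]
     [[0], [0, 1, 2, 3, 4, 5], [0, 5, 4, 3, 2, 1]]"

definition half_open_prism :: "bool \<Rightarrow> tangle" where
  "half_open_prism s = tabular [(0, s), (2, s), (2, s), (2, s), (3, s)]
     [[], [0, 1, 2, 3], [4, 5, 6, 0], [7, 8, 1, 6], [3, 2, 8, 7, 5, 4]]
     [[0], [0, 1, 2, 3], [0, 4, 5, 1], [5, 6, 2, 1], [0, 3, 2, 6, 5, 4]]"

definition mirror_prism :: "bool \<Rightarrow> tangle" where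
  "mirror_prism s = tabular [(0, s), (2, s), (2, s), (2, s), (2, s), (2, s), (2, s)]
     [[], [0, 1, 2, 3], [4, 5, 6, 0], [7, 8, 1, 6], [3, 2, 9, 10], [10, 11, 5, 4], [11, 9, 8, 7]]
     [[0], [0, 1, 2, 3], [0, 4, 5, 1], [5, 6, 2, 1], [0, 3, 2, 7], [0, 7, 5, 4], [5, 7, 2, 6]]"

text \<open>
  The checks are finite for either value of the shading \<open>s\<close>.
\<close>

lemma planar_fourier_tangle: "planar_tangle (fourier_tangle s)"
  unfolding fourier_tangle_def Let_def
  by (rule planar_loopless, induction s) code_simp+

lemma planar_fourier_inv_tangle: "planar_tangle (fourier_inv_tangle s)"
  unfolding fourier_inv_tangle_def Let_def
  by (rule planar_loopless, induction s) code_simp+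

lemma planar_conv_tangle: "planar_tangle (conv_tangle s)"
  unfolding conv_tangle_def
  by (rule planar_loopless, induction s) code_simp+

lemma planar_mult_tangle2: "planar_tangle (mult_tangle (2, s))"
  unfolding mult_tangle_def Let_def
  by (rule planar_loopless, induction s) code_simp+

lemma planar_closure_tangle2: "planar_tangle (closure_tangle (2, s))"
  unfolding closure_tangle_def
  by (rule planar_loopless, induction s) code_simp+

lemma planar_mult_tangle3: "planar_tangle (mult_tangle (3, s))"
  unfolding mult_tangle_def Let_def
  by (rule planar_loopless, induction s) code_simp+

lemma planar_closure_tangle3: "planar_tangle (closure_tangle (3, s))"
  unfolding closure_tangle_def
  by (rule planar_loopless, induction s) code_simp+

lemma planar_identity_tangle2: "planar_tangle (identity_tangle (2, s))"
  unfolding identity_tangle_def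
  by (rule planar_loopless, induction s) code_simp+

lemma planar_fourier_mult: "planar_tangle (fourier_mult s)"
  unfolding fourier_mult_def tabular_def
  by (rule planar_loopless, induction s) code_simp+

lemma planar_conv_fourier: "planar_tangle (conv_fourier s)"
  unfolding conv_fourier_def tabular_def
  by (rule planar_loopless, induction s) code_simp+

lemma planar_half_prism: "planar_tangle (half_prism s)"
  unfolding half_prism_def tabular_def
  by (rule planar_loopless, induction s) code_simp+

lemma planar_pairing2: "planar_tangle (pairing2 s)"
  unfolding pairing2_def tabular_def
  by (rule planar_loopless, induction s) code_simp+

lemma planar_triple_pairing: "planar_tangle (triple_pairing s)"
  unfolding triple_pairing_def tabular_def
  by (rule planar_loopless, induction s) code_simp+

lemma planar_quadruple_pairing: "planar_tangle (quadruple_pairing s)"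
  unfolding quadruple_pairing_def tabular_def
  by (rule planar_loopless, induction s) code_simp+

lemma planar_quintuple_pairing: "planar_tangle (quintuple_pairing s)"
  unfolding quintuple_pairing_def tabular_def
  by (rule planar_loopless, induction s) code_simp+

lemma planar_prism: "planar_tangle (prism s)"
  unfolding prism_def tabular_def
  by (rule planar_loopless, induction s) code_simp+

lemma planar_pairing3: "planar_tangle (pairing3 s)"
  unfolding pairing3_def tabular_def
  by (rule planar_loopless, induction s) code_simp+

lemma planar_half_open_prism: "planar_tangle (half_open_prism s)"
  unfolding half_open_prism_def tabular_def
  by (rule planar_loopless, induction s) code_simp+

lemma planar_mirror_prism: "planar_tangle (mirror_prism s)"
  unfolding mirror_prism_def tabular_def
  by (rule planar_loopless, induction s) code_simp+

lemma planar_reflect_half_prism: "planar_tangle (reflect (half_prism s))"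
  unfolding half_prism_def tabular_def reflect_loopless
  by (rule planar_loopless, induction s) code_simp+

lemma fourier_inv_composite:
  "composite (fourier_inv_tangle (\<not> s)) 1 (fourier_tangle s) (identity_tangle (2, s))"
  using planar_fourier_inv_tangle[of "\<not> s"] planar_fourier_tangle[of s] planar_identity_tangle2[of s]
  unfolding fourier_inv_tangle_def Let_def fourier_tangle_def identity_tangle_def
  by (rule composite_loopless) (induction s, code_simp+)

lemma fourier_composite_inv:
  "composite (fourier_tangle (\<not> s)) 1 (fourier_inv_tangle s) (identity_tangle (2, s))"
  using planar_fourier_tangle[of "\<not> s"] planar_fourier_inv_tangle[of s] planar_identity_tangle2[of s]
  unfolding fourier_tangle_def Let_def fourier_inv_tangle_def identity_tangle_def
  by (rule composite_loopless) (induction s, code_simp+)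

lemma fourier_mult_composite:
  "composite (fourier_tangle s) 1 (mult_tangle (2, s)) (fourier_mult s)"
  using planar_fourier_tangle[of s] planar_mult_tangle2[of s] planar_fourier_mult[of s]
  unfolding fourier_tangle_def Let_def mult_tangle_def fourier_mult_def tabular_def
  by (rule composite_loopless) (induction s, code_simp+)

lemma conv_fourier_composite:
  "composite (conv_tangle (\<not> s)) 1 (fourier_tangle s) (conv_fourier s)"
  using planar_conv_tangle[of "\<not> s"] planar_fourier_tangle[of s] planar_conv_fourier[of s]
  unfolding conv_tangle_def fourier_tangle_def Let_def conv_fourier_def tabular_def
  by (rule composite_loopless) (induction s, code_simp+)

lemma conv_fourier_fourier_composite:
  "composite (conv_fourier s) 2 (fourier_tangle s) (fourier_mult s)"
  using planar_conv_fourier[of s] planar_fourier_tangle[of s] planar_fourier_mult[of s]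
  unfolding conv_fourier_def tabular_def fourier_tangle_def Let_def fourier_mult_def
  by (rule composite_loopless) (induction s, code_simp+)

lemma pairing2_composite:
  "composite (closure_tangle (2, s)) 1 (mult_tangle (2, s)) (pairing2 s)"
  using planar_closure_tangle2[of s] planar_mult_tangle2[of s] planar_pairing2[of s]
  unfolding closure_tangle_def mult_tangle_def Let_def pairing2_def tabular_def
  by (rule composite_loopless) (induction s, code_simp+)

lemma triple_pairing_composite:
  "composite (pairing2 s) 2 (conv_tangle s) (triple_pairing s)"
  using planar_pairing2[of s] planar_conv_tangle[of s] planar_triple_pairing[of s]
  unfolding pairing2_def tabular_def conv_tangle_def triple_pairing_def
  by (rule composite_loopless) (induction s, code_simp+)

lemma quadruple_pairing_composite:
  "composite (triple_pairing s) 1 (mult_tangle (2, s)) (quadruple_pairing s)"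
  using planar_triple_pairing[of s] planar_mult_tangle2[of s] planar_quadruple_pairing[of s]
  unfolding triple_pairing_def tabular_def mult_tangle_def Let_def quadruple_pairing_def
  by (rule composite_loopless) (induction s, code_simp+)

lemma quintuple_pairing_composite:
  "composite (quadruple_pairing s) 3 (mult_tangle (2, s)) (quintuple_pairing s)"
  using planar_quadruple_pairing[of s] planar_mult_tangle2[of s] planar_quintuple_pairing[of s]
  unfolding quadruple_pairing_def tabular_def mult_tangle_def Let_def quintuple_pairing_def
  by (rule composite_loopless) (induction s, code_simp+)

lemma prism_composite:
  "composite (quintuple_pairing s) 5 (mult_tangle (2, s)) (prism s)"
  using planar_quintuple_pairing[of s] planar_mult_tangle2[of s] planar_prism[of s]
  unfolding quintuple_pairing_def tabular_def mult_tangle_def Let_def prism_def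
  by (rule composite_loopless) (induction s, code_simp+)

lemma pairing3_composite:
  "composite (closure_tangle (3, s)) 1 (mult_tangle (3, s)) (pairing3 s)"
  using planar_closure_tangle3[of s] planar_mult_tangle3[of s] planar_pairing3[of s]
  unfolding closure_tangle_def mult_tangle_def Let_def pairing3_def tabular_def
  by (rule composite_loopless) (induction s, code_simp+)

lemma half_open_prism_composite:
  "composite (pairing3 s) 1 (half_prism s) (half_open_prism s)"
  using planar_pairing3[of s] planar_half_prism[of s] planar_half_open_prism[of s]
  unfolding pairing3_def tabular_def half_prism_def half_open_prism_def
  by (rule composite_loopless) (induction s, code_simp+)

lemma mirror_prism_composite:
  "composite (half_open_prism s) 4 (reflect (half_prism s)) (mirror_prism s)"
  using planar_half_open_prism[of s] planar_reflect_half_prism[of s] planar_mirror_prism[of s]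
  unfolding half_open_prism_def tabular_def half_prism_def mirror_prism_def reflect_loopless
  by (rule composite_loopless) (induction s, code_simp+)

text \<open>
  Both tangles are the same prism; they differ in the numbering of the boxes, which is
  \<open>c, c', u, u', v, v'\<close> in one case and \<open>c', u, v, c, u', v'\<close> in the other.
\<close>

lemma prism_isotopic_mirror_prism:
  "isotopic_via (\<lambda>d. [0, 4, 1, 2, 5, 3, 6] ! d) (prism s) (mirror_prism s)"
  using planar_prism[of s] planar_mirror_prism[of s]
  unfolding prism_def mirror_prism_def tabular_def
  by (rule isotopic_loopless) (induction s, code_simp+)

lemma colours_tangles [simp]:
  "colours (fourier_tangle s) = [(2, \<not> s), (2, s)]"
  "colours (fourier_inv_tangle s) = [(2, \<not> s), (2, s)]"
  "colours (conv_tangle s) = [(2, s), (2, s), (2, s)]"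
  "colours (mult_tangle c) = [c, c, c]"
  "colours (closure_tangle c) = [(0, snd c), c]"
  "colours (identity_tangle c) = [c, c]"
  "colours (fourier_mult s) = [(2, \<not> s), (2, s), (2, s)]"
  "colours (conv_fourier s) = [(2, \<not> s), (2, s), (2, \<not> s)]"
  "colours (half_prism s) = [(3, s), (2, s), (2, s), (2, s)]"
  "colours (reflect (half_prism s)) = [(3, s), (2, s), (2, s), (2, s)]"
  "colours (pairing2 s) = [(0, s), (2, s), (2, s)]"
  "colours (triple_pairing s) = [(0, s), (2, s), (2, s), (2, s)]"
  "colours (quadruple_pairing s) = [(0, s), (2, s), (2, s), (2, s), (2, s)]"
  "colours (quintuple_pairing s) = [(0, s), (2, s), (2, s), (2, s), (2, s), (2, s)]"
  "colours (prism s) = [(0, s), (2, s), (2, s), (2, s), (2, s), (2, s), (2, s)]"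
  "colours (pairing3 s) = [(0, s), (3, s), (3, s)]"
  "colours (half_open_prism s) = [(0, s), (2, s), (2, s), (2, s), (3, s)]"
  "colours (mirror_prism s) = [(0, s), (2, s), (2, s), (2, s), (2, s), (2, s), (2, s)]"
  by (simp_all add: fourier_tangle_def fourier_inv_tangle_def conv_tangle_def mult_tangle_def
      closure_tangle_def identity_tangle_def fourier_mult_def conv_fourier_def half_prism_def
      pairing2_def triple_pairing_def quadruple_pairing_def quintuple_pairing_def prism_def
      pairing3_def half_open_prism_def mirror_prism_def tabular_def reflect_def Let_def)

section \<open>Fourier transform, convolution and the Schur product theorem\<close>

context planar_algebra
begin

lemma Z_glue:
  assumes "composite T i S R" "planar_tangle T" "planar_tangle S" "planar_tangle R"
    and "i = Suc (length us)" "valid_inputs P S ys" "valid_inputs P R (us @ ys @ vs)"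
  shows "Z T (us @ [Z S ys] @ vs) = Z R (us @ ys @ vs)"
  using Z_composite[OF assms(2-4) _ assms(6,7)] assms(1,5) by simp

lemma fourier_closed: "x \<in> P (2, s) \<Longrightarrow> fourier Z s x \<in> P (2, \<not> s)"
  using Z_closed[OF planar_fourier_tangle[of s], of "[x]"] by (simp add: valid_inputs_def fourier_def)

lemma convolution_closed: "u \<in> P (2, s) \<Longrightarrow> v \<in> P (2, s) \<Longrightarrow> convolution Z s u v \<in> P (2, s)"
  using Z_closed[OF planar_conv_tangle[of s], of "[u, v]"] by (simp add: valid_inputs_def convolution_def)

lemma pmult_closed: "u \<in> P (2, s) \<Longrightarrow> v \<in> P (2, s) \<Longrightarrow> pmult Z (2, s) u v \<in> P (2, s)"
  using Z_closed[OF planar_mult_tangle2[of s], of "[u, v]"] by (simp add: valid_inputs_def pmult_def)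

lemma fourier_linear:
  "x \<in> P (2, s) \<Longrightarrow> y \<in> P (2, s) \<Longrightarrow>
   fourier Z s (scale c x + y) = scale c (fourier Z s x) + fourier Z s y"
  using Z_multilinear[OF planar_fourier_tangle[of s], of "[]" x "[]" y c]
  by (simp add: valid_inputs_def fourier_def)

lemma fourier_inverse: "x \<in> P (2, s) \<Longrightarrow> Z (fourier_inv_tangle (\<not> s)) [fourier Z s x] = x"
  using Z_glue[OF fourier_inv_composite planar_fourier_inv_tangle planar_fourier_tangle
      planar_identity_tangle2, of "[]" s "[x]" "[]"] Z_identity[of x "(2, s)"]
  by (simp add: valid_inputs_def fourier_def)

lemma fourier_inj:
  assumes "x \<in> P (2, s)" "y \<in> P (2, s)" "fourier Z s x = fourier Z s y"
  shows "x = y"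
  using fourier_inverse[OF assms(1)] fourier_inverse[OF assms(2)] unfolding assms(3) by (rule trans[OF sym])

lemma fourier_surj:
  assumes "y \<in> P (2, \<not> s)"
  shows "\<exists>x \<in> P (2, s). fourier Z s x = y"
proof -
  let ?x = "Z (fourier_inv_tangle (\<not> s)) [y]"
  have "?x \<in> P (2, s)"
    using Z_closed[OF planar_fourier_inv_tangle[of "\<not> s"], of "[y]"] assms by (simp add: valid_inputs_def)
  moreover have "fourier Z s ?x = y"
    using Z_glue[OF fourier_composite_inv[of "\<not> s"] planar_fourier_tangle planar_fourier_inv_tangle
        planar_identity_tangle2, of "[]" "[y]" "[]"] Z_identity[OF assms] assms
    by (simp add: valid_inputs_def fourier_def)
  ultimately show ?thesis by blast
qed

text \<open>
  A quarter turn moves the lower factor to the left and the upper factor to the right.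
\<close>

lemma fourier_pmult:
  assumes "x \<in> P (2, s)" "y \<in> P (2, s)"
  shows "fourier Z s (pmult Z (2, s) x y) = convolution Z (\<not> s) (fourier Z s x) (fourier Z s y)"
proof -
  note closed = assms fourier_closed[OF assms(1)] fourier_closed[OF assms(2)]
  have "fourier Z s (pmult Z (2, s) x y) = Z (fourier_mult s) [x, y]"
    using Z_glue[OF fourier_mult_composite planar_fourier_tangle planar_mult_tangle2 planar_fourier_mult,
        of "[]" s "[x, y]" "[]"] closed
    by (simp add: valid_inputs_def fourier_def pmult_def)
  also have "\<dots> = Z (conv_fourier s) [x, fourier Z s y]"
    using Z_glue[OF conv_fourier_fourier_composite planar_conv_fourier planar_fourier_tangle planar_fourier_mult,
        of "[x]" s "[y]" "[]"] closed
    by (simp add: valid_inputs_def fourier_def)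
  also have "\<dots> = convolution Z (\<not> s) (fourier Z s x) (fourier Z s y)"
    using Z_glue[OF conv_fourier_composite planar_conv_tangle planar_fourier_tangle planar_conv_fourier,
        of "[]" s "[x]" "[fourier Z s y]"] closed
    by (simp add: valid_inputs_def fourier_def convolution_def)
  finally show ?thesis .
qed

lemma Z_prism:
  assumes "c \<in> P (2, s)" "c' \<in> P (2, s)" "u \<in> P (2, s)" "u' \<in> P (2, s)" "v \<in> P (2, s)" "v' \<in> P (2, s)"
  shows "Z (prism s) [c, c', u, u', v, v'] = Z (closure_tangle (2, s))
    [pmult Z (2, s) (pmult Z (2, s) c c') (convolution Z s (pmult Z (2, s) u u') (pmult Z (2, s) v v'))]"
proof -
  let ?m = "pmult Z (2, s)"
  have closed: "?m c c' \<in> P (2, s)" "?m u u' \<in> P (2, s)" "?m v v' \<in> P (2, s)"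
    "convolution Z s (?m u u') (?m v v') \<in> P (2, s)"
    using assms by (simp_all add: pmult_closed convolution_closed)
  have "Z (prism s) [c, c', u, u', v, v'] = Z (quintuple_pairing s) [c, c', u, u', ?m v v']"
    using Z_glue[OF prism_composite planar_quintuple_pairing planar_mult_tangle2 planar_prism,
        of "[c, c', u, u']" s "[v, v']" "[]"] assms
    by (simp add: valid_inputs_def pmult_def)
  also have "\<dots> = Z (quadruple_pairing s) [c, c', ?m u u', ?m v v']"
    using Z_glue[OF quintuple_pairing_composite planar_quadruple_pairing planar_mult_tangle2
        planar_quintuple_pairing, of "[c, c']" s "[u, u']" "[?m v v']"] assms closed
    by (simp add: valid_inputs_def pmult_def)
  also have "\<dots> = Z (triple_pairing s) [?m c c', ?m u u', ?m v v']"
    using Z_glue[OF quadruple_pairing_composite planar_triple_pairing planar_mult_tangle2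
        planar_quadruple_pairing, of "[]" s "[c, c']" "[?m u u', ?m v v']"] assms closed
    by (simp add: valid_inputs_def pmult_def)
  also have "\<dots> = Z (pairing2 s) [?m c c', convolution Z s (?m u u') (?m v v')]"
    using Z_glue[OF triple_pairing_composite planar_pairing2 planar_conv_tangle
        planar_triple_pairing, of "[?m c c']" s "[?m u u', ?m v v']" "[]"] closed
    by (simp add: valid_inputs_def convolution_def)
  also have "\<dots> = Z (closure_tangle (2, s)) [?m (?m c c') (convolution Z s (?m u u') (?m v v'))]"
    using Z_glue[OF pairing2_composite planar_closure_tangle2 planar_mult_tangle2 planar_pairing2,
        of "[]" s "[?m c c', convolution Z s (?m u u') (?m v v')]" "[]"] closed
    by (simp add: valid_inputs_def pmult_def)
  finally show ?thesis .
qed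

lemma Z_mirror_prism:
  assumes "c \<in> P (2, s)" "c' \<in> P (2, s)" "u \<in> P (2, s)" "u' \<in> P (2, s)" "v \<in> P (2, s)" "v' \<in> P (2, s)"
  shows "Z (mirror_prism s) [c', u, v, c, u', v'] = Z (closure_tangle (3, s))
    [pmult Z (3, s) (Z (half_prism s) [c', u, v]) (Z (reflect (half_prism s)) [c, u', v'])]"
proof -
  let ?w = "Z (half_prism s) [c', u, v]" and ?w' = "Z (reflect (half_prism s)) [c, u', v']"
  have closed: "?w \<in> P (3, s)" "?w' \<in> P (3, s)"
    using Z_closed[OF planar_half_prism[of s], of "[c', u, v]"]
      Z_closed[OF planar_reflect_half_prism[of s], of "[c, u', v']"] assms
    by (simp_all add: valid_inputs_def)
  have "Z (mirror_prism s) [c', u, v, c, u', v'] = Z (half_open_prism s) [c', u, v, ?w']"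
    using Z_glue[OF mirror_prism_composite planar_half_open_prism planar_reflect_half_prism
        planar_mirror_prism, of "[c', u, v]" s "[c, u', v']" "[]"] assms
    by (simp add: valid_inputs_def)
  also have "\<dots> = Z (pairing3 s) [?w, ?w']"
    using Z_glue[OF half_open_prism_composite planar_pairing3 planar_half_prism planar_half_open_prism,
        of "[]" s "[c', u, v]" "[?w']"] assms closed
    by (simp add: valid_inputs_def)
  also have "\<dots> = Z (closure_tangle (3, s)) [pmult Z (3, s) ?w ?w']"
    using Z_glue[OF pairing3_composite planar_closure_tangle3 planar_mult_tangle3 planar_pairing3,
        of "[]" s "[?w, ?w']" "[]"] closed
    by (simp add: valid_inputs_def pmult_def)
  finally show ?thesis .
qed

lemma prism_eq_mirror_prism:
  assumes "c \<in> P (2, s)" "c' \<in> P (2, s)" "u \<in> P (2, s)" "u' \<in> P (2, s)" "v \<in> P (2, s)" "v' \<in> P (2, s)"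
  shows "Z (prism s) [c, c', u, u', v, v'] = Z (mirror_prism s) [c', u, v, c, u', v']"
proof (rule Z_isotopy[OF planar_prism planar_mirror_prism prism_isotopic_mirror_prism, symmetric])
  fix d assume "1 \<le> d" "d \<le> length [c, c', u, u', v, v']"
  then have "d \<in> {1, 2, 3, 4, 5, 6}" by auto
  then show "[c', u, v, c, u', v'] ! ([0, 4, 1, 2, 5, 3, 6] ! d - 1) = [c, c', u, u', v, v'] ! (d - 1)"
    by auto
qed (use assms in \<open>simp_all add: valid_inputs_def\<close>)

end

context cstar_planar_algebra
begin

lemma tracial: "tracial_star_algebra scale (P c) (pmult Z c) (pone Z c) (star c) (tr c)"
proof -
  interpret fin_dim_cstar_algebra scale "P c" "pmult Z c" "pone Z c" "star c" by (rule cstar)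
  show ?thesis
    by unfold_locales (use tr_linear tr_trace tr_positive tr_faithful in blast)+
qed

lemma star_closed: "x \<in> P c \<Longrightarrow> star c x \<in> P c" and star_star: "x \<in> P c \<Longrightarrow> star c (star c x) = x"
  using fin_dim_cstar_algebra.star_closed[OF cstar] fin_dim_cstar_algebra.star_star[OF cstar] by blast+

text \<open>
  The reflection positivity behind the Schur product theorem.  Drawn as a closed diagram, the left hand
  side is a prism, symmetric under reflection in the plane between its triangles \<open>c\<^sup>*, u, v\<close> and
  \<open>c, u\<^sup>*, v\<^sup>*\<close>.  Cutting along that plane writes it as the pairing of a 3-box with its own adjoint.
\<close>

lemma tr_square_convolution:
  assumes c: "c \<in> P (2, s)" and u: "u \<in> P (2, s)" and v: "v \<in> P (2, s)"
  defines "m \<equiv> pmult Z (2, s)" and "st \<equiv> star (2, s)"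
  shows "tr (2, s) (m (m c (st c)) (convolution Z s (m u (st u)) (m v (st v)))) =
    tr (3, s) (pmult Z (3, s) (Z (half_prism s) [st c, u, v]) (star (3, s) (Z (half_prism s) [st c, u, v])))"
proof -
  let ?w = "Z (half_prism s) [st c, u, v]"
  have st: "st c \<in> P (2, s)" "st u \<in> P (2, s)" "st v \<in> P (2, s)" "st (st c) = c"
    using assms by (simp_all add: star_closed star_star)
  have w: "?w \<in> P (3, s)"
    using Z_closed[OF planar_half_prism[of s], of "[st c, u, v]"] assms st by (simp add: valid_inputs_def)
  then have ww: "pmult Z (3, s) ?w (star (3, s) ?w) \<in> P (3, s)"
    using fin_dim_cstar_algebra.mul_closed[OF cstar] star_closed by blast
  have w': "star (3, s) ?w = Z (reflect (half_prism s)) [c, st u, st v]"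
    using star_reflect[OF planar_half_prism[of s], of "[st c, u, v]"] st u v
    by (simp add: valid_inputs_def st_def)
  have "m (m c (st c)) (convolution Z s (m u (st u)) (m v (st v))) \<in> P (2, s)"
    using c u v st by (simp add: m_def pmult_closed convolution_closed)
  then have "tr (2, s) (m (m c (st c)) (convolution Z s (m u (st u)) (m v (st v)))) =
      tr (0, s) (Z (prism s) [c, st c, u, st u, v, st v])"
    using Z_prism[OF c st(1) u st(2) v st(3)] tr_closure[of _ "(2, s)"] by (simp add: m_def)
  also have "\<dots> = tr (0, s) (Z (closure_tangle (3, s)) [pmult Z (3, s) ?w (star (3, s) ?w)])"
    using prism_eq_mirror_prism[OF c st(1) u st(2) v st(3)] Z_mirror_prism[OF c st(1) u st(2) v st(3)]
    by (simp add: w')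
  also have "\<dots> = tr (3, s) (pmult Z (3, s) ?w (star (3, s) ?w))"
    using tr_closure[OF ww] by simp
  finally show ?thesis .
qed

text \<open>
  Schur product theorem.  By self-duality it suffices to pair the convolution with squares.
\<close>

theorem convolution_positive:
  assumes "positive P Z star (2, s) a" "positive P Z star (2, s) b"
  shows "positive P Z star (2, s) (convolution Z s a b)"
proof -
  interpret B: tracial_star_algebra scale "P (2, s)" "pmult Z (2, s)" "pone Z (2, s)" "star (2, s)" "tr (2, s)"
    by (rule tracial)
  obtain u v where uv: "u \<in> P (2, s)" "a = pmult Z (2, s) u (star (2, s) u)"
    "v \<in> P (2, s)" "b = pmult Z (2, s) v (star (2, s) v)"
    using assms unfolding positive_def by blast
  have "\<exists>w \<in> P (2, s). convolution Z s a b = pmult Z (2, s) w (star (2, s) w)"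
  proof (rule B.positive_cone_self_dual)
    show "convolution Z s a b \<in> P (2, s)"
      unfolding uv using uv(1,3) by (intro convolution_closed pmult_closed star_closed)
    fix c assume c: "c \<in> P (2, s)"
    let ?w = "Z (half_prism s) [star (2, s) c, u, v]"
    have w: "?w \<in> P (3, s)"
      using Z_closed[OF planar_half_prism[of s], of "[star (2, s) c, u, v]"] uv c star_closed
      by (simp add: valid_inputs_def)
    show "Im (tr (2, s) (pmult Z (2, s) (pmult Z (2, s) c (star (2, s) c)) (convolution Z s a b))) = 0 \<and>
        0 \<le> Re (tr (2, s) (pmult Z (2, s) (pmult Z (2, s) c (star (2, s) c)) (convolution Z s a b)))"
      unfolding uv tr_square_convolution[OF c uv(1,3)] by (rule tr_positive[OF w])
  qed
  then show ?thesis unfolding positive_def .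
qed

lemma F_positive_pmult:
  assumes "F_positive P Z star s x" "F_positive P Z star s y"
  shows "F_positive P Z star s (pmult Z (2, s) x y)"
  using assms convolution_positive[of "\<not> s"] fourier_pmult[of x s y] pmult_closed[of x s y]
  unfolding F_positive_def by simp

section \<open>F-positive eigenvectors\<close>

text \<open>
  The cone of \<open>F\<close>-positive elements is cut out by the functionals \<open>y \<mapsto> tr (u u\<^sup>* F(y))\<close>, and the
  powers of \<open>x\<close> belong to it by the Schur product theorem.  For \<open>x = 0\<close>, whose powers
  vanish, the equations hold for every \<open>y\<close>, and the preimage of the unit is a nonzero F-positive element.
\<close>

theorem F_positive_eigenvector:
  assumes x: "F_positive P Z star s x"
  defines "r \<equiv> spectral_radius scale (P (2, s)) (pmult Z (2, s)) (pone Z (2, s)) x"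
  shows "\<exists>y \<in> P (2, s). y \<noteq> 0 \<and> F_positive P Z star s y \<and>
    pmult Z (2, s) x y = scale (complex_of_real r) y \<and> pmult Z (2, s) y x = scale (complex_of_real r) y"
proof -
  interpret A: tracial_star_algebra scale "P (2, s)" "pmult Z (2, s)" "pone Z (2, s)" "star (2, s)" "tr (2, s)"
    by (rule tracial)
  interpret B: tracial_star_algebra scale "P (2, \<not> s)" "pmult Z (2, \<not> s)" "pone Z (2, \<not> s)"
    "star (2, \<not> s)" "tr (2, \<not> s)"
    by (rule tracial)
  let ?sq = "\<lambda>u. pmult Z (2, \<not> s) u (star (2, \<not> s) u)"
  have xP: "x \<in> P (2, s)" using x by (simp add: F_positive_def)
  have zero: "fourier Z s 0 = 0"
    using fourier_linear[OF A.zero_closed A.zero_closed, of 1] by simp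
  have sq: "?sq u \<in> P (2, \<not> s)" if "u \<in> P (2, \<not> s)" for u
    using that by (intro B.closed)
  show ?thesis
  proof (cases "x = 0")
    case True
    obtain y where y: "y \<in> P (2, s)" "fourier Z s y = pone Z (2, \<not> s)"
      using fourier_surj[OF B.one_closed] by blast
    have "y \<noteq> 0" using y(2) zero B.one_nonzero by auto
    moreover have "pone Z (2, \<not> s) = ?sq (pone Z (2, \<not> s))"
      by (simp add: B.star_one B.mul_one B.one_closed)
    then have "F_positive P Z star s y"
      unfolding F_positive_def positive_def y(2) using y(1) B.one_closed by blast
    moreover have "r = 0"
    proof -
      obtain p where p: "A.minimal_poly 0 p" using A.ex_minimal_poly[OF A.zero_closed] by blast
      obtain z where z: "poly p z = 0" "cmod z = r"
        using A.spectral_radius_root(2)[OF A.zero_closed p] unfolding r_def True by blast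
      have "scale z (A.peval 0 (synthetic_div p z)) = 0"
        using A.eigenvector(2)[OF A.zero_closed p z(1)] A.mul_zero_left[OF A.peval_closed[OF A.zero_closed]]
        by simp
      then show ?thesis using A.eigenvector(1)[OF A.zero_closed p z(1)] z(2) by simp
    qed
    ultimately show ?thesis using y(1) True by (auto simp: A.mul_zero_left A.mul_zero_right)
  next
    case False
    define \<Phi> where "\<Phi> = (\<lambda>u y. tr (2, \<not> s) (pmult Z (2, \<not> s) (?sq u) (fourier Z s y))) ` P (2, \<not> s)"
    have powers: "F_positive P Z star s (A.peval x (monom 1 (Suc n)))" for n
    proof (induction n)
      case 0
      have "A.peval x (monom 1 (Suc 0)) = x"
        using A.peval_X[OF xP] by (simp add: monom_Suc monom_0)
      then show ?case using x by simp
    next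
      case (Suc n)
      then show ?case using F_positive_pmult[OF x Suc] by (simp only: A.peval_monom_Suc[OF xP])
    qed
    have "\<exists>y \<in> P (2, s). y \<noteq> 0 \<and> pmult Z (2, s) x y = scale (of_real r) y \<and>
        pmult Z (2, s) y x = scale (of_real r) y \<and> (\<forall>\<phi> \<in> \<Phi>. Im (\<phi> y) = 0 \<and> 0 \<le> Re (\<phi> y))"
      unfolding r_def
    proof (rule A.perron_frobenius[OF xP False])
      fix \<phi> y z c assume "\<phi> \<in> \<Phi>" "y \<in> P (2, s)" "z \<in> P (2, s)"
      then show "\<phi> (scale c y + z) = c * \<phi> y + \<phi> z"
        using sq by (auto simp: \<Phi>_def fourier_linear fourier_closed B.mul_linear_right B.tr_linear B.mul_closed)
    next
      fix y assume y: "y \<in> P (2, s)" "\<And>\<phi>. \<phi> \<in> \<Phi> \<Longrightarrow> \<phi> y = 0"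
      have "fourier Z s y = 0"
        by (rule B.trace_form_nondegenerate[OF fourier_closed[OF y(1)]], rule y(2)) (simp add: \<Phi>_def)
      then show "y = 0" using fourier_inj[OF y(1) A.zero_closed] zero by simp
    next
      fix \<phi> n assume "\<phi> \<in> \<Phi>"
      then obtain u where u: "u \<in> P (2, \<not> s)"
        "\<phi> = (\<lambda>y. tr (2, \<not> s) (pmult Z (2, \<not> s) (?sq u) (fourier Z s y)))" by (auto simp: \<Phi>_def)
      obtain v where v: "v \<in> P (2, \<not> s)" "fourier Z s (A.peval x (monom 1 (Suc n))) = ?sq v"
        using powers[of n] unfolding F_positive_def positive_def by blast
      show "Im (\<phi> (A.peval x (monom 1 (Suc n)))) = 0 \<and> 0 \<le> Re (\<phi> (A.peval x (monom 1 (Suc n))))"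
        unfolding u(2) v(2) by (rule B.tr_square_square[OF u(1) v(1)])
    qed
    then obtain y where y: "y \<in> P (2, s)" "y \<noteq> 0" "pmult Z (2, s) x y = scale (of_real r) y"
      "pmult Z (2, s) y x = scale (of_real r) y" "\<And>\<phi>. \<phi> \<in> \<Phi> \<Longrightarrow> Im (\<phi> y) = 0 \<and> 0 \<le> Re (\<phi> y)" by blast
    have "\<exists>v \<in> P (2, \<not> s). fourier Z s y = ?sq v"
      by (rule B.positive_cone_self_dual[OF fourier_closed[OF y(1)]], rule y(5)) (simp add: \<Phi>_def)
    then have "F_positive P Z star s y" using y(1) unfolding F_positive_def positive_def by blast
    with y show ?thesis by blast
  qed
qed

text \<open>
  The Fourier transform is injective and carries the product to the convolution.
\<close>

lemma eigen_equations_iff: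
  assumes "x \<in> P (2, s)" "y \<in> P (2, s)"
  shows "pmult Z (2, s) x y = scale c y \<longleftrightarrow>
      convolution Z (\<not> s) (fourier Z s x) (fourier Z s y) = scale c (fourier Z s y)"
    and "pmult Z (2, s) y x = scale c y \<longleftrightarrow>
      convolution Z (\<not> s) (fourier Z s y) (fourier Z s x) = scale c (fourier Z s y)"
proof -
  interpret A: tracial_star_algebra scale "P (2, s)" "pmult Z (2, s)" "pone Z (2, s)" "star (2, s)" "tr (2, s)"
    by (rule tracial)
  have zero: "fourier Z s 0 = 0"
    using fourier_linear[OF A.zero_closed A.zero_closed, of 1] by simp
  have scale: "fourier Z s (scale c y) = scale c (fourier Z s y)"
    using fourier_linear[OF assms(2) A.zero_closed, of c] zero by simp
  have "u = scale c y \<longleftrightarrow> fourier Z s u = scale c (fourier Z s y)" if "u \<in> P (2, s)" for u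
    using fourier_inj[OF that A.scale_closed[OF assms(2), of c]] scale by auto
  then show "pmult Z (2, s) x y = scale c y \<longleftrightarrow>
      convolution Z (\<not> s) (fourier Z s x) (fourier Z s y) = scale c (fourier Z s y)"
    "pmult Z (2, s) y x = scale c y \<longleftrightarrow>
      convolution Z (\<not> s) (fourier Z s y) (fourier Z s x) = scale c (fourier Z s y)"
    using assms by (simp_all add: fourier_pmult pmult_closed flip: fourier_pmult)
qed

end

theorem proposition3p1:
  fixes scale :: "complex \<Rightarrow> 'a::ab_group_add \<Rightarrow> 'a"
    and P :: "colour \<Rightarrow> 'a set"
    and Z :: "tangle \<Rightarrow> 'a list \<Rightarrow> 'a"
    and star :: "colour \<Rightarrow> 'a \<Rightarrow> 'a"
    and tr :: "colour \<Rightarrow> 'a \<Rightarrow> complex"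
    and s :: bool and x :: 'a and r :: real
  assumes "cstar_planar_algebra scale P Z star tr"
    and "x \<in> P (2, s)"
    and "F_positive P Z star s x"
    and "r = spectral_radius scale (P (2, s)) (pmult Z (2, s)) (pone Z (2, s)) x"
  shows "(\<exists>y \<in> P (2, s). y \<noteq> 0 \<and> F_positive P Z star s y \<and>
            pmult Z (2, s) x y = scale (complex_of_real r) y \<and>
            pmult Z (2, s) y x = scale (complex_of_real r) y) \<and>
         (\<forall>y \<in> P (2, s).
            (pmult Z (2, s) x y = scale (complex_of_real r) y \<and>
             pmult Z (2, s) y x = scale (complex_of_real r) y) \<longleftrightarrow>
            (convolution Z (\<not> s) (fourier Z s x) (fourier Z s y)
               = scale (complex_of_real r) (fourier Z s y) \<and>
             convolution Z (\<not> s) (fourier Z s y) (fourier Z s x)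
               = scale (complex_of_real r) (fourier Z s y)))"
proof -
  interpret cstar_planar_algebra scale P Z star tr by (rule assms(1))
  show ?thesis
    unfolding assms(4) using F_positive_eigenvector[OF assms(3)] eigen_equations_iff[OF assms(2)] by blast
qed

end
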